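(* Fix an integer $k\ge 1$, a symmetric matrix $A\in\mathbb{R}^{k\times k}$ and $\beta>0$. For each integer $n>k$ let $X\in\mathbb{R}^{n\times k}$ be a random matrix distributed according to the $n$-vector model $p$ (defined in the context), and let $(Q,R)=\Phi(X)$ be the unique output of the Gram-Schmidt factorization $X=QR$ (defined almost surely). The following hold. (i) The matrices $Q$ and $R$ are statistically independent. (ii) The law of $Q$ is the uniform distribution on $O(n,k)$, i.e. $Q$ has the law of the first $k$ columns of a matrix drawn from the Haar measure of the orthogonal group $O(n)$. (iii) As $n\to\infty$, the law of $R$ concentrates to the delta measure on an upper-triangular matrix $R^{\star}\in\mathbb{R}^{k\times k}$ (not depending on $n$). Moreover, for any $b\in(0,1/2)$, $$\lim_{n\to\infty}\mathbb{P}\left[\lVert R-R^{\star}\rVert_F<n^{-1/2+b}\right]=1.$$ (iv) Let $S^{\star}_{\beta}$ be the optimal solution of $$\max_{S\in\mathbb{R}^{k\times k}}\ \beta\,\mathrm{tr}(AS)+\tfrac12\log\det(S)\quad\text{subject to } S\succeq 0,\ S_{ii}=1,\ i=1,\dots,k,$$ with the same $\beta$ as in $p$. The matrix $R^{\star}$ in (iii) is the unique right Cholesky factor of $S^{\star}_{\beta}$, i.e. $S^{\star}_{\beta}=(R^{\star})^{\top}R^{\star}$.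
   Context: The $n$-vector model $p$ with inverse temperature $\beta$ and interaction matrix $A$ is the probability distribution of $X=[X_1,\dots,X_k]$ (columns $X_i\in\mathbb{R}^n$) proportional to the unnormalized distribution function $$p(x_1,\dots,x_k)=\exp\Big(\beta n\sum_{i,j=1}^k\langle x_i,x_j\rangle A_{ij}\Big)\prod_{i=1}^k\delta(1-\lVert x_i\rVert^2);$$ equivalently, it is supported on $(\mathbb{S}^{n-1})^k$ with density proportional to the exponential factor with respect to the product of the uniform measures on the unit spheres $\mathbb{S}^{n-1}\subset\mathbb{R}^n$. $O(n,k)$ is the set of $n\times k$ matrices $Q$ with $Q^{\top}Q=I_k$. For $M\in\mathbb{R}^{n\times k}$ of full column rank, $\Phi(M)=(Q,R)$ denotes the unique pair with $M=QR$, $Q\in O(n,k)$, and $R\in\mathbb{R}^{k\times k}$ upper-triangular with positive diagonal entries. The right Cholesky factor of a positive definite $S$ is the unique upper-triangular $R$ with positive diagonal such that $S=R^{\top}R$. $\lVert\cdot\rVert_F$ is the Frobenius norm. $\log\det(S)=-\infty$ for singular $S\succeq 0$. The matrix variable $S$ ranges over symmetric matrices. *)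

theory Defs
  imports "HOL-Probability.Probability"
begin

text \<open>
  The dimension \<open>n\<close> tends to infinity and is therefore a natural number: a vector of \<open>\<real>\<^sup>n\<close> is an
  extensional function on \<open>{..<n}\<close>, and a matrix with \<open>n\<close> rows whose columns are indexed by \<open>J\<close> is
  the extensional family \<open>M\<close> of its columns, the entry in row \<open>i\<close> and column \<open>j\<close> being \<open>M j i\<close>.
  The dimension \<open>k\<close> is fixed: its index set \<open>{1,\<dots>,k}\<close> is a finite linearly ordered type \<open>'k\<close>,
  with \<open>k = CARD('k)\<close>, and \<open>k \<times> k\<close> matrices have the type \<open>real^'k^'k\<close>, whose \<^const>\<open>norm\<close> is the
  Frobenius norm.
\<close>

type_synonym 'k sqmat = "((real, 'k) vec, 'k) vec"

definition colmat_space :: "nat \<Rightarrow> 'j set \<Rightarrow> ('j \<Rightarrow> nat \<Rightarrow> real) measure" where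
  "colmat_space n J = (\<Pi>\<^sub>M j\<in>J. \<Pi>\<^sub>M i\<in>{..<n}. borel)"

definition ip :: "nat \<Rightarrow> (nat \<Rightarrow> real) \<Rightarrow> (nat \<Rightarrow> real) \<Rightarrow> real" where
  "ip n x y = (\<Sum>i<n. x i * y i)"

definition orthonormal_cols :: "nat \<Rightarrow> 'j set \<Rightarrow> ('j \<Rightarrow> nat \<Rightarrow> real) set" where
  "orthonormal_cols n J =
     {Q \<in> space (colmat_space n J). \<forall>i\<in>J. \<forall>j\<in>J. ip n (Q i) (Q j) = (if i = j then 1 else 0)}"

abbreviation orthogonal_group :: "nat \<Rightarrow> (nat \<Rightarrow> nat \<Rightarrow> real) set" where
  "orthogonal_group n \<equiv> orthonormal_cols n {..<n}"


subsection \<open>The n-vector model\<close>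

text \<open>
  The uniform distribution on the unit sphere, as the image of the uniform distribution on the
  unit ball under radial projection (normalised cone measure, which for the Euclidean sphere is
  the normalised surface measure).
\<close>

definition sphere_uniform :: "nat \<Rightarrow> (nat \<Rightarrow> real) measure" where
  "sphere_uniform n =
     distr (uniform_measure (\<Pi>\<^sub>M i\<in>{..<n}. lborel)
              {x \<in> space (\<Pi>\<^sub>M i\<in>{..<n}. lborel). L2_set x {..<n} \<le> 1})
           (\<Pi>\<^sub>M i\<in>{..<n}. borel)
           (\<lambda>x. \<lambda>i\<in>{..<n}. x i / L2_set x {..<n})"

definition nvector_weight :: "real \<Rightarrow> 'k::finite sqmat \<Rightarrow> nat \<Rightarrow> ('k \<Rightarrow> nat \<Rightarrow> real) \<Rightarrow> real" where
  "nvector_weight \<beta> A n x =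
     exp (\<beta> * real n * (\<Sum>i\<in>UNIV. \<Sum>j\<in>UNIV. ip n (x i) (x j) * A $ i $ j))"

definition nvector_model :: "real \<Rightarrow> 'k::finite sqmat \<Rightarrow> nat \<Rightarrow> ('k \<Rightarrow> nat \<Rightarrow> real) measure" where
  "nvector_model \<beta> A n =
     (let U = (\<Pi>\<^sub>M j\<in>UNIV. sphere_uniform n);
          Z = (\<integral>x. nvector_weight \<beta> A n x \<partial>U)
      in density U (\<lambda>x. ennreal (nvector_weight \<beta> A n x / Z)))"


subsection \<open>Gram-Schmidt factorization\<close>

definition upper_triangular :: "'k::{finite,linorder} sqmat \<Rightarrow> bool" where
  "upper_triangular R \<longleftrightarrow> (\<forall>i j. j < i \<longrightarrow> R $ i $ j = 0)"

definition full_column_rank :: "nat \<Rightarrow> ('k::finite \<Rightarrow> nat \<Rightarrow> real) \<Rightarrow> bool" where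
  "full_column_rank n X \<longleftrightarrow>
     (\<forall>c :: 'k \<Rightarrow> real. (\<forall>i<n. (\<Sum>j\<in>UNIV. c j * X j i) = 0) \<longrightarrow> (\<forall>j. c j = 0))"

definition is_qr ::
  "nat \<Rightarrow> ('k::{finite,linorder} \<Rightarrow> nat \<Rightarrow> real) \<Rightarrow> ('k \<Rightarrow> nat \<Rightarrow> real) \<times> 'k sqmat \<Rightarrow> bool" where
  "is_qr n X = (\<lambda>(Q, R).
     Q \<in> orthonormal_cols n UNIV \<and>
     upper_triangular R \<and> (\<forall>j. 0 < R $ j $ j) \<and>
     (\<forall>j. \<forall>i<n. X j i = (\<Sum>l\<in>UNIV. Q l i * R $ l $ j)))"

text \<open>
  Matrices without full column rank form a null set for the n-vector model; there the
  factorization is given the arbitrary value \<open>(0, 0)\<close> so that it is a total function into the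
  space of pairs of matrices.
\<close>

definition gram_schmidt ::
  "nat \<Rightarrow> ('k::{finite,linorder} \<Rightarrow> nat \<Rightarrow> real) \<Rightarrow> ('k \<Rightarrow> nat \<Rightarrow> real) \<times> 'k sqmat" where
  "gram_schmidt n X =
     (if full_column_rank n X then (THE QR. is_qr n X QR) else (\<lambda>j. \<lambda>i\<in>{..<n}. 0, 0))"


subsection \<open>Haar measure of the orthogonal group\<close>

definition colmat_mult ::
  "nat \<Rightarrow> (nat \<Rightarrow> nat \<Rightarrow> real) \<Rightarrow> (nat \<Rightarrow> nat \<Rightarrow> real) \<Rightarrow> (nat \<Rightarrow> nat \<Rightarrow> real)" where
  "colmat_mult n V U = (\<lambda>j\<in>{..<n}. \<lambda>i\<in>{..<n}. \<Sum>l<n. V l i * U j l)"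

definition is_haar_orthogonal :: "nat \<Rightarrow> (nat \<Rightarrow> nat \<Rightarrow> real) measure \<Rightarrow> bool" where
  "is_haar_orthogonal n \<mu> \<longleftrightarrow>
     prob_space \<mu> \<and>
     sets \<mu> = sets (restrict_space (colmat_space n {..<n}) (orthogonal_group n)) \<and>
     (\<forall>V\<in>orthogonal_group n. distr \<mu> \<mu> (colmat_mult n V) = \<mu>)"

text \<open>The element \<open>j\<close> of \<open>'k\<close> corresponds to the column number \<open>card {..<j}\<close>, counted from \<open>0\<close>.\<close>

definition first_cols :: "(nat \<Rightarrow> nat \<Rightarrow> real) \<Rightarrow> 'k::{finite,linorder} \<Rightarrow> nat \<Rightarrow> real" where
  "first_cols U = (\<lambda>j. U (card {..<j}))"


subsection \<open>Independence and weak convergence\<close>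

text \<open>
  The analogue of \<^const>\<open>prob_space.indep_var\<close> for two random variables whose values may have
  different types.
\<close>

definition indep_rvs ::
  "'a measure \<Rightarrow> 'b measure \<Rightarrow> ('a \<Rightarrow> 'b) \<Rightarrow> 'c measure \<Rightarrow> ('a \<Rightarrow> 'c) \<Rightarrow> bool" where
  "indep_rvs M S X T Y \<longleftrightarrow>
     X \<in> measurable M S \<and> Y \<in> measurable M T \<and>
     prob_space.indep_set M
       (sigma_sets (space M) {X -` B \<inter> space M | B. B \<in> sets S})
       (sigma_sets (space M) {Y -` B \<inter> space M | B. B \<in> sets T})"

definition converges_weakly :: "(nat \<Rightarrow> 'b::topological_space measure) \<Rightarrow> 'b measure \<Rightarrow> bool" where
  "converges_weakly \<mu> \<nu> \<longleftrightarrow>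
     (\<forall>f :: 'b \<Rightarrow> real. continuous_on UNIV f \<and> bounded (range f) \<longrightarrow>
        (\<lambda>n. \<integral>x. f x \<partial>\<mu> n) \<longlonglongrightarrow> (\<integral>x. f x \<partial>\<nu>))"


subsection \<open>The log-determinant program\<close>

definition pos_semidef :: "'k::finite sqmat \<Rightarrow> bool" where
  "pos_semidef S \<longleftrightarrow> transpose S = S \<and> (\<forall>v. 0 \<le> v \<bullet> (S *v v))"

definition feasible :: "'k::finite sqmat \<Rightarrow> bool" where
  "feasible S \<longleftrightarrow> pos_semidef S \<and> (\<forall>i. S $ i $ i = 1)"

definition logdet :: "'k::finite sqmat \<Rightarrow> ereal" where
  "logdet S = (if det S = 0 then - \<infinity> else ereal (ln (det S)))"

definition objective :: "real \<Rightarrow> 'k::finite sqmat \<Rightarrow> 'k sqmat \<Rightarrow> ereal" where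
  "objective \<beta> A S = ereal (\<beta> * trace (A ** S)) + ereal (1 / 2) * logdet S"

definition is_optimal :: "real \<Rightarrow> 'k::finite sqmat \<Rightarrow> 'k sqmat \<Rightarrow> bool" where
  "is_optimal \<beta> A S \<longleftrightarrow> feasible S \<and> (\<forall>T. feasible T \<longrightarrow> objective \<beta> A T \<le> objective \<beta> A S)"

definition is_right_cholesky ::
  "'k::{finite,linorder} sqmat \<Rightarrow> 'k sqmat \<Rightarrow> bool" where
  "is_right_cholesky S R \<longleftrightarrow>
     upper_triangular R \<and> (\<forall>i. 0 < R $ i $ i) \<and> S = transpose R ** R"

end

theory Submission
  imports Defs "HOL-Real_Asymp.Real_Asymp"
begin

text \<open>
  The weight of the model depends on \<open>X\<close> through \<open>X\<^sup>T X = R\<^sup>T R\<close> only, so that the law of \<open>X = Q R\<close> is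
  invariant under \<open>X \<mapsto> V X\<close> for orthogonal \<open>V\<close>, which sends \<open>(Q, R)\<close> to \<open>(V Q, R)\<close>. Averaging over Haar
  distributed \<open>V\<close> shows that \<open>Q\<close> is uniform and independent of \<open>R\<close>.

  For \<open>R\<close>, use in each column the coordinates \<open>w\<^sub>j = (R\<^sub>i\<^sub>j / R\<^sub>j\<^sub>j)\<close>, \<open>i < j\<close>. With respect to Lebesgue measure in
  \<open>w\<close> the law of \<open>R\<close> has a density proportional to \<open>G(R)\<^sup>n\<close>, where \<open>G(R) = exp (\<beta> tr (A R\<^sup>T R)) \<Prod>\<^sub>j R\<^sub>j\<^sub>j\<close> is the
  exponential of the objective at \<open>R\<^sup>T R\<close>. At the maximizer \<open>R\<^sup>\<star>\<close> of \<open>G\<close> the first order conditions say that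
  \<open>(R\<^sup>\<star>\<^sup>T R\<^sup>\<star>)\<^sup>-\<^sup>1 = \<Lambda> - 2 \<beta> A\<close> with \<open>\<Lambda>\<close> diagonal. Hence \<open>G(R) / G(R\<^sup>\<star>) = exp ((k - \<parallel>M\<parallel>\<^sup>2) / 2) \<Prod>\<^sub>j M\<^sub>j\<^sub>j\<close> for
  \<open>M = R (R\<^sup>\<star>)\<^sup>-\<^sup>1\<close>, which is at most \<open>exp (- \<parallel>M - 1\<parallel>\<^sup>2 / 2)\<close>, and at least \<open>exp (- 3 \<parallel>M - 1\<parallel>\<^sup>2)\<close> near \<open>M = 1\<close>. The
  upper bound gives the uniqueness of the optimum, and both together give the concentration by
  Laplace's method.
\<close>

subsection \<open>Lebesgue measure on finite products of the real line\<close>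

text \<open>Every normalizing constant that depends on \<open>n\<close> (ball volume, chart masses,
  partition function) stays abstract; it is shown to be positive and finite, and cancels in a
  quotient of two chart integrals. The choice of coordinates makes this quotient manageable. In the
  entries of \<open>R\<close> the density of a column carries a power of its diagonal entry whose
  exponent depends on the column; in the ratios \<open>w_j\<close> the exponent is \<open>n\<close>
  for each column, so no Jacobian is left over. Moreover the law of \<open>w_j\<close> does not
  depend on the frame built from the earlier columns, so these blocks are independent under the
  uniform measure. The price is that the chart has infinite volume as soon as there are two columns.
  In the tail estimate only \<open>n - k\<close> of the \<open>n\<close> factors are therefore
  replaced by a bound valid away from the optimum, and the other \<open>k\<close> keep the integral
  finite. The normalization is bounded below on a cell of side \<open>2 / n\<close>, at the cost of
  a power of \<open>n\<close>. At distance \<open>n^(-1/2 + b)\<close> the tail decays like the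
  exponential of a negative multiple of \<open>n^(2 b)\<close>, which beats that power.\<close>

abbreviation lebprod :: "'i set \<Rightarrow> ('i \<Rightarrow> real) measure" where
  "lebprod I \<equiv> \<Pi>\<^sub>M i\<in>I. lborel"

interpretation lebprod: product_sigma_finite "\<lambda>_. lborel :: real measure"
  by standard

lemma sets_lebprod [measurable_cong]: "sets (lebprod I) = sets (\<Pi>\<^sub>M i\<in>I. borel)"
  by (rule sets_PiM_cong) auto

lemma measurable_lebprod_iff: "f \<in> measurable N (lebprod I) \<longleftrightarrow> f \<in> measurable N (\<Pi>\<^sub>M i\<in>I. borel)"
  by (simp only: measurable_cong_sets[OF refl sets_lebprod])

lemma space_lebprod: "space (lebprod I) = extensional I"
  by (auto simp: space_PiM PiE_def)

lemma sigma_finite_lebprod: "finite I \<Longrightarrow> sigma_finite_measure (lebprod I)"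
  by (rule lebprod.sigma_finite)

lemma measurable_comp_PiM [measurable (raw)]:
  assumes "f \<in> measurable N (\<Pi>\<^sub>M i\<in>I. borel)" "i \<in> I"
  shows "(\<lambda>x. f x i :: real) \<in> borel_measurable N"
  using measurable_compose[OF assms(1) measurable_component_singleton[OF assms(2)]] .

lemma emeasure_lborel_translate:
  fixes A :: "real set"
  assumes "A \<in> sets borel"
  shows "emeasure lborel ((\<lambda>x. x + c) -` A) = emeasure lborel A"
proof -
  have "emeasure lborel A = emeasure (distr lborel borel ((+) c)) A"
    by (simp add: lborel_distr_plus)
  also have "(+) c = (\<lambda>x. x + c)"
    by (simp add: fun_eq_iff)
  also have "emeasure (distr lborel borel (\<lambda>x. x + c)) A = emeasure lborel ((\<lambda>x. x + c) -` A)"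
    using assms by (subst emeasure_distr) auto
  finally show ?thesis ..
qed

lemma emeasure_lborel_scale:
  fixes A :: "real set"
  assumes "A \<in> sets borel" "0 < s"
  shows "emeasure lborel A = ennreal s * emeasure lborel ((\<lambda>x. s * x) -` A)"
proof -
  have "emeasure lborel A = emeasure (density (distr lborel borel (\<lambda>x. 0 + s *\<^sub>R x)) (\<lambda>_. \<bar>s\<bar> ^ DIM(real))) A"
    using assms by (subst lborel_affine[of s 0]) auto
  also have "\<dots> = ennreal s * emeasure lborel ((\<lambda>x. s * x) -` A)"
    using assms by (simp add: emeasure_density nn_integral_cmult emeasure_distr)
  finally show ?thesis .
qed

lemma distr_lebprod_translate:
  assumes "finite I"
  shows "distr (lebprod I) (lebprod I) (\<lambda>x. \<lambda>i\<in>I. x i + a i) = lebprod I"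
proof (rule lebprod.PiM_eqI[OF assms])
  fix A :: "'a \<Rightarrow> real set" assume A: "\<And>i. i \<in> I \<Longrightarrow> A i \<in> sets lborel"
  have "emeasure (distr (lebprod I) (lebprod I) (\<lambda>x. \<lambda>i\<in>I. x i + a i)) (Pi\<^sub>E I A) =
     emeasure (lebprod I) ((\<lambda>x. \<lambda>i\<in>I. x i + a i) -` Pi\<^sub>E I A \<inter> space (lebprod I))"
    using A assms by (intro emeasure_distr measurable_restrict) (auto intro!: sets_PiM_I_finite)
  also have "(\<lambda>x. \<lambda>i\<in>I. x i + a i) -` Pi\<^sub>E I A \<inter> space (lebprod I) = Pi\<^sub>E I (\<lambda>i. (\<lambda>x. x + a i) -` A i)"
    by (auto simp: space_PiM PiE_iff extensional_def)
  also have "emeasure (lebprod I) \<dots> = (\<Prod>i\<in>I. emeasure lborel ((\<lambda>x. x + a i) -` A i))"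
    using A assms by (intro lebprod.emeasure_PiM) (auto intro!: measurable_sets_borel[of _ borel])
  also have "\<dots> = (\<Prod>i\<in>I. emeasure lborel (A i))"
    using A by (intro prod.cong refl emeasure_lborel_translate) auto
  finally show "emeasure (distr (lebprod I) (lebprod I) (\<lambda>x. \<lambda>i\<in>I. x i + a i)) (Pi\<^sub>E I A)
     = (\<Prod>i\<in>I. emeasure lborel (A i))" .
qed simp

lemma nn_integral_lebprod_translate:
  assumes "finite I" "f \<in> borel_measurable (lebprod I)"
  shows "(\<integral>\<^sup>+x. f (\<lambda>i\<in>I. x i + a i) \<partial>lebprod I) = (\<integral>\<^sup>+x. f x \<partial>lebprod I)"
proof -
  have "(\<integral>\<^sup>+x. f x \<partial>lebprod I) = (\<integral>\<^sup>+x. f x \<partial>distr (lebprod I) (lebprod I) (\<lambda>x. \<lambda>i\<in>I. x i + a i))"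
    by (simp add: distr_lebprod_translate assms)
  also have "\<dots> = (\<integral>\<^sup>+x. f (\<lambda>i\<in>I. x i + a i) \<partial>lebprod I)"
    using assms by (intro nn_integral_distr measurable_restrict) auto
  finally show ?thesis ..
qed

lemma nn_integral_lebprod_scale:
  assumes "finite I" "f \<in> borel_measurable (lebprod I)" "0 < s"
  shows "(\<integral>\<^sup>+x. f x \<partial>lebprod I) = ennreal (s ^ card I) * (\<integral>\<^sup>+x. f (\<lambda>i\<in>I. s * x i) \<partial>lebprod I)"
proof -
  have meas [measurable]: "(\<lambda>x. \<lambda>i\<in>I. s * x i) \<in> measurable (lebprod I) (lebprod I)"
    by (intro measurable_restrict) auto
  have "density (distr (lebprod I) (lebprod I) (\<lambda>x. \<lambda>i\<in>I. s * x i)) (\<lambda>_. ennreal (s ^ card I)) = lebprod I"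
    (is "?D = _")
  proof (rule lebprod.PiM_eqI[OF assms(1)])
    fix A :: "'a \<Rightarrow> real set" assume A: "\<And>i. i \<in> I \<Longrightarrow> A i \<in> sets lborel"
    have "emeasure ?D (Pi\<^sub>E I A) = ennreal (s ^ card I) *
       emeasure (lebprod I) ((\<lambda>x. \<lambda>i\<in>I. s * x i) -` Pi\<^sub>E I A \<inter> space (lebprod I))"
      using A assms(1)
      by (simp add: emeasure_density nn_integral_cmult emeasure_distr sets_PiM_I_finite)
    also have "(\<lambda>x. \<lambda>i\<in>I. s * x i) -` Pi\<^sub>E I A \<inter> space (lebprod I) = Pi\<^sub>E I (\<lambda>i. (\<lambda>x. s * x) -` A i)"
      by (auto simp: space_PiM PiE_iff extensional_def)
    also have "emeasure (lebprod I) \<dots> = (\<Prod>i\<in>I. emeasure lborel ((\<lambda>x. s * x) -` A i))"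
      using A assms(1) by (intro lebprod.emeasure_PiM) (auto intro!: measurable_sets_borel[of _ borel])
    also have "ennreal (s ^ card I) * \<dots> = (\<Prod>i\<in>I. ennreal s * emeasure lborel ((\<lambda>x. s * x) -` A i))"
      using assms(3) by (simp add: prod.distrib ennreal_power)
    also have "\<dots> = (\<Prod>i\<in>I. emeasure lborel (A i))"
      using A assms(3) by (intro prod.cong refl emeasure_lborel_scale[symmetric]) auto
    finally show "emeasure ?D (Pi\<^sub>E I A) = (\<Prod>i\<in>I. emeasure lborel (A i))" .
  qed simp
  then have "(\<integral>\<^sup>+x. f x \<partial>lebprod I) = (\<integral>\<^sup>+x. f x \<partial>?D)"
    by simp
  also have "\<dots> = ennreal (s ^ card I) * (\<integral>\<^sup>+x. f (\<lambda>i\<in>I. s * x i) \<partial>lebprod I)"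
    using assms by (simp add: nn_integral_density nn_integral_cmult nn_integral_distr)
  finally show ?thesis .
qed

text \<open>Identifies the block of coordinates at the positions \<open>h i\<close> with a copy
  indexed by the labels \<open>i\<close> themselves, which is how chart coordinates are indexed
  later.\<close>

lemma distr_lebprod_reindex:
  assumes "finite I" "inj_on h I"
  shows "distr (lebprod (h ` I)) (lebprod I) (\<lambda>x. \<lambda>i\<in>I. x (h i)) = lebprod I"
proof (rule lebprod.PiM_eqI[OF assms(1)])
  fix A :: "'a \<Rightarrow> real set" assume A: "\<And>i. i \<in> I \<Longrightarrow> A i \<in> sets lborel"
  let ?A = "\<lambda>j. A (the_inv_into I h j)"
  have "emeasure (distr (lebprod (h ` I)) (lebprod I) (\<lambda>x. \<lambda>i\<in>I. x (h i))) (Pi\<^sub>E I A) =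
     emeasure (lebprod (h ` I)) ((\<lambda>x. \<lambda>i\<in>I. x (h i)) -` Pi\<^sub>E I A \<inter> space (lebprod (h ` I)))"
    using A assms by (intro emeasure_distr measurable_restrict) (auto intro!: sets_PiM_I_finite)
  also have "(\<lambda>x. \<lambda>i\<in>I. x (h i)) -` Pi\<^sub>E I A \<inter> space (lebprod (h ` I)) = Pi\<^sub>E (h ` I) ?A"
    using assms by (auto simp: space_PiM PiE_iff extensional_def the_inv_into_f_f)
  also have "emeasure (lebprod (h ` I)) \<dots> = (\<Prod>j\<in>h ` I. emeasure lborel (?A j))"
    using A assms by (intro lebprod.emeasure_PiM) (auto simp: the_inv_into_f_f)
  also have "\<dots> = (\<Prod>i\<in>I. emeasure lborel (A i))"
    using assms by (subst prod.reindex) (auto intro!: prod.cong simp: the_inv_into_f_f)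
  finally show "emeasure (distr (lebprod (h ` I)) (lebprod I) (\<lambda>x. \<lambda>i\<in>I. x (h i))) (Pi\<^sub>E I A)
     = (\<Prod>i\<in>I. emeasure lborel (A i))" .
qed simp

subsection \<open>Orthonormal families\<close>

text \<open>Unlike \<open>orthonormal_cols\<close> this says nothing about values outside
  \<open>J\<close>, so that a family can be updated at a new index or passed to a subset.\<close>

definition orthonormal :: "nat \<Rightarrow> 'j set \<Rightarrow> ('j \<Rightarrow> nat \<Rightarrow> real) \<Rightarrow> bool" where
  "orthonormal n J q \<longleftrightarrow>
     (\<forall>i\<in>J. q i \<in> extensional {..<n}) \<and> (\<forall>i\<in>J. \<forall>j\<in>J. ip n (q i) (q j) = (if i = j then 1 else 0))"

text \<open>For orthonormal \<open>q\<close> this is the orthogonal projection of \<open>x\<close>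
  to the complement of the span of \<open>q\<close>.\<close>

definition resid :: "nat \<Rightarrow> 'j set \<Rightarrow> ('j \<Rightarrow> nat \<Rightarrow> real) \<Rightarrow> (nat \<Rightarrow> real) \<Rightarrow> nat \<Rightarrow> real" where
  "resid n J q x = (\<lambda>i\<in>{..<n}. x i - (\<Sum>l\<in>J. ip n (q l) x * q l i))"

text \<open>Division by zero sends the zero vector to itself, which keeps the map equivariant under
  rotations everywhere.\<close>

definition normalize_vec :: "nat \<Rightarrow> (nat \<Rightarrow> real) \<Rightarrow> nat \<Rightarrow> real" where
  "normalize_vec n x = (\<lambda>i\<in>{..<n}. x i / L2_set x {..<n})"

definition mulv :: "nat \<Rightarrow> (nat \<Rightarrow> nat \<Rightarrow> real) \<Rightarrow> (nat \<Rightarrow> real) \<Rightarrow> nat \<Rightarrow> real" where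
  "mulv n V x = (\<lambda>i\<in>{..<n}. \<Sum>l<n. V l i * x l)"

definition transp :: "nat \<Rightarrow> (nat \<Rightarrow> nat \<Rightarrow> real) \<Rightarrow> nat \<Rightarrow> nat \<Rightarrow> real" where
  "transp n V = (\<lambda>j\<in>{..<n}. \<lambda>i\<in>{..<n}. V i j)"

lemma space_colmat: "space (colmat_space n J) = (\<Pi>\<^sub>E j\<in>J. extensional {..<n})"
  by (auto simp: colmat_space_def space_PiM PiE_def)

lemma orthonormal_cols_iff:
  "Q \<in> orthonormal_cols n J \<longleftrightarrow> Q \<in> extensional J \<and> orthonormal n J Q"
  by (auto simp: orthonormal_cols_def orthonormal_def space_colmat PiE_iff)

lemma orthogonal_group_colmat:
  "V \<in> orthogonal_group n \<Longrightarrow> V \<in> space (colmat_space n {..<n})"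
  by (simp add: orthonormal_cols_def)

lemma ip_self: "ip n x x = (L2_set x {..<n})\<^sup>2"
  by (simp add: ip_def L2_set_def sum_nonneg power2_eq_square)

lemma L2_set_eq_sqrt_ip: "L2_set x {..<n} = sqrt (ip n x x)"
  by (simp add: ip_def L2_set_def power2_eq_square)

lemma ip_commute: "ip n x y = ip n y x"
  by (simp add: ip_def mult.commute)

lemma ip_sum_right: "ip n x (\<lambda>i. \<Sum>l\<in>J. f l i) = (\<Sum>l\<in>J. ip n x (f l))"
  unfolding ip_def by (subst sum.swap) (simp add: sum_distrib_left)

lemma ip_scale_right: "ip n x (\<lambda>i. c * y i) = c * ip n x y"
  by (simp add: ip_def sum_distrib_left mult_ac)

lemma ip_diff_right: "ip n x (\<lambda>i. y i - z i) = ip n x y - ip n x z"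
  by (simp add: ip_def right_diff_distrib sum_subtractf)

lemma ip_cong: "(\<And>i. i < n \<Longrightarrow> x i = x' i) \<Longrightarrow> (\<And>i. i < n \<Longrightarrow> y i = y' i) \<Longrightarrow> ip n x y = ip n x' y'"
  by (simp add: ip_def)

lemma ip_resid_right:
  "ip n x (resid n J q y) = ip n x y - (\<Sum>l\<in>J. ip n (q l) y * ip n x (q l))"
proof -
  have "ip n x (resid n J q y) = ip n x (\<lambda>i. y i - (\<Sum>l\<in>J. ip n (q l) y * q l i))"
    by (intro ip_cong) (auto simp: resid_def)
  then show ?thesis
    by (simp add: ip_diff_right ip_sum_right ip_scale_right)
qed

lemma orthonormal_sum_ip:
  assumes "orthonormal n J q" "finite J" "a \<in> J"
  shows "(\<Sum>l\<in>J. c l * ip n (q a) (q l)) = c a"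
proof -
  have "(\<Sum>l\<in>J. c l * ip n (q a) (q l)) = (\<Sum>l\<in>J. if l = a then c a else 0)"
    using assms by (intro sum.cong) (auto simp: orthonormal_def)
  then show ?thesis
    using assms by simp
qed

lemma ip_resid_orthogonal:
  assumes "orthonormal n J q" "finite J" "a \<in> J"
  shows "ip n (q a) (resid n J q x) = 0"
  by (simp add: ip_resid_right orthonormal_sum_ip[OF assms])

text \<open>Pythagoras: the residual is orthogonal to every \<open>q l\<close>, so its product with
  itself equals its product with \<open>x\<close>.\<close>

lemma ip_resid_self:
  assumes "orthonormal n J q" "finite J"
  shows "ip n (resid n J q x) (resid n J q x) = ip n x x - (\<Sum>l\<in>J. (ip n (q l) x)\<^sup>2)"
proof -
  have "(\<Sum>l\<in>J. ip n (q l) x * ip n (resid n J q x) (q l)) = 0"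
    using ip_resid_orthogonal[OF assms, of _ x]
    by (intro sum.neutral) (simp add: ip_commute[of n "resid n J q x" "q _"])
  then have "ip n (resid n J q x) (resid n J q x) = ip n (resid n J q x) x"
    by (simp add: ip_resid_right[of n "resid n J q x" J q x])
  also have "\<dots> = ip n x x - (\<Sum>l\<in>J. (ip n (q l) x)\<^sup>2)"
    by (subst ip_commute) (simp add: ip_resid_right power2_eq_square ip_commute[of n x "q _"])
  finally show ?thesis .
qed

text \<open>Replaces dimension theory: a positive sum yields an extension of \<open>q\<close>, a vanishing one completeness.\<close>

lemma sum_resid_unit:
  assumes "orthonormal n J q" "finite J"
  defines "e \<equiv> \<lambda>a. \<lambda>i\<in>{..<n}. if i = a then 1 else 0"
  shows "(\<Sum>a<n. ip n (resid n J q (e a)) (resid n J q (e a))) = real n - real (card J)"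
proof -
  have e: "ip n x (e a) = x a" if "a < n" for a x
    using that by (simp add: ip_def e_def if_distrib[of "\<lambda>t. _ * t"] cong: if_cong)
  have "e a a = 1" if "a < n" for a
    using that by (simp add: e_def)
  then have "(\<Sum>a<n. ip n (resid n J q (e a)) (resid n J q (e a))) = (\<Sum>a<n. 1 - (\<Sum>l\<in>J. q l a * q l a))"
    by (intro sum.cong refl) (simp add: ip_resid_self[OF assms(1,2)] e power2_eq_square)
  also have "\<dots> = real n - (\<Sum>l\<in>J. ip n (q l) (q l))"
    by (simp add: sum_subtractf ip_def) (rule sum.swap)
  also have "(\<Sum>l\<in>J. ip n (q l) (q l)) = (\<Sum>l\<in>J. 1)"
    using assms(1) by (intro sum.cong) (auto simp: orthonormal_def)
  finally show ?thesis
    by simp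
qed

lemma ip_self_nonneg: "0 \<le> ip n x x"
  by (simp add: ip_self)

lemma ip_self_eq_0D: "ip n x x = 0 \<Longrightarrow> i < n \<Longrightarrow> x i = 0"
  by (auto simp: ip_def sum_nonneg_eq_0_iff)

lemma L2_set_lessThan_eq_0_iff: "L2_set x {..<n::nat} = 0 \<longleftrightarrow> (\<forall>i<n. x i = 0)"
  by (auto simp: L2_set_eq_sqrt_ip ip_def sum_nonneg_eq_0_iff)

text \<open>For \<open>card J = n\<close> the squared residuals of the unit vectors sum to zero, so
  each unit vector equals its expansion in \<open>q\<close>. Coordinate \<open>b\<close> of the
  expansion of the unit vector at \<open>a\<close> is the claim: the rows of a square matrix with
  orthonormal columns are orthonormal.\<close>

lemma orthonormal_complete:
  assumes "orthonormal n J q" "finite J" "card J = n" "a < n" "b < n"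
  shows "(\<Sum>l\<in>J. q l a * q l b) = (if a = b then 1 else 0)"
proof -
  define e :: "nat \<Rightarrow> nat \<Rightarrow> real" where "e = (\<lambda>a. \<lambda>i\<in>{..<n}. if i = a then 1 else 0)"
  have e: "ip n x (e a) = x a" for x
    using assms(4) by (simp add: ip_def e_def if_distrib[of "\<lambda>t. _ * t"] cong: if_cong)
  have "(\<Sum>a<n. ip n (resid n J q (e a)) (resid n J q (e a))) = 0"
    using sum_resid_unit[OF assms(1,2)] assms(3) by (simp add: e_def)
  then have "ip n (resid n J q (e a)) (resid n J q (e a)) = 0"
    using assms(4) by (subst (asm) sum_nonneg_eq_0_iff[OF finite_lessThan]) (auto simp: ip_self_nonneg)
  from ip_self_eq_0D[OF this assms(5)] assms(5) have "e a b = (\<Sum>l\<in>J. ip n (q l) (e a) * q l b)"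
    by (simp add: resid_def)
  then show ?thesis
    using assms(4,5) by (auto simp: e) (simp_all add: e_def)
qed

lemma ip_normalize_right: "ip n x (normalize_vec n y) = ip n x y / L2_set y {..<n}"
  by (simp add: ip_def normalize_vec_def sum_divide_distrib)

lemma ip_normalize_self:
  assumes "L2_set y {..<n} \<noteq> 0"
  shows "ip n (normalize_vec n y) (normalize_vec n y) = 1"
proof -
  have "ip n (normalize_vec n y) (normalize_vec n y) = ip n y y / (L2_set y {..<n})\<^sup>2"
    by (simp add: ip_normalize_right ip_commute[of n "normalize_vec n y" y] power2_eq_square)
  then show ?thesis
    using assms by (simp add: ip_self)
qed

lemma orthonormal_insert:
  assumes "orthonormal n J q" "u \<in> extensional {..<n}" "ip n u u = 1" "\<And>l. l \<in> J \<Longrightarrow> ip n (q l) u = 0"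
    "b \<notin> J"
  shows "orthonormal n (insert b J) (q(b := u))"
  using assms unfolding orthonormal_def by (auto simp: ip_commute[of n u "q _"])

text \<open>The squared residuals of the unit vectors sum to \<open>n - card J > 0\<close>, so one
  residual is nonzero and can be normalized.\<close>

lemma orthonormal_extend_one:
  assumes "orthonormal n J q" "finite J" "card J < n"
  obtains u where "u \<in> extensional {..<n}" "ip n u u = 1" "\<And>l. l \<in> J \<Longrightarrow> ip n (q l) u = 0"
proof -
  define e :: "nat \<Rightarrow> nat \<Rightarrow> real" where "e = (\<lambda>a. \<lambda>i\<in>{..<n}. if i = a then 1 else 0)"
  have "(\<Sum>a<n. ip n (resid n J q (e a)) (resid n J q (e a))) \<noteq> 0"
    using sum_resid_unit[OF assms(1,2)] assms(3) by (simp add: e_def)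
  then obtain a where a: "ip n (resid n J q (e a)) (resid n J q (e a)) \<noteq> 0"
    by (meson sum.neutral)
  let ?r = "resid n J q (e a)"
  show thesis
  proof
    show "normalize_vec n ?r \<in> extensional {..<n}"
      by (simp add: normalize_vec_def)
    show "ip n (normalize_vec n ?r) (normalize_vec n ?r) = 1"
      using a by (intro ip_normalize_self) (simp add: L2_set_eq_sqrt_ip)
    show "ip n (q l) (normalize_vec n ?r) = 0" if "l \<in> J" for l
      using ip_resid_orthogonal[OF assms(1,2) that] by (simp add: ip_normalize_right)
  qed
qed

text \<open>Realizes an orthonormal family as prescribed columns of an orthogonal matrix. Rotating
  by that matrix reduces questions about \<open>q\<close> to questions about coordinate
  axes.\<close>

lemma orthonormal_extend:
  assumes "orthonormal n J q" "finite J" "inj_on h J" "h ` J \<subseteq> {..<n}"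
  obtains W where "W \<in> orthogonal_group n" "\<And>j. j \<in> J \<Longrightarrow> W (h j) = q j"
proof -
  \<comment> \<open>\<open>D\<close> is the set of free column positions that have already been
    filled; the case of all free positions is the goal.\<close>
  have "\<exists>W. orthonormal n (h ` J \<union> D) W \<and> (\<forall>j\<in>J. W (h j) = q j)"
    if "finite D" "D \<subseteq> {..<n} - h ` J" for D
    using that
  proof (induction D rule: finite_induct)
    case empty
    have "orthonormal n (h ` J) (\<lambda>l. q (the_inv_into J h l))"
      using assms(1,3) by (auto simp: orthonormal_def the_inv_into_f_f inj_on_eq_iff)
    then show ?case
      using assms(3) by (intro exI[of _ "\<lambda>l. q (the_inv_into J h l)"]) (auto simp: the_inv_into_f_f)
  next
    case (insert b D)
    then obtain W where W: "orthonormal n (h ` J \<union> D) W" "\<forall>j\<in>J. W (h j) = q j"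
      by auto
    have "h ` J \<union> D \<subset> {..<n}"
      using insert.prems insert.hyps assms(4) by blast
    then have "card (h ` J \<union> D) < n"
      using psubset_card_mono[of "{..<n}" "h ` J \<union> D"] by simp
    then obtain u where u: "u \<in> extensional {..<n}" "ip n u u = 1"
      "\<And>l. l \<in> h ` J \<union> D \<Longrightarrow> ip n (W l) u = 0"
      using orthonormal_extend_one[OF W(1)] assms(2) insert.hyps by auto
    have "b \<notin> h ` J \<union> D"
      using insert by auto
    from orthonormal_insert[OF W(1) u this]
    have "orthonormal n (h ` J \<union> insert b D) (W(b := u))"
      by simp
    moreover have "\<forall>j\<in>J. (W(b := u)) (h j) = q j"
      using W(2) insert.prems by auto
    ultimately show ?case
      by blast
  qed
  from this[of "{..<n} - h ` J"] obtain W where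
    W: "orthonormal n {..<n} W" "\<forall>j\<in>J. W (h j) = q j"
    using assms(4) by (auto simp: Un_absorb1)
  show thesis
  proof
    show "restrict W {..<n} \<in> orthogonal_group n"
      using W(1) by (auto simp: orthonormal_cols_iff orthonormal_def)
    show "restrict W {..<n} (h j) = q j" if "j \<in> J" for j
      using W(2) that assms(4) by (auto simp: image_subset_iff)
  qed
qed

section \<open>Action of orthogonal matrices on vectors\<close>

lemma orthogonal_group_orthonormal: "V \<in> orthogonal_group n \<Longrightarrow> orthonormal n {..<n} V"
  by (simp add: orthonormal_cols_iff)

lemma orthogonal_group_rows:
  assumes "V \<in> orthogonal_group n" "a < n" "b < n"
  shows "(\<Sum>l<n. V l a * V l b) = (if a = b then 1 else 0)"
  using orthonormal_complete[OF orthogonal_group_orthonormal[OF assms(1)] _ _ assms(2,3)] by simp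

lemma orthogonal_group_ip:
  assumes "V \<in> orthogonal_group n" "a < n" "b < n"
  shows "ip n (V a) (V b) = (if a = b then 1 else 0)"
  using assms by (auto simp: orthonormal_cols_def)

lemma transp_in_orthogonal_group:
  assumes "V \<in> orthogonal_group n"
  shows "transp n V \<in> orthogonal_group n"
  using orthogonal_group_rows[OF assms]
  by (auto simp: orthonormal_cols_iff orthonormal_def transp_def ip_def)

lemma mulv_extensional [simp]: "mulv n V x \<in> extensional {..<n}"
  by (simp add: mulv_def)

lemma ip_mulv:
  assumes "V \<in> orthogonal_group n"
  shows "ip n (mulv n V x) (mulv n V y) = ip n x y"
proof -
  have "ip n (mulv n V x) (mulv n V y) = (\<Sum>i<n. (\<Sum>a<n. V a i * x a) * (\<Sum>b<n. V b i * y b))"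
    by (simp add: ip_def mulv_def)
  also have "\<dots> = (\<Sum>i<n. \<Sum>a<n. \<Sum>b<n. x a * y b * (V a i * V b i))"
    by (simp add: sum_product mult_ac)
  also have "\<dots> = (\<Sum>a<n. \<Sum>b<n. \<Sum>i<n. x a * y b * (V a i * V b i))"
    by (subst sum.swap) (intro sum.cong refl sum.swap)
  also have "\<dots> = (\<Sum>a<n. \<Sum>b<n. x a * y b * ip n (V a) (V b))"
    by (simp add: ip_def sum_distrib_left)
  also have "\<dots> = (\<Sum>a<n. \<Sum>b<n. if b = a then x a * y b else 0)"
    using assms by (intro sum.cong refl) (auto simp: orthogonal_group_ip)
  also have "\<dots> = ip n x y"
    by (simp add: ip_def)
  finally show ?thesis .
qed

lemma L2_set_mulv:
  "V \<in> orthogonal_group n \<Longrightarrow> L2_set (mulv n V x) {..<n} = L2_set x {..<n}"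
  by (simp add: L2_set_eq_sqrt_ip ip_mulv)

text \<open>Rests on the orthonormality of the rows of \<open>V\<close>, that is on the completeness
  of its columns.\<close>

lemma mulv_transp:
  assumes "V \<in> orthogonal_group n" "x \<in> extensional {..<n}"
  shows "mulv n V (mulv n (transp n V) x) = x"
proof
  fix i
  show "mulv n V (mulv n (transp n V) x) i = x i"
  proof (cases "i < n")
    case True
    have "mulv n V (mulv n (transp n V) x) i = (\<Sum>l<n. V l i * (\<Sum>a<n. V l a * x a))"
      using True by (simp add: mulv_def transp_def)
    also have "\<dots> = (\<Sum>a<n. \<Sum>l<n. V l i * V l a * x a)"
      by (subst sum.swap) (simp add: sum_distrib_left mult_ac)
    also have "\<dots> = (\<Sum>a<n. (\<Sum>l<n. V l i * V l a) * x a)"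
      by (simp add: sum_distrib_right)
    also have "\<dots> = (\<Sum>a<n. if a = i then x a else 0)"
      using True by (intro sum.cong refl) (auto simp: orthogonal_group_rows[OF assms(1)])
    finally show ?thesis
      using True by simp
  next
    case False
    then show ?thesis
      using assms(2) by (auto simp: mulv_def extensional_def)
  qed
qed

lemma ip_mulv_left:
  assumes "V \<in> orthogonal_group n" "a < n"
  shows "ip n (V a) (mulv n V x) = x a"
proof -
  have "ip n (V a) (mulv n V x) = (\<Sum>l<n. x l * ip n (V a) (V l))"
    by (subst ip_cong[where x'="V a" and y'="\<lambda>i. \<Sum>l<n. x l * V l i"])
       (auto simp: mulv_def ip_sum_right ip_scale_right mult.commute)
  then show ?thesis
    using orthonormal_sum_ip[OF orthogonal_group_orthonormal[OF assms(1)]] assms(2) by simp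
qed

lemma mulv_diff: "i < n \<Longrightarrow> mulv n V (\<lambda>i\<in>{..<n}. x i - y i) i = mulv n V x i - mulv n V y i"
  by (simp add: mulv_def right_diff_distrib sum_subtractf)

lemma mulv_add: "i < n \<Longrightarrow> mulv n V (\<lambda>i\<in>{..<n}. x i + y i) i = mulv n V x i + mulv n V y i"
  by (simp add: mulv_def distrib_left sum.distrib)

lemma mulv_resid:
  assumes "V \<in> orthogonal_group n"
  shows "mulv n V (resid n J q x) = resid n J (\<lambda>l. mulv n V (q l)) (mulv n V x)"
proof
  fix i
  have *: "(\<Sum>l<n. V l i * (\<Sum>a\<in>J. ip n (q a) x * q a l)) = (\<Sum>a\<in>J. ip n (q a) x * (\<Sum>l<n. V l i * q a l))"
    by (simp add: sum_distrib_left sum.swap[of _ "{..<n}" J] mult_ac)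
  show "mulv n V (resid n J q x) i = resid n J (\<lambda>l. mulv n V (q l)) (mulv n V x) i"
    using * by (cases "i < n") (auto simp: mulv_def resid_def ip_mulv[OF assms, unfolded mulv_def]
        right_diff_distrib sum_subtractf)
qed

lemma mulv_normalize:
  assumes "V \<in> orthogonal_group n"
  shows "mulv n V (normalize_vec n x) = normalize_vec n (mulv n V x)"
  using L2_set_mulv[OF assms, of x]
  by (auto simp: fun_eq_iff normalize_vec_def mulv_def sum_divide_distrib)

lemma mulv_colmat_mult:
  "j < n \<Longrightarrow> colmat_mult n V U j = mulv n V (U j)"
  by (simp add: colmat_mult_def mulv_def)

subsection \<open>Rotation invariance of Lebesgue measure\<close>

lemma measurable_L2_set:
  assumes "finite I" "J \<subseteq> I" "f \<in> measurable N (\<Pi>\<^sub>M i\<in>I. borel)"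
  shows "(\<lambda>x. L2_set (f x) J) \<in> borel_measurable N"
proof -
  have [measurable]: "(\<lambda>x. f x i) \<in> borel_measurable N" if "i \<in> J" for i
    using assms that by (intro measurable_comp_PiM[OF assms(3)]) auto
  show ?thesis
    unfolding L2_set_def by measurable
qed

lemma measurable_ip [measurable (raw)]:
  assumes [measurable]: "f \<in> measurable N (\<Pi>\<^sub>M i\<in>{..<n}. borel)" "g \<in> measurable N (\<Pi>\<^sub>M i\<in>{..<n}. borel)"
  shows "(\<lambda>x. ip n (f x) (g x)) \<in> borel_measurable N"
  unfolding ip_def by measurable

lemma measurable_normalize_vec [measurable (raw)]:
  assumes [measurable]: "f \<in> measurable N (\<Pi>\<^sub>M i\<in>{..<n}. borel)"
  shows "(\<lambda>x. normalize_vec n (f x)) \<in> measurable N (\<Pi>\<^sub>M i\<in>{..<n}. borel)"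
proof -
  have [measurable]: "(\<lambda>x. L2_set (f x) {..<n}) \<in> borel_measurable N"
    by (rule measurable_L2_set[OF _ _ assms]) auto
  show ?thesis
    unfolding normalize_vec_def by measurable
qed

lemma measurable_mulv [measurable (raw)]:
  assumes [measurable]: "f \<in> measurable N (\<Pi>\<^sub>M i\<in>{..<n}. borel)"
  shows "(\<lambda>x. mulv n V (f x)) \<in> measurable N (\<Pi>\<^sub>M i\<in>{..<n}. borel)"
  unfolding mulv_def by measurable

definition unit_ball :: "nat \<Rightarrow> (nat \<Rightarrow> real) set" where
  "unit_ball n = {x \<in> space (lebprod {..<n}). L2_set x {..<n} \<le> 1}"

lemma sets_unit_ball [measurable]: "unit_ball n \<in> sets (lebprod {..<n})"
proof -
  have [measurable]: "(\<lambda>x. L2_set x {..<n}) \<in> borel_measurable (lebprod {..<n})"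
    by (rule measurable_L2_set[where I="{..<n}"]) auto
  show ?thesis
    unfolding unit_ball_def by measurable
qed

lemma emeasure_lebprod_cube:
  assumes "finite I" "\<And>i. i \<in> I \<Longrightarrow> 0 \<le> (r i :: real)"
  shows "emeasure (lebprod I) (\<Pi>\<^sub>E i\<in>I. {a i - r i..a i + r i}) = ennreal (\<Prod>i\<in>I. 2 * r i)"
  using assms by (subst lebprod.emeasure_PiM) (auto simp: prod_ennreal intro!: prod.cong)

lemma emeasure_unit_ball_pos: "0 < emeasure (lebprod {..<n}) (unit_ball n)"
proof -
  \<comment> \<open>The half side \<open>1 / n\<close> makes the sum of the absolute coordinates at
    most 1, and this sum dominates the Euclidean norm.\<close>
  have "(\<Pi>\<^sub>E i\<in>{..<n}. {0 - 1 / real n..0 + 1 / real n}) \<subseteq> unit_ball n"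
  proof
    fix x assume x: "x \<in> (\<Pi>\<^sub>E i\<in>{..<n}. {0 - 1 / real n..0 + 1 / real n})"
    have "L2_set x {..<n} \<le> (\<Sum>i<n. \<bar>x i\<bar>)"
      by (rule L2_set_le_sum_abs)
    also have "\<dots> \<le> (\<Sum>i<n. 1 / real n)"
      using x by (intro sum_mono) (force simp: PiE_iff)
    also have "\<dots> \<le> 1"
      by simp
    finally show "x \<in> unit_ball n"
      using x by (auto simp: unit_ball_def space_lebprod PiE_iff)
  qed
  then have "emeasure (lebprod {..<n}) (\<Pi>\<^sub>E i\<in>{..<n}. {0 - 1 / real n..0 + 1 / real n})
      \<le> emeasure (lebprod {..<n}) (unit_ball n)"
    by (intro emeasure_mono sets_unit_ball)
  moreover have "0 < emeasure (lebprod {..<n}) (\<Pi>\<^sub>E i\<in>{..<n}. {0 - 1 / real n..0 + 1 / real n})"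
    by (subst emeasure_lebprod_cube) (auto intro!: prod_pos simp del: prod_constant)
  ultimately show ?thesis
    by order
qed

lemma emeasure_unit_ball_finite: "emeasure (lebprod {..<n}) (unit_ball n) < \<infinity>"
proof -
  have "unit_ball n \<subseteq> (\<Pi>\<^sub>E i\<in>{..<n}. {0 - 1..0 + 1})"
  proof
    fix x assume x: "x \<in> unit_ball n"
    have "\<bar>x i\<bar> \<le> 1" if "i < n" for i
    proof -
      have "\<bar>x i\<bar> \<le> L2_set (\<lambda>i. \<bar>x i\<bar>) {..<n}"
        using that by (intro member_le_L2_set) auto
      also have "\<dots> \<le> 1"
        using x by (simp add: unit_ball_def L2_set_def)
      finally show ?thesis .
    qed
    then show "x \<in> (\<Pi>\<^sub>E i\<in>{..<n}. {0 - 1..0 + 1})"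
      using x by (force simp: unit_ball_def space_lebprod PiE_iff abs_le_iff)
  qed
  then have "emeasure (lebprod {..<n}) (unit_ball n) \<le> emeasure (lebprod {..<n}) (\<Pi>\<^sub>E i\<in>{..<n}. {0 - 1..0 + 1})"
    by (intro emeasure_mono) (auto intro!: sets_PiM_I_finite)
  also have "\<dots> < \<infinity>"
    by (subst emeasure_lebprod_cube) auto
  finally show ?thesis .
qed

text \<open>
  A translation invariant measure is proportional to Lebesgue measure, by Fubini; the unit ball
  determines the constant.
\<close>

lemma nn_integral_lebprod_mulv:
  assumes V: "V \<in> orthogonal_group n" and f [measurable]: "f \<in> borel_measurable (lebprod {..<n})"
  shows "(\<integral>\<^sup>+x. f (mulv n V x) \<partial>lebprod {..<n}) = (\<integral>\<^sup>+x. f x \<partial>lebprod {..<n})"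
proof -
  let ?L = "lebprod {..<n}" and ?B = "emeasure (lebprod {..<n}) (unit_ball n)"
  define b :: "(nat \<Rightarrow> real) \<Rightarrow> ennreal" where "b = indicator (unit_ball n)"
  have b [measurable]: "b \<in> borel_measurable ?L"
    by (simp add: b_def)
  define add :: "(nat \<Rightarrow> real) \<Rightarrow> (nat \<Rightarrow> real) \<Rightarrow> nat \<Rightarrow> real" where
    "add = (\<lambda>x y. \<lambda>i\<in>{..<n}. x i + y i)"
  define diff :: "(nat \<Rightarrow> real) \<Rightarrow> (nat \<Rightarrow> real) \<Rightarrow> nat \<Rightarrow> real" where
    "diff = (\<lambda>x y. \<lambda>i\<in>{..<n}. x i - y i)"
  have add_meas [measurable]: "(\<lambda>p. add (g p) (h p)) \<in> measurable N ?L"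
    if [measurable]: "g \<in> measurable N ?L" "h \<in> measurable N ?L"
    for g h :: "'c \<Rightarrow> nat \<Rightarrow> real" and N :: "'c measure"
  proof -
    have [measurable]: "g \<in> measurable N (\<Pi>\<^sub>M i\<in>{..<n}. borel)" "h \<in> measurable N (\<Pi>\<^sub>M i\<in>{..<n}. borel)"
      using that by (simp_all add: measurable_lebprod_iff)
    show ?thesis
      unfolding add_def measurable_lebprod_iff by measurable
  qed
  have diff_meas [measurable]: "(\<lambda>p. diff (g p) (h p)) \<in> measurable N ?L"
    if [measurable]: "g \<in> measurable N ?L" "h \<in> measurable N ?L"
    for g h :: "'c \<Rightarrow> nat \<Rightarrow> real" and N :: "'c measure"
  proof -
    have [measurable]: "g \<in> measurable N (\<Pi>\<^sub>M i\<in>{..<n}. borel)" "h \<in> measurable N (\<Pi>\<^sub>M i\<in>{..<n}. borel)"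
      using that by (simp_all add: measurable_lebprod_iff)
    show ?thesis
      unfolding diff_def measurable_lebprod_iff by measurable
  qed
  have mulv_meas [measurable]: "(\<lambda>p. mulv n W (g p)) \<in> measurable N ?L"
    if [measurable]: "g \<in> measurable N ?L" for g :: "'c \<Rightarrow> nat \<Rightarrow> real" and N :: "'c measure" and W
  proof -
    have "g \<in> measurable N (\<Pi>\<^sub>M i\<in>{..<n}. borel)"
      using that by (simp add: measurable_lebprod_iff)
    from measurable_mulv[OF this] show ?thesis
      by (simp add: measurable_lebprod_iff)
  qed
  interpret L: pair_sigma_finite ?L ?L
    by (intro pair_sigma_finite.intro sigma_finite_lebprod) auto
  have ext: "x \<in> space ?L \<Longrightarrow> x \<in> extensional {..<n}" for x
    by (simp add: space_lebprod)
  have shift: "(\<integral>\<^sup>+x. g (add x a) \<partial>?L) = (\<integral>\<^sup>+x. g x \<partial>?L)"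
    if "g \<in> borel_measurable ?L" for g :: "(nat \<Rightarrow> real) \<Rightarrow> ennreal" and a
    unfolding add_def using that by (intro nn_integral_lebprod_translate) auto
  \<comment> \<open>The factor \<open>?B\<close> is the integral of \<open>b\<close>; being positive
    and finite it can be cancelled at the end.\<close>
  have "(\<integral>\<^sup>+x. f (mulv n V x) \<partial>?L) * ?B = (\<integral>\<^sup>+y. b y * (\<integral>\<^sup>+x. f (mulv n V x) \<partial>?L) \<partial>?L)"
    by (simp add: nn_integral_multc b_def mult.commute)
  also have "\<dots> = (\<integral>\<^sup>+y. b y * (\<integral>\<^sup>+x. f (add (mulv n V x) y) \<partial>?L) \<partial>?L)"
  proof (rule nn_integral_cong, rule arg_cong2[where f="(*)"], rule refl)
    fix y assume y: "y \<in> space ?L"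
    \<comment> \<open>Translating \<open>x\<close> by the preimage of \<open>y\<close> under the
      rotation adds \<open>y\<close> to the rotated vector.\<close>
    have *: "mulv n V (add x (mulv n (transp n V) y)) = add (mulv n V x) y" for x
    proof
      fix i
      show "mulv n V (add x (mulv n (transp n V) y)) i = add (mulv n V x) y i"
        using mulv_add[of i n V x "mulv n (transp n V) y"]
        by (cases "i < n") (simp_all add: add_def mulv_transp[OF V ext[OF y]], simp add: mulv_def)
    qed
    have "(\<integral>\<^sup>+x. f (mulv n V x) \<partial>?L) = (\<integral>\<^sup>+x. f (mulv n V (add x (mulv n (transp n V) y))) \<partial>?L)"
      by (rule shift[symmetric]) measurable
    then show "(\<integral>\<^sup>+x. f (mulv n V x) \<partial>?L) = (\<integral>\<^sup>+x. f (add (mulv n V x) y) \<partial>?L)"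
      by (simp add: *)
  qed
  also have "\<dots> = (\<integral>\<^sup>+y. (\<integral>\<^sup>+x. b y * f (add (mulv n V x) y) \<partial>?L) \<partial>?L)"
    by (intro nn_integral_cong nn_integral_cmult[symmetric]) measurable
  also have "\<dots> = (\<integral>\<^sup>+x. (\<integral>\<^sup>+y. b y * f (add (mulv n V x) y) \<partial>?L) \<partial>?L)"
    by (rule L.Fubini') measurable
  \<comment> \<open>The inner variable is shifted by the rotated \<open>x\<close>, which moves the
    dependence on \<open>x\<close> from \<open>f\<close> to the ball indicator.\<close>
  also have "\<dots> = (\<integral>\<^sup>+x. (\<integral>\<^sup>+y. b (diff y (mulv n V x)) * f y \<partial>?L) \<partial>?L)"
  proof (rule nn_integral_cong)
    fix x assume "x \<in> space ?L"
    have [measurable]: "(\<lambda>y. mulv n V x) \<in> measurable ?L ?L"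
      by (rule measurable_const) (simp add: space_lebprod)
    have "(\<integral>\<^sup>+y. b (diff y (mulv n V x)) * f y \<partial>?L) =
      (\<integral>\<^sup>+y. b (diff (add y (mulv n V x)) (mulv n V x)) * f (add y (mulv n V x)) \<partial>?L)"
      by (rule shift[symmetric]) measurable
    also have "\<dots> = (\<integral>\<^sup>+y. b y * f (add (mulv n V x) y) \<partial>?L)"
    proof (rule nn_integral_cong, intro arg_cong2[where f="(*)"] arg_cong[where f=b] arg_cong[where f=f])
      fix y assume "y \<in> space ?L"
      then show "diff (add y (mulv n V x)) (mulv n V x) = y"
        by (auto simp: space_lebprod diff_def add_def fun_eq_iff extensional_def)
      show "add y (mulv n V x) = add (mulv n V x) y"
        by (simp add: add_def add.commute)
    qed
    finally show "(\<integral>\<^sup>+y. b y * f (add (mulv n V x) y) \<partial>?L) =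
      (\<integral>\<^sup>+y. b (diff y (mulv n V x)) * f y \<partial>?L)" ..
  qed
  also have "\<dots> = (\<integral>\<^sup>+y. (\<integral>\<^sup>+x. b (diff y (mulv n V x)) * f y \<partial>?L) \<partial>?L)"
    by (rule L.Fubini') measurable
  also have "\<dots> = (\<integral>\<^sup>+y. f y * ?B \<partial>?L)"
  proof (intro nn_integral_cong)
    fix y assume y: "y \<in> space ?L"
    let ?a = "\<lambda>i. - mulv n (transp n V) y i"
    \<comment> \<open>The difference is the rotation of \<open>mulv n (transp n V) y\<close> minus
      \<open>x\<close>. The ball is invariant under rotations and sign change, so only a translate
      of it remains, of measure \<open>?B\<close> for every \<open>y\<close>.\<close>
    have "b (diff y (mulv n V x)) = b (add x ?a)" for x
    proof -
      have "diff y (mulv n V x) = mulv n V (diff (mulv n (transp n V) y) x)"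
      proof
        fix i
        show "diff y (mulv n V x) i = mulv n V (diff (mulv n (transp n V) y) x) i"
          using mulv_diff[of i n V "mulv n (transp n V) y" x]
          by (cases "i < n") (simp_all add: diff_def mulv_transp[OF V ext[OF y]], simp add: mulv_def)
      qed
      then have "L2_set (diff y (mulv n V x)) {..<n} = L2_set (diff (mulv n (transp n V) y) x) {..<n}"
        by (simp add: L2_set_mulv[OF V])
      also have "\<dots> = L2_set (add x ?a) {..<n}"
        by (simp add: L2_set_def diff_def add_def power2_commute)
      finally show ?thesis
        by (simp add: b_def unit_ball_def space_lebprod indicator_def diff_def add_def)
    qed
    then have "(\<integral>\<^sup>+x. b (diff y (mulv n V x)) \<partial>?L) = (\<integral>\<^sup>+x. b x \<partial>?L)"
      using shift[of b ?a] by simp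
    moreover have "(\<integral>\<^sup>+x. b (diff y (mulv n V x)) * f y \<partial>?L) = (\<integral>\<^sup>+x. b (diff y (mulv n V x)) \<partial>?L) * f y"
      using y by (intro nn_integral_multc) measurable
    ultimately show "(\<integral>\<^sup>+x. b (diff y (mulv n V x)) * f y \<partial>?L) = f y * ?B"
      by (simp add: b_def mult.commute)
  qed
  also have "\<dots> = (\<integral>\<^sup>+y. f y \<partial>?L) * ?B"
    by (simp add: nn_integral_multc)
  finally show ?thesis
    using emeasure_unit_ball_pos[of n] emeasure_unit_ball_finite[of n]
    by (auto simp: mult.commute[of _ ?B] ennreal_mult_cancel_left)
qed

subsection \<open>The uniform distribution on the sphere\<close>

abbreviation vec_space :: "nat \<Rightarrow> (nat \<Rightarrow> real) measure" where
  "vec_space n \<equiv> \<Pi>\<^sub>M i\<in>{..<n}. borel"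

lemma space_vec_space: "space (vec_space n) = extensional {..<n}"
  by (auto simp: space_PiM PiE_def)

lemma sphere_uniform_altdef:
  "sphere_uniform n = distr (uniform_measure (lebprod {..<n}) (unit_ball n)) (vec_space n) (normalize_vec n)"
  by (simp add: sphere_uniform_def unit_ball_def normalize_vec_def[abs_def])

lemma sets_sphere_uniform [simp, measurable_cong]: "sets (sphere_uniform n) = sets (vec_space n)"
  by (simp add: sphere_uniform_altdef)

lemma space_sphere_uniform: "space (sphere_uniform n) = extensional {..<n}"
  by (simp add: sphere_uniform_altdef space_vec_space)

lemma measurable_normalize_vec_uniform [measurable]:
  "normalize_vec n \<in> measurable (uniform_measure (lebprod {..<n}) (unit_ball n)) (vec_space n)"
proof -
  have "normalize_vec n \<in> measurable (vec_space n) (vec_space n)"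
    by measurable
  then show ?thesis
    by (simp cong: measurable_cong_sets add: sets_lebprod)
qed

lemma prob_space_sphere_uniform: "prob_space (sphere_uniform n)"
proof -
  have "prob_space (uniform_measure (lebprod {..<n}) (unit_ball n))"
    using emeasure_unit_ball_pos[of n] emeasure_unit_ball_finite[of n]
    by (intro prob_space_uniform_measure) auto
  then show ?thesis
    unfolding sphere_uniform_altdef by (rule prob_space.prob_space_distr) measurable
qed

lemma nn_integral_sphere_uniform:
  assumes [measurable]: "f \<in> borel_measurable (vec_space n)"
  shows "(\<integral>\<^sup>+x. f x \<partial>sphere_uniform n) =
    (\<integral>\<^sup>+x. f (normalize_vec n x) * indicator (unit_ball n) x \<partial>lebprod {..<n}) / emeasure (lebprod {..<n}) (unit_ball n)"
proof -
  have [measurable]: "normalize_vec n \<in> measurable (lebprod {..<n}) (vec_space n)"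
    by (subst measurable_cong_sets[OF sets_lebprod refl]) measurable
  have "(\<integral>\<^sup>+x. f x \<partial>sphere_uniform n) =
    (\<integral>\<^sup>+x. f (normalize_vec n x) \<partial>uniform_measure (lebprod {..<n}) (unit_ball n))"
    unfolding sphere_uniform_altdef by (rule nn_integral_distr) measurable
  also have "\<dots> = (\<integral>\<^sup>+x. f (normalize_vec n x) * indicator (unit_ball n) x \<partial>lebprod {..<n}) / emeasure (lebprod {..<n}) (unit_ball n)"
    by (rule nn_integral_uniform_measure) measurable
  finally show ?thesis .
qed

lemma unit_ball_mulv:
  "V \<in> orthogonal_group n \<Longrightarrow> x \<in> space (lebprod {..<n}) \<Longrightarrow> mulv n V x \<in> unit_ball n \<longleftrightarrow> x \<in> unit_ball n"
  by (simp add: unit_ball_def space_lebprod L2_set_mulv)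

text \<open>Inherited from Lebesgue measure: radial projection commutes with rotations and the ball
  is invariant.\<close>

lemma nn_integral_sphere_uniform_mulv:
  assumes V: "V \<in> orthogonal_group n" and f [measurable]: "f \<in> borel_measurable (vec_space n)"
  shows "(\<integral>\<^sup>+x. f (mulv n V x) \<partial>sphere_uniform n) = (\<integral>\<^sup>+x. f x \<partial>sphere_uniform n)"
proof -
  have [measurable]: "normalize_vec n \<in> measurable (lebprod {..<n}) (vec_space n)"
    by (subst measurable_cong_sets[OF sets_lebprod refl]) measurable
  have "(\<integral>\<^sup>+x. f (mulv n V (normalize_vec n x)) * indicator (unit_ball n) x \<partial>lebprod {..<n}) =
    (\<integral>\<^sup>+x. f (normalize_vec n (mulv n V x)) * indicator (unit_ball n) (mulv n V x) \<partial>lebprod {..<n})"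
    using unit_ball_mulv[OF V] by (intro nn_integral_cong) (simp add: mulv_normalize[OF V] indicator_def)
  also have "\<dots> = (\<integral>\<^sup>+x. f (normalize_vec n x) * indicator (unit_ball n) x \<partial>lebprod {..<n})"
    by (rule nn_integral_lebprod_mulv[OF V]) measurable
  finally show ?thesis
    by (simp add: nn_integral_sphere_uniform)
qed

section \<open>Null sets of Lebesgue measure and of the uniform distribution on the sphere\<close>

lemma null_sets_lebprod_component:
  assumes "finite I" "a \<in> I"
  shows "{x \<in> space (lebprod I). x a = 0} \<in> null_sets (lebprod I)"
proof -
  have eq: "{x \<in> space (lebprod I). x a = 0} = (\<Pi>\<^sub>E i\<in>I. if i = a then {0} else UNIV)"
    using assms by (auto simp: space_lebprod PiE_iff extensional_def split: if_splits)
  have "emeasure (lebprod I) (\<Pi>\<^sub>E i\<in>I. if i = a then {0} else UNIV) =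
     (\<Prod>i\<in>I. emeasure lborel (if i = a then {0 :: real} else UNIV))"
    using assms by (intro lebprod.emeasure_PiM) auto
  also have "\<dots> = 0"
    using assms by (intro prod_zero) (auto intro!: bexI[of _ a])
  finally show ?thesis
    unfolding eq using assms by (intro null_setsI) (auto intro!: sets_PiM_I_finite)
qed

lemma AE_lebprod_component_nonzero:
  assumes "finite I" "a \<in> I"
  shows "AE x in lebprod I. x a \<noteq> 0"
  using null_sets_lebprod_component[OF assms] by (rule AE_I') auto

lemma AE_lebprod_L2_set_pos:
  assumes "finite I" "J \<subseteq> I" "J \<noteq> {}"
  shows "AE x in lebprod I. 0 < L2_set x J"
proof -
  obtain a where a: "a \<in> J" using assms(3) by auto
  have "AE x in lebprod I. x a \<noteq> 0"
    using a assms by (intro AE_lebprod_component_nonzero) auto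
  then show ?thesis
  proof eventually_elim
    case (elim x)
    have "finite J" using assms finite_subset by blast
    then have "L2_set x J \<noteq> 0"
      using elim a by (auto simp: L2_set_eq_0_iff)
    then show ?case
      by (simp add: less_le)
  qed
qed

lemma AE_sphere_uniformI:
  assumes "AE x in lebprod {..<n}. P (normalize_vec n x)" "{x \<in> space (vec_space n). P x} \<in> sets (vec_space n)"
  shows "AE x in sphere_uniform n. P x"
  unfolding sphere_uniform_altdef
proof (subst AE_distr_iff)
  show "AE x in uniform_measure (lebprod {..<n}) (unit_ball n). P (normalize_vec n x)"
    using assms(1) by (intro AE_uniform_measureI) auto
qed (use assms(2) in auto)

lemma AE_sphere_uniform_unit:
  assumes "0 < n"
  shows "AE x in sphere_uniform n. ip n x x = 1"
proof (rule AE_sphere_uniformI)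
  have "AE x in lebprod {..<n}. 0 < L2_set x {..<n}"
    using assms by (intro AE_lebprod_L2_set_pos) auto
  then show "AE x in lebprod {..<n}. ip n (normalize_vec n x) (normalize_vec n x) = 1"
    by eventually_elim (simp add: ip_normalize_self)
qed measurable

lemma L2_set_normalize_vec:
  assumes "J \<subseteq> {..<n}"
  shows "L2_set (normalize_vec n x) J = L2_set x J / L2_set x {..<n}"
proof -
  have "L2_set (normalize_vec n x) J = L2_set (\<lambda>i. 1 / L2_set x {..<n} * x i) J"
    using assms by (intro L2_set_cong) (auto simp: normalize_vec_def)
  also have "\<dots> = 1 / L2_set x {..<n} * L2_set x J"
    by (intro L2_set_right_distrib[symmetric]) simp
  finally show ?thesis by simp
qed

text \<open>
  In the affine chart \<open>w = y / |z|\<close> of the sphere, \<open>(y, z)\<close> being the two blocks of coordinates, the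
  uniform distribution on the sphere has a density proportional to \<open>chart_factor I w ^ n\<close>:
  substitute \<open>y = |z| w\<close>, and then rescale \<open>z\<close> by \<open>chart_factor I w\<close>.
\<close>

definition chart_factor :: "'i set \<Rightarrow> ('i \<Rightarrow> real) \<Rightarrow> real" where
  "chart_factor I w = 1 / sqrt (1 + (\<Sum>i\<in>I. (w i)\<^sup>2))"

lemma chart_factor_pos: "0 < chart_factor I w"
  by (simp add: chart_factor_def add_pos_nonneg sum_nonneg)

lemma measurable_chart_factor [measurable (raw)]:
  assumes [measurable]: "f \<in> measurable N (\<Pi>\<^sub>M i\<in>I. borel)"
  shows "(\<lambda>x. chart_factor I (f x)) \<in> borel_measurable N"
  unfolding chart_factor_def by measurable

text \<open>Never evaluated. It is positive and finite for \<open>card I < n\<close> because the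
  uniform distribution has total mass 1, see \<open>nn_integral_chart_coords\<close>.\<close>

definition chart_mass :: "nat \<Rightarrow> 'i set \<Rightarrow> ennreal" where
  "chart_mass n I = (\<integral>\<^sup>+w. ennreal (chart_factor I w ^ n) \<partial>lebprod I)"

lemma measurable_indicator_atMost [measurable (raw)]:
  fixes f g :: "'a \<Rightarrow> real"
  assumes [measurable]: "f \<in> borel_measurable N" "g \<in> borel_measurable N"
  shows "(\<lambda>x. indicator {..f x} (g x) :: ennreal) \<in> borel_measurable N"
proof -
  have "(\<lambda>x. indicator {..f x} (g x)) = (\<lambda>x. if g x \<le> f x then 1 else 0 :: ennreal)"
    by (auto simp: indicator_def)
  then show ?thesis by simp
qed

text \<open>The chart for coordinate axes: the positions in the image of \<open>h\<close> form the
  block \<open>y\<close>, the others the block \<open>z\<close>. \<open>K\<close> collects the ball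
  volume and an integral over \<open>z\<close>, and is identified later by total mass.\<close>

lemma sphere_chart_coordinates_aux:
  assumes I: "finite I" "inj_on h I" "h ` I \<subseteq> {..<n}" "card I < n"
  obtains K where "\<And>g. g \<in> borel_measurable (lebprod I) \<Longrightarrow>
    (\<integral>\<^sup>+u. g (\<lambda>i\<in>I. u (h i) / L2_set u ({..<n} - h ` I)) \<partial>sphere_uniform n) =
      K * (\<integral>\<^sup>+w. g w * ennreal (chart_factor I w ^ n) \<partial>lebprod I)"
proof -
  let ?Z = "{..<n} - h ` I" and ?L = "lebprod {..<n}"
  let ?B = "emeasure ?L (unit_ball n)"
  have card: "card ?Z + card I = n"
    using I by (subst card_Diff_subset) (auto simp: card_image)
  have finI: "finite (h ` I)" and finZ [simp]: "finite ?Z"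
    using I by auto
  \<comment> \<open>Guarantees that the norm of \<open>z\<close> is almost everywhere positive, so
    that dividing by it is a change of variables.\<close>
  have Zne: "?Z \<noteq> {}"
  proof
    assume "?Z = {}"
    then have "card ?Z = 0" by simp
    then show False using card I(4) by linarith
  qed
  have Zsub: "?Z \<subseteq> {..<n}" by auto
  have Un: "?Z \<union> h ` I = {..<n}"
    using I(3) by auto
  \<comment> \<open>The integral over \<open>z\<close> that arises when
    \<open>chart_factor I w\<close> is 1; the general case is a rescaling of it.\<close>
  define K' where "K' = (\<integral>\<^sup>+z. ennreal (L2_set z ?Z ^ card I) * indicator {..1} (L2_set z ?Z) \<partial>lebprod ?Z)"
  have LZ [measurable]: "(\<lambda>z. L2_set (f z) ?Z) \<in> borel_measurable N"
    if "f \<in> measurable N (\<Pi>\<^sub>M i\<in>?Z. borel)" for f N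
    by (rule measurable_L2_set[OF finZ subset_refl that])
  interpret P: pair_sigma_finite "lebprod ?Z" "lebprod I"
    using I by (intro pair_sigma_finite.intro sigma_finite_lebprod) auto
  show thesis
  proof (rule that[of "K' / ?B"])
    fix g :: "('a \<Rightarrow> real) \<Rightarrow> ennreal" assume g: "g \<in> borel_measurable (lebprod I)"
    note [measurable] = g
    have g': "g \<in> borel_measurable (\<Pi>\<^sub>M i\<in>I. borel)"
      using g by (simp add: measurable_cong_sets[OF sets_lebprod refl])
    define G where "G = (\<lambda>u. g (\<lambda>i\<in>I. u (h i) / L2_set u ?Z))"
    have hI: "h i \<in> {..<n}" if "i \<in> I" for i
      using I(3) that by auto
    have chart_meas: "(\<lambda>u. \<lambda>i\<in>I. u (h i) / L2_set u ?Z) \<in> measurable (vec_space n) (\<Pi>\<^sub>M i\<in>I. borel)"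
    proof (intro measurable_restrict borel_measurable_divide)
      show "(\<lambda>u. u (h i)) \<in> borel_measurable (vec_space n)" if "i \<in> I" for i
        using hI[OF that] by (rule measurable_component_singleton)
      show "(\<lambda>u. L2_set u ?Z) \<in> borel_measurable (vec_space n)"
        by (rule measurable_L2_set[where I="{..<n}"]) auto
    qed
    have G: "G \<in> borel_measurable (vec_space n)"
      unfolding G_def by (rule measurable_compose[OF chart_meas g'])
    have GL [measurable]: "G \<in> borel_measurable ?L"
      using G by (simp add: measurable_cong_sets[OF sets_lebprod refl])
    \<comment> \<open>\<open>G\<close> is homogeneous of degree 0, so the radial projection in the
      definition of the uniform distribution drops out.\<close>
    have GN: "G (normalize_vec n x) = G x" for x
    proof (cases "L2_set x {..<n} = 0")
      case True
      then have "\<forall>i<n. x i = 0"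
        by (simp add: L2_set_lessThan_eq_0_iff)
      then have "(\<lambda>i\<in>I. normalize_vec n x (h i) / L2_set (normalize_vec n x) ?Z) = (\<lambda>i\<in>I. x (h i) / L2_set x ?Z)"
        using hI by (auto simp: normalize_vec_def fun_eq_iff)
      then show ?thesis by (simp add: G_def)
    next
      case False
      then have "(\<lambda>i\<in>I. normalize_vec n x (h i) / L2_set (normalize_vec n x) ?Z) = (\<lambda>i\<in>I. x (h i) / L2_set x ?Z)"
        using hI L2_set_normalize_vec[OF Zsub, of x] by (auto simp: normalize_vec_def fun_eq_iff)
      then show ?thesis by (simp add: G_def)
    qed
    have "(\<integral>\<^sup>+u. G u \<partial>sphere_uniform n) = (\<integral>\<^sup>+x. G x * indicator (unit_ball n) x \<partial>?L) / ?B"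
      by (simp add: nn_integral_sphere_uniform[OF G] GN)
    also have "(\<integral>\<^sup>+x. G x * indicator (unit_ball n) x \<partial>?L) =
      (\<integral>\<^sup>+z. (\<integral>\<^sup>+y. G (merge ?Z (h ` I) (z, y)) * indicator (unit_ball n) (merge ?Z (h ` I) (z, y)) \<partial>lebprod (h ` I)) \<partial>lebprod ?Z)"
      using finI by (subst lebprod.product_nn_integral_fold[of ?Z "h ` I", unfolded Un, symmetric]) (auto simp del: sets_lebprod)
    also have "\<dots> = (\<integral>\<^sup>+z. (\<integral>\<^sup>+w. g w * (ennreal (L2_set z ?Z ^ card I) * indicator {..chart_factor I w} (L2_set z ?Z)) \<partial>lebprod I) \<partial>lebprod ?Z)"
    proof (rule nn_integral_cong_AE)
      have "AE z in lebprod ?Z. 0 < L2_set z ?Z"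
        using Zne by (intro AE_lebprod_L2_set_pos) auto
      moreover have "AE z in lebprod ?Z. z \<in> space (lebprod ?Z)"
        by (rule AE_space)
      ultimately show "AE z in lebprod ?Z.
        (\<integral>\<^sup>+y. G (merge ?Z (h ` I) (z, y)) * indicator (unit_ball n) (merge ?Z (h ` I) (z, y)) \<partial>lebprod (h ` I)) =
        (\<integral>\<^sup>+w. g w * (ennreal (L2_set z ?Z ^ card I) * indicator {..chart_factor I w} (L2_set z ?Z)) \<partial>lebprod I)"
      proof eventually_elim
        case (elim z)
        define s where "s = L2_set z ?Z"
        have s: "0 < s" using elim by (simp add: s_def)
        have Lm: "L2_set (merge ?Z (h ` I) (z, y)) ?Z = s" for y
          unfolding s_def by (intro L2_set_cong) auto
        have Lm': "L2_set (merge ?Z (h ` I) (z, y)) {..<n} = sqrt (s\<^sup>2 + (\<Sum>i\<in>I. (y (h i))\<^sup>2))" for y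
        proof -
          have "(L2_set (merge ?Z (h ` I) (z, y)) {..<n})\<^sup>2 =
              (\<Sum>i\<in>?Z \<union> h ` I. (merge ?Z (h ` I) (z, y) i)\<^sup>2)"
            unfolding Un by (simp add: L2_set_def sum_nonneg)
          also have "\<dots> = (\<Sum>i\<in>?Z. (z i)\<^sup>2) + (\<Sum>i\<in>h ` I. (y i)\<^sup>2)"
            using I by (subst sum.union_disjoint) auto
          also have "(\<Sum>i\<in>?Z. (z i)\<^sup>2) = s\<^sup>2"
            by (simp add: s_def L2_set_def sum_nonneg)
          also have "(\<Sum>i\<in>h ` I. (y i)\<^sup>2) = (\<Sum>i\<in>I. (y (h i))\<^sup>2)"
            using I by (simp add: sum.reindex)
          finally show ?thesis
            by (metis L2_set_nonneg real_sqrt_unique)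
        qed
        \<comment> \<open>The integrand as a function of \<open>y\<close> alone: for fixed
          \<open>z\<close> both the chart and the ball condition see \<open>z\<close> only through
          its norm \<open>s\<close>.\<close>
        define H where "H = (\<lambda>y. g (\<lambda>i\<in>I. y i / s) * indicator {..1} (s\<^sup>2 + (\<Sum>i\<in>I. (y i)\<^sup>2)))"
        have div_meas: "(\<lambda>y. \<lambda>i\<in>I. y i / s) \<in> measurable (\<Pi>\<^sub>M i\<in>I. borel) (\<Pi>\<^sub>M i\<in>I. borel)"
          by measurable
        have H': "H \<in> borel_measurable (\<Pi>\<^sub>M i\<in>I. borel)"
          unfolding H_def
          by (intro borel_measurable_times_ennreal measurable_compose[OF div_meas g']) measurable
        have H [measurable]: "H \<in> borel_measurable (lebprod I)"
          using H' by (simp add: measurable_cong_sets[OF sets_lebprod refl])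
        have re_meas: "(\<lambda>x. \<lambda>i\<in>I. x (h i)) \<in> measurable (lebprod (h ` I)) (lebprod I)"
          by (intro measurable_restrict measurable_component_singleton) auto
        have "(\<integral>\<^sup>+y. G (merge ?Z (h ` I) (z, y)) * indicator (unit_ball n) (merge ?Z (h ` I) (z, y)) \<partial>lebprod (h ` I))
           = (\<integral>\<^sup>+y. H (\<lambda>i\<in>I. y (h i)) \<partial>lebprod (h ` I))"
        proof (intro nn_integral_cong)
          fix y assume y: "y \<in> space (lebprod (h ` I))"
          have "merge ?Z (h ` I) (z, y) (h i) = y (h i)" if "i \<in> I" for i
            using that by auto
          then have "(\<lambda>i\<in>I. merge ?Z (h ` I) (z, y) (h i) / s) = (\<lambda>i\<in>I. (\<lambda>i\<in>I. y (h i)) i / s)"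
            by (auto simp: fun_eq_iff)
          moreover have "merge ?Z (h ` I) (z, y) \<in> extensional (?Z \<union> h ` I)"
            by (rule extensional_merge)
          then have "merge ?Z (h ` I) (z, y) \<in> unit_ball n \<longleftrightarrow> s\<^sup>2 + (\<Sum>i\<in>I. (y (h i))\<^sup>2) \<le> 1"
            unfolding Un by (simp add: unit_ball_def Lm' space_lebprod)
          ultimately show "G (merge ?Z (h ` I) (z, y)) * indicator (unit_ball n) (merge ?Z (h ` I) (z, y)) =
              H (\<lambda>i\<in>I. y (h i))"
            by (simp add: G_def Lm H_def indicator_def)
        qed
        also have "\<dots> = (\<integral>\<^sup>+y. H y \<partial>distr (lebprod (h ` I)) (lebprod I) (\<lambda>x. \<lambda>i\<in>I. x (h i)))"
          using re_meas H by (simp add: nn_integral_distr)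
        also have "\<dots> = (\<integral>\<^sup>+y. H y \<partial>lebprod I)"
          using I by (simp add: distr_lebprod_reindex)
        \<comment> \<open>The substitution \<open>y = s w\<close>.\<close>
        also have "\<dots> = ennreal (s ^ card I) * (\<integral>\<^sup>+w. H (\<lambda>i\<in>I. s * w i) \<partial>lebprod I)"
          by (rule nn_integral_lebprod_scale[OF I(1) H s])
        also have "(\<integral>\<^sup>+w. H (\<lambda>i\<in>I. s * w i) \<partial>lebprod I) = (\<integral>\<^sup>+w. g w * indicator {..chart_factor I w} s \<partial>lebprod I)"
        proof (intro nn_integral_cong)
          fix w assume w: "w \<in> space (lebprod I)"
          have "(\<lambda>i\<in>I. (\<lambda>i\<in>I. s * w i) i / s) = w"
            using s w by (auto simp: fun_eq_iff space_lebprod extensional_def)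
          \<comment> \<open>In the variable \<open>w\<close> the ball condition is
            \<open>s\<^sup>2 (1 + |w|\<^sup>2) \<le> 1\<close>, a bound on \<open>s\<close>
            alone.\<close>
          moreover have "s\<^sup>2 + (\<Sum>i\<in>I. ((\<lambda>i\<in>I. s * w i) i)\<^sup>2) \<le> 1 \<longleftrightarrow> s \<le> chart_factor I w"
          proof -
            let ?c = "1 + (\<Sum>i\<in>I. (w i)\<^sup>2)"
            have c: "0 < ?c" by (simp add: add_pos_nonneg sum_nonneg)
            have "s\<^sup>2 + (\<Sum>i\<in>I. ((\<lambda>i\<in>I. s * w i) i)\<^sup>2) = s\<^sup>2 * ?c"
              by (simp add: power_mult_distrib sum_distrib_left distrib_left)
            also have "\<dots> = (s * sqrt ?c)\<^sup>2"
              using c by (simp add: power_mult_distrib)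
            also have "\<dots> \<le> 1 \<longleftrightarrow> s * sqrt ?c \<le> 1"
              using s c by (simp add: power_le_one_iff abs_square_le_1 abs_mult)
            also have "\<dots> \<longleftrightarrow> s \<le> chart_factor I w"
              using c by (simp add: chart_factor_def pos_le_divide_eq)
            finally show ?thesis .
          qed
          ultimately show "H (\<lambda>i\<in>I. s * w i) = g w * indicator {..chart_factor I w} s"
            by (simp add: H_def indicator_def)
        qed
        also have "ennreal (s ^ card I) * \<dots> = (\<integral>\<^sup>+w. ennreal (s ^ card I) * (g w * indicator {..chart_factor I w} s) \<partial>lebprod I)"
          by (intro nn_integral_cmult[symmetric]) measurable
        finally show ?case
          by (simp add: s_def mult_ac)
      qed
    qed
    also have "\<dots> = (\<integral>\<^sup>+w. (\<integral>\<^sup>+z. g w * (ennreal (L2_set z ?Z ^ card I) * indicator {..chart_factor I w} (L2_set z ?Z)) \<partial>lebprod ?Z) \<partial>lebprod I)"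
      by (rule P.Fubini'[symmetric]) measurable
    also have "\<dots> = (\<integral>\<^sup>+w. K' * (g w * ennreal (chart_factor I w ^ n)) \<partial>lebprod I)"
    proof (intro nn_integral_cong)
      fix w
      let ?c = "chart_factor I w"
      have c: "0 < ?c" by (rule chart_factor_pos)
      let ?f = "\<lambda>z. ennreal (L2_set z ?Z ^ card I) * indicator {..?c} (L2_set z ?Z)"
      have "(\<integral>\<^sup>+z. ?f z \<partial>lebprod ?Z) = ennreal (?c ^ card ?Z) * (\<integral>\<^sup>+z. ?f (\<lambda>i\<in>?Z. ?c * z i) \<partial>lebprod ?Z)"
        using c by (intro nn_integral_lebprod_scale) auto
      also have "(\<integral>\<^sup>+z. ?f (\<lambda>i\<in>?Z. ?c * z i) \<partial>lebprod ?Z) =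
        (\<integral>\<^sup>+z. ennreal (?c ^ card I) * (ennreal (L2_set z ?Z ^ card I) * indicator {..1} (L2_set z ?Z)) \<partial>lebprod ?Z)"
      proof (intro nn_integral_cong)
        fix z
        have "L2_set (\<lambda>i\<in>?Z. ?c * z i) ?Z = L2_set (\<lambda>i. ?c * z i) ?Z"
          by (intro L2_set_cong) auto
        also have "\<dots> = ?c * L2_set z ?Z"
          using c by (simp add: L2_set_right_distrib)
        finally show "?f (\<lambda>i\<in>?Z. ?c * z i) = ennreal (?c ^ card I) * (ennreal (L2_set z ?Z ^ card I) * indicator {..1} (L2_set z ?Z))"
          using c by (simp add: power_mult_distrib ennreal_mult' indicator_def mult.assoc)
      qed
      also have "\<dots> = ennreal (?c ^ card I) * K'"
        unfolding K'_def by (intro nn_integral_cmult) measurable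
      \<comment> \<open>The Jacobian in \<open>z\<close> and the factor from \<open>y = s w\<close>
        contribute \<open>card ?Z\<close> and \<open>card I\<close> powers. Their sum is
        \<open>n\<close> whatever the size of \<open>I\<close>.\<close>
      also have "ennreal (?c ^ card ?Z) * (ennreal (?c ^ card I) * K') = ennreal (?c ^ n) * K'"
        using c by (simp add: mult.assoc[symmetric] ennreal_mult'[symmetric] power_add[symmetric] card)
      finally have "(\<integral>\<^sup>+z. ?f z \<partial>lebprod ?Z) = ennreal (?c ^ n) * K'" .
      moreover have "(\<integral>\<^sup>+z. g w * ?f z \<partial>lebprod ?Z) = g w * (\<integral>\<^sup>+z. ?f z \<partial>lebprod ?Z)"
        by (intro nn_integral_cmult) measurable
      ultimately show "(\<integral>\<^sup>+z. g w * ?f z \<partial>lebprod ?Z) = K' * (g w * ennreal (?c ^ n))"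
        by (simp add: mult_ac)
    qed
    also have "\<dots> = K' * (\<integral>\<^sup>+w. g w * ennreal (chart_factor I w ^ n) \<partial>lebprod I)"
      by (intro nn_integral_cmult) measurable
    finally show "(\<integral>\<^sup>+u. g (\<lambda>i\<in>I. u (h i) / L2_set u ?Z) \<partial>sphere_uniform n) =
        K' / ?B * (\<integral>\<^sup>+w. g w * ennreal (chart_factor I w ^ n) \<partial>lebprod I)"
      by (simp add: G_def ennreal_times_divide divide_ennreal_def mult_ac)
  qed
qed

subsection \<open>Coordinates with respect to an orthonormal family\<close>

text \<open>The same affine chart with the coordinate axes replaced by the family \<open>q\<close>;
  the norm of the residual takes the place of the norm of \<open>z\<close>.\<close>

definition chart_coords :: "nat \<Rightarrow> 'j set \<Rightarrow> ('j \<Rightarrow> nat \<Rightarrow> real) \<Rightarrow> (nat \<Rightarrow> real) \<Rightarrow> 'j \<Rightarrow> real" where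
  "chart_coords n I q x = (\<lambda>i\<in>I. ip n (q i) x / L2_set (resid n I q x) {..<n})"

lemma resid_cong: "(\<And>l. l \<in> I \<Longrightarrow> q l = q' l) \<Longrightarrow> resid n I q x = resid n I q' x"
  by (simp add: resid_def cong: sum.cong)

lemma chart_coords_cong: "(\<And>l. l \<in> I \<Longrightarrow> q l = q' l) \<Longrightarrow> chart_coords n I q x = chart_coords n I q' x"
  using resid_cong[of I q q' n x] by (simp add: chart_coords_def cong: restrict_cong)

lemma orthonormal_cong: "(\<And>l. l \<in> I \<Longrightarrow> q l = q' l) \<Longrightarrow> orthonormal n I q \<longleftrightarrow> orthonormal n I q'"
  by (simp add: orthonormal_def)

lemma measurable_resid [measurable (raw)]:
  assumes "\<And>l. l \<in> I \<Longrightarrow> (\<lambda>x. q x l) \<in> measurable N (vec_space n)" and [measurable]: "f \<in> measurable N (vec_space n)"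
  shows "(\<lambda>x. resid n I (q x) (f x)) \<in> measurable N (vec_space n)"
proof -
  have [measurable]: "(\<lambda>x. q x l i) \<in> borel_measurable N" if "l \<in> I" "i \<in> {..<n}" for l i
    using assms(1)[OF that(1)] that(2) by (rule measurable_comp_PiM)
  have [measurable]: "(\<lambda>x. ip n (q x l) (f x)) \<in> borel_measurable N" if "l \<in> I" for l
    using assms(1)[OF that] assms(2) by (rule measurable_ip)
  show ?thesis
    unfolding resid_def by measurable
qed

lemma measurable_chart_coords [measurable (raw)]:
  assumes "\<And>l. l \<in> I \<Longrightarrow> (\<lambda>x. q x l) \<in> measurable N (vec_space n)" and [measurable]: "f \<in> measurable N (vec_space n)"
  shows "(\<lambda>x. chart_coords n I (q x) (f x)) \<in> measurable N (\<Pi>\<^sub>M i\<in>I. borel)"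
proof -
  have [measurable]: "(\<lambda>x. ip n (q x l) (f x)) \<in> borel_measurable N" if "l \<in> I" for l
    using assms(1)[OF that] assms(2) by (rule measurable_ip)
  have [measurable]: "(\<lambda>x. L2_set (resid n I (q x) (f x)) {..<n}) \<in> borel_measurable N"
    by (rule measurable_L2_set[OF _ subset_refl measurable_resid[OF assms]]) auto
  show ?thesis
    unfolding chart_coords_def by measurable
qed

text \<open>\<open>W\<close> has \<open>q i\<close> as column number \<open>h i\<close>, so products
  with \<open>q i\<close> turn into coordinates and the residual keeps exactly the other
  coordinates.\<close>

lemma orthonormal_rotate:
  assumes "orthonormal n I q" "finite I" "inj_on h I" "h ` I \<subseteq> {..<n}"
  obtains W where "W \<in> orthogonal_group n" "\<And>i u. i \<in> I \<Longrightarrow> ip n (q i) (mulv n W u) = u (h i)"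
    "\<And>u. L2_set (resid n I q (mulv n W u)) {..<n} = L2_set u ({..<n} - h ` I)"
proof -
  obtain W where W: "W \<in> orthogonal_group n" "\<And>i. i \<in> I \<Longrightarrow> W (h i) = q i"
    using orthonormal_extend[OF assms] by blast
  show thesis
  proof (rule that[OF W(1)])
    show ip: "ip n (q i) (mulv n W u) = u (h i)" if "i \<in> I" for i u
      using ip_mulv_left[OF W(1), of "h i" u] W(2)[OF that] assms(4) that by auto
    show "L2_set (resid n I q (mulv n W u)) {..<n} = L2_set u ({..<n} - h ` I)" for u
    proof -
      have "ip n (resid n I q (mulv n W u)) (resid n I q (mulv n W u)) = ip n u u - (\<Sum>i\<in>I. (u (h i))\<^sup>2)"
        using ip_resid_self[OF assms(1,2)] by (simp add: ip_mulv[OF W(1)] ip)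
      also have "\<dots> = (\<Sum>i<n. (u i)\<^sup>2) - (\<Sum>i\<in>h ` I. (u i)\<^sup>2)"
        using assms(3) by (simp add: ip_def sum.reindex power2_eq_square)
      also have "\<dots> = (\<Sum>i\<in>{..<n} - h ` I. (u i)\<^sup>2)"
        using assms(4) by (subst sum_diff) auto
      finally show ?thesis
        by (subst L2_set_eq_sqrt_ip) (simp add: L2_set_def)
    qed
  qed
qed

lemma obtain_embedding:
  assumes "finite I" "card I \<le> n"
  obtains h :: "'i \<Rightarrow> nat" where "inj_on h I" "h ` I \<subseteq> {..<n}"
proof -
  obtain h where "bij_betw h I {0..<card I}"
    using ex_bij_betw_finite_nat[OF assms(1)] by blast
  then show thesis
    using assms(2) by (intro that[of h]) (auto simp: bij_betw_def)
qed

lemma measurable_chart_coords_const: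
  assumes "orthonormal n I q"
  shows "chart_coords n I q \<in> measurable (vec_space n) (\<Pi>\<^sub>M i\<in>I. borel)"
  using assms by (intro measurable_chart_coords measurable_const)
    (auto simp: orthonormal_def space_vec_space)

lemma measurable_resid_const:
  assumes "orthonormal n I q"
  shows "resid n I q \<in> measurable (vec_space n) (vec_space n)"
  using assms by (intro measurable_resid measurable_const)
    (auto simp: orthonormal_def space_vec_space)

text \<open>Rotation invariance replaces \<open>q\<close> by coordinate axes, hence the law of the
  chart coordinates does not depend on \<open>q\<close>. This is the source of independence between
  the columns in the chart.\<close>

lemma nn_integral_chart_coords:
  assumes "orthonormal n I q" "finite I" "card I < n" "g \<in> borel_measurable (\<Pi>\<^sub>M i\<in>I. borel)"
  shows "chart_mass n I * (\<integral>\<^sup>+u. g (chart_coords n I q u) \<partial>sphere_uniform n) =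
    (\<integral>\<^sup>+w. g w * ennreal (chart_factor I w ^ n) \<partial>lebprod I)"
    and chart_mass_pos: "chart_mass n I \<noteq> 0"
    and chart_mass_finite: "chart_mass n I \<noteq> \<infinity>"
proof -
  obtain h :: "'a \<Rightarrow> nat" where h: "inj_on h I" "h ` I \<subseteq> {..<n}"
    using obtain_embedding[OF assms(2) less_imp_le[OF assms(3)]] .
  obtain K where K: "\<And>g. g \<in> borel_measurable (lebprod I) \<Longrightarrow>
    (\<integral>\<^sup>+u. g (\<lambda>i\<in>I. u (h i) / L2_set u ({..<n} - h ` I)) \<partial>sphere_uniform n) =
      K * (\<integral>\<^sup>+w. g w * ennreal (chart_factor I w ^ n) \<partial>lebprod I)"
    using sphere_chart_coordinates_aux[OF assms(2) h assms(3)] by blast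
  obtain W where W: "W \<in> orthogonal_group n" "\<And>i u. i \<in> I \<Longrightarrow> ip n (q i) (mulv n W u) = u (h i)"
    "\<And>u. L2_set (resid n I q (mulv n W u)) {..<n} = L2_set u ({..<n} - h ` I)"
    using orthonormal_rotate[OF assms(1,2) h] by blast
  interpret prob_space "sphere_uniform n"
    by (rule prob_space_sphere_uniform)
  \<comment> \<open>The constant function 1 identifies \<open>K\<close> as the reciprocal of the
    chart mass, which therefore is neither 0 nor infinite.\<close>
  have K1: "1 = K * chart_mass n I"
    using K[of "\<lambda>_. 1"] emeasure_space_1 by (simp add: chart_mass_def)
  show pos: "chart_mass n I \<noteq> 0"
    using K1 by auto
  show fin: "chart_mass n I \<noteq> \<infinity>"
    using K1 by (cases "K = 0") (auto simp: ennreal_mult_top)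
  have "(\<integral>\<^sup>+u. g (chart_coords n I q u) \<partial>sphere_uniform n) =
      (\<integral>\<^sup>+u. g (chart_coords n I q (mulv n W u)) \<partial>sphere_uniform n)"
    by (rule nn_integral_sphere_uniform_mulv[OF W(1), symmetric])
       (rule measurable_compose[OF measurable_chart_coords_const[OF assms(1)] assms(4)])
  also have "\<dots> = (\<integral>\<^sup>+u. g (\<lambda>i\<in>I. u (h i) / L2_set u ({..<n} - h ` I)) \<partial>sphere_uniform n)"
    using W(2,3) by (simp add: chart_coords_def cong: restrict_cong)
  also have "\<dots> = K * (\<integral>\<^sup>+w. g w * ennreal (chart_factor I w ^ n) \<partial>lebprod I)"
    using assms(4) by (intro K) (simp add: measurable_cong_sets[OF sets_lebprod refl])
  finally show "chart_mass n I * (\<integral>\<^sup>+u. g (chart_coords n I q u) \<partial>sphere_uniform n) =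
    (\<integral>\<^sup>+w. g w * ennreal (chart_factor I w ^ n) \<partial>lebprod I)"
    by (simp add: mult.assoc[symmetric] mult.commute[of _ K] K1[symmetric])
qed

text \<open>After a rotation the residual norm is that of a nonempty block of coordinates, and a
  single coordinate vanishes only on a null set. The event is transferred as an integral of an
  indicator.\<close>

lemma AE_sphere_uniform_resid:
  assumes "orthonormal n I q" "finite I" "card I < n"
  shows "AE x in sphere_uniform n. L2_set (resid n I q x) {..<n} \<noteq> 0"
proof -
  obtain h :: "'a \<Rightarrow> nat" where h: "inj_on h I" "h ` I \<subseteq> {..<n}"
    using obtain_embedding[OF assms(2) less_imp_le[OF assms(3)]] .
  obtain W where W: "W \<in> orthogonal_group n"
    "\<And>u. L2_set (resid n I q (mulv n W u)) {..<n} = L2_set u ({..<n} - h ` I)"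
    using orthonormal_rotate[OF assms(1,2) h] by metis
  have "h ` I \<noteq> {..<n}"
    using card_image[OF h(1)] assms(3) by auto
  then have ne: "{..<n} - h ` I \<noteq> {}" "{..<n} \<noteq> {}"
    using h(2) by auto
  have [measurable]: "(\<lambda>x. L2_set x ({..<n} - h ` I)) \<in> borel_measurable (vec_space n)"
    by (rule measurable_L2_set[where I="{..<n}"]) auto
  have [measurable]: "(\<lambda>x. L2_set (resid n I q x) {..<n}) \<in> borel_measurable (vec_space n)"
    by (rule measurable_L2_set[OF _ subset_refl measurable_resid_const[OF assms(1)]]) auto
  have "AE x in lebprod {..<n}. 0 < L2_set x ({..<n} - h ` I)"
    "AE x in lebprod {..<n}. 0 < L2_set x {..<n}"
    using ne by (intro AE_lebprod_L2_set_pos; auto)+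
  then have "AE x in lebprod {..<n}. L2_set (normalize_vec n x) ({..<n} - h ` I) \<noteq> 0"
    by eventually_elim (simp add: L2_set_normalize_vec)
  then have "AE x in sphere_uniform n. L2_set x ({..<n} - h ` I) \<noteq> 0"
    by (rule AE_sphere_uniformI) measurable
  then have "0 = (\<integral>\<^sup>+x. indicator {0} (L2_set x ({..<n} - h ` I)) \<partial>sphere_uniform n)"
    by (subst nn_integral_0_iff_AE[THEN iffD2]) auto
  also have "\<dots> = (\<integral>\<^sup>+x. indicator {0} (L2_set (resid n I q (mulv n W x)) {..<n}) \<partial>sphere_uniform n)"
    by (simp add: W(2))
  also have "\<dots> = (\<integral>\<^sup>+x. indicator {0} (L2_set (resid n I q x) {..<n}) \<partial>sphere_uniform n)"
    by (rule nn_integral_sphere_uniform_mulv[OF W(1)]) measurable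
  finally show ?thesis
    by (subst (asm) eq_commute, subst (asm) nn_integral_0_iff_AE) (auto simp: indicator_def)
qed

subsection \<open>The Gram-Schmidt recursion\<close>

text \<open>
  For linearly dependent columns \<open>L2_set _ _ = 0\<close> makes some vectors of \<open>gs\<close> vanish; the factorization
  identity and the equivariance under rotations hold regardless.
\<close>

function gs :: "nat \<Rightarrow> 'j::linorder set \<Rightarrow> ('j \<Rightarrow> nat \<Rightarrow> real) \<Rightarrow> 'j \<Rightarrow> nat \<Rightarrow> real" where
  "gs n J X j = normalize_vec n
     (\<lambda>i\<in>{..<n}. X j i - (\<Sum>l\<in>{l\<in>J. l < j \<and> finite J}. ip n (gs n J X l) (X j) * gs n J X l i))"
  by pat_completeness auto
termination
  \<comment> \<open>The conjunct \<open>finite J\<close> inside the index set makes the sum empty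
    for infinite \<open>J\<close>, so every recursive call lowers this cardinality.\<close>
  by (relation "Wellfounded.measure (\<lambda>(n, J, X, j). card {l\<in>J. l < j})") (auto intro!: psubset_card_mono)

declare gs.simps [simp del]

definition gs_resid :: "nat \<Rightarrow> 'j::linorder set \<Rightarrow> ('j \<Rightarrow> nat \<Rightarrow> real) \<Rightarrow> 'j \<Rightarrow> nat \<Rightarrow> real" where
  "gs_resid n J X j = resid n {l\<in>J. l < j} (gs n J X) (X j)"

text \<open>Full column rank as seen by the recursion: no column is a combination of the earlier
  ones. The equivalence is \<open>full_column_rank_iff\<close>.\<close>

definition gs_nondeg :: "nat \<Rightarrow> 'j::linorder set \<Rightarrow> ('j \<Rightarrow> nat \<Rightarrow> real) \<Rightarrow> bool" where
  "gs_nondeg n J X \<longleftrightarrow> (\<forall>j\<in>J. L2_set (gs_resid n J X j) {..<n} \<noteq> 0)"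

lemma gs_rec: "finite J \<Longrightarrow> gs n J X j = normalize_vec n (gs_resid n J X j)"
  by (subst gs.simps) (simp add: gs_resid_def resid_def)

text \<open>The index type need not be well ordered and \<open>j\<close> need not lie in
  \<open>J\<close>; the number of elements of \<open>J\<close> below \<open>j\<close>
  decreases.\<close>

lemma gs_less_induct [consumes 1, case_names less]:
  fixes J :: "'j::linorder set"
  assumes "finite J" and step: "\<And>j. (\<And>l. l \<in> J \<Longrightarrow> l < j \<Longrightarrow> P l) \<Longrightarrow> P j"
  shows "P j"
proof (induction "card {l\<in>J. l < j}" arbitrary: j rule: less_induct)
  case less
  show ?case
  proof (rule step)
    fix l assume "l \<in> J" "l < j"
    then have "card {l'\<in>J. l' < l} < card {l\<in>J. l < j}"
      using assms(1) by (intro psubset_card_mono) auto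
    then show "P l" by (rule less)
  qed
qed

lemma gs_cong:
  assumes "finite J" "finite J'" "{l\<in>J. l < j} = {l\<in>J'. l < j}" "\<And>l. l \<in> J \<Longrightarrow> l < j \<Longrightarrow> X l = X' l" "X j = X' j"
  shows "gs n J X j = gs n J' X' j"
  using assms(1,3-)
proof (induction j rule: gs_less_induct)
  case (less j)
  have "gs n J X l = gs n J' X' l" if "l \<in> {l\<in>J. l < j}" for l
    using that less.prems by (intro less.IH) auto
  then have "gs_resid n J X j = gs_resid n J' X' j"
    unfolding gs_resid_def less.prems(3) less.prems(1)[symmetric] by (rule resid_cong)
  then show ?case
    by (simp add: gs_rec assms(1,2))
qed

lemma gs_resid_cong:
  assumes "finite J" "finite J'" "{l\<in>J. l < j} = {l\<in>J'. l < j}" "\<And>l. l \<in> J \<Longrightarrow> l < j \<Longrightarrow> X l = X' l" "X j = X' j"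
  shows "gs_resid n J X j = gs_resid n J' X' j"
proof -
  have "gs n J X l = gs n J' X' l" if "l \<in> {l\<in>J. l < j}" for l
    using that assms by (intro gs_cong) auto
  then show ?thesis
    unfolding gs_resid_def assms(5) assms(3)[symmetric] by (rule resid_cong)
qed

text \<open>A new largest index does not disturb the earlier vectors. Hence the proofs on
  \<open>gs\<close> can add one column at a time, always the last one.\<close>

lemma gs_insert_max:
  fixes J :: "'j::linorder set"
  assumes "finite J" "\<And>a. a \<in> J \<Longrightarrow> a < b" "\<And>l. l \<in> J \<Longrightarrow> X l = X' l"
  shows "j \<in> J \<Longrightarrow> gs n (insert b J) X j = gs n J X' j"
    and "j \<in> J \<Longrightarrow> gs_resid n (insert b J) X j = gs_resid n J X' j"
    and "gs_resid n (insert b J) X b = resid n J (gs n J X') (X b)"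
proof -
  have eq: "{l \<in> insert b J. l < j} = {l\<in>J. l < j}" if "j \<in> J" for j
    using assms(2)[OF that] by auto
  show 1: "gs n (insert b J) X j = gs n J X' j" if "j \<in> J" for j
    by (intro gs_cong eq) (use assms that assms(2)[OF that] in \<open>auto dest: less_asym\<close>)
  show "gs_resid n (insert b J) X j = gs_resid n J X' j" if "j \<in> J" for j
    by (intro gs_resid_cong eq) (use assms that assms(2)[OF that] in \<open>auto dest: less_asym\<close>)
  have "{l \<in> insert b J. l < b} = J"
    using assms(2) by auto
  then show "gs_resid n (insert b J) X b = resid n J (gs n J X') (X b)"
    unfolding gs_resid_def using 1 by (auto intro: resid_cong)
qed

lemma orthonormal_gs:
  assumes "finite J" "gs_nondeg n J X"
  shows "orthonormal n J (gs n J X)"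
  using assms
proof (induction J rule: finite_linorder_max_induct)
  case empty
  show ?case by (simp add: orthonormal_def)
next
  case (insert b J)
  note ins = gs_insert_max[OF insert.hyps(1), of b X X]
  have nondeg: "gs_nondeg n J X"
    using insert.prems insert.hyps(2) ins(2) by (auto simp: gs_nondeg_def)
  then have IH: "orthonormal n J (gs n J X)"
    by (rule insert.IH)
  let ?r = "resid n J (gs n J X) (X b)"
  have r: "gs_resid n (insert b J) X b = ?r"
    using insert.hyps(2) by (intro ins(3)) auto
  have gs_b: "gs n (insert b J) X b = normalize_vec n ?r"
    using insert.hyps(1) r by (simp add: gs_rec)
  have "L2_set ?r {..<n} \<noteq> 0"
    using insert.prems r by (auto simp: gs_nondeg_def)
  then have "orthonormal n (insert b J) ((gs n J X)(b := normalize_vec n ?r))"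
    using IH insert.hyps ip_resid_orthogonal[OF IH insert.hyps(1), of _ "X b"]
    by (intro orthonormal_insert ip_normalize_self) (auto simp: ip_normalize_right, simp add: normalize_vec_def)
  also have "?this \<longleftrightarrow> ?case"
    using insert.hyps ins(1) gs_b by (intro orthonormal_cong) auto
  finally show ?case .
qed

lemma gs_mulv:
  assumes "V \<in> orthogonal_group n" "finite J"
  shows "gs n J (\<lambda>j. mulv n V (X j)) j = mulv n V (gs n J X j)"
  using assms(2)
proof (induction j rule: gs_less_induct)
  case (less j)
  have "gs_resid n J (\<lambda>j. mulv n V (X j)) j = resid n {l\<in>J. l < j} (\<lambda>l. mulv n V (gs n J X l)) (mulv n V (X j))"
    unfolding gs_resid_def using less by (intro resid_cong) auto
  also have "\<dots> = mulv n V (gs_resid n J X j)"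
    by (simp add: gs_resid_def mulv_resid[OF assms(1)])
  finally show ?case
    by (simp add: gs_rec assms mulv_normalize)
qed

lemma gs_resid_mulv:
  assumes "V \<in> orthogonal_group n" "finite J"
  shows "gs_resid n J (\<lambda>j. mulv n V (X j)) j = mulv n V (gs_resid n J X j)"
  using gs_mulv[OF assms, of X]
  by (simp add: gs_resid_def mulv_resid[OF assms(1)]) (intro resid_cong, auto)

lemma gs_decomposition:
  assumes "finite J" "i < n"
  shows "X j i = (\<Sum>l\<in>{l\<in>J. l < j}. gs n J X l i * ip n (gs n J X l) (X j)) +
    gs n J X j i * L2_set (gs_resid n J X j) {..<n}"
proof -
  have "gs n J X j i * L2_set (gs_resid n J X j) {..<n} = gs_resid n J X j i"
  proof (cases "L2_set (gs_resid n J X j) {..<n} = 0")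
    case True
    then show ?thesis
      using assms(2) by (simp add: L2_set_lessThan_eq_0_iff)
  next
    case False
    then show ?thesis
      using assms by (simp add: gs_rec normalize_vec_def)
  qed
  then show ?thesis
    using assms(2) by (simp add: gs_resid_def resid_def mult.commute)
qed

section \<open>Measurability of the recursion\<close>

lemma measurable_colmat_proj: "j \<in> J \<Longrightarrow> (\<lambda>X. X j) \<in> measurable (colmat_space n J) (vec_space n)"
  unfolding colmat_space_def by (rule measurable_component_singleton)

lemma measurable_colmat_component:
  "f \<in> measurable N (colmat_space n J) \<Longrightarrow> j \<in> J \<Longrightarrow> (\<lambda>x. f x j) \<in> measurable N (vec_space n)"
  using measurable_compose[OF _ measurable_colmat_proj] .

lemma measurable_gs_aux:
  assumes "finite J" "j \<in> J"
  shows "(\<lambda>X. gs n J X j) \<in> measurable (colmat_space n J) (vec_space n)"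
  using assms(2)
proof (induction j rule: gs_less_induct[OF assms(1)])
  case (1 j)
  have "(\<lambda>X. gs_resid n J X j) \<in> measurable (colmat_space n J) (vec_space n)"
    unfolding gs_resid_def using 1
    by (intro measurable_resid measurable_colmat_proj) auto
  then show ?case
    unfolding gs_rec[OF assms(1)] by (rule measurable_normalize_vec)
qed

lemma measurable_gs [measurable (raw)]:
  assumes "f \<in> measurable N (colmat_space n J)" "finite J" "j \<in> J"
  shows "(\<lambda>x. gs n J (f x) j) \<in> measurable N (vec_space n)"
  using measurable_compose[OF assms(1) measurable_gs_aux[OF assms(2,3)]] .

lemma measurable_gs_resid [measurable (raw)]:
  assumes "f \<in> measurable N (colmat_space n J)" "finite J" "j \<in> J"
  shows "(\<lambda>x. gs_resid n J (f x) j) \<in> measurable N (vec_space n)"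
  unfolding gs_resid_def using assms
  by (intro measurable_resid measurable_colmat_component[OF assms(1)] measurable_gs) auto

lemma measurable_L2_set_gs_resid [measurable (raw)]:
  assumes "f \<in> measurable N (colmat_space n J)" "finite J" "j \<in> J"
  shows "(\<lambda>x. L2_set (gs_resid n J (f x) j) {..<n}) \<in> borel_measurable N"
  by (rule measurable_L2_set[OF _ subset_refl measurable_gs_resid[OF assms]]) simp

lemma pred_gs_nondeg [measurable (raw)]:
  assumes "f \<in> measurable N (colmat_space n J)" "finite J"
  shows "Measurable.pred N (\<lambda>x. gs_nondeg n J (f x))"
  unfolding gs_nondeg_def
proof (rule pred_intros_finite(3))
  fix j assume "j \<in> J"
  then have [measurable]: "(\<lambda>x. L2_set (gs_resid n J (f x) j) {..<n}) \<in> borel_measurable N"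
    by (intro measurable_L2_set_gs_resid assms)
  show "Measurable.pred N (\<lambda>x. L2_set (gs_resid n J (f x) j) {..<n} \<noteq> 0)"
    by measurable
qed (fact assms)

subsection \<open>Independent uniform columns\<close>

abbreviation sphere_cols :: "nat \<Rightarrow> 'j set \<Rightarrow> ('j \<Rightarrow> nat \<Rightarrow> real) measure" where
  "sphere_cols n J \<equiv> \<Pi>\<^sub>M j\<in>J. sphere_uniform n"

definition mulm :: "nat \<Rightarrow> 'j set \<Rightarrow> (nat \<Rightarrow> nat \<Rightarrow> real) \<Rightarrow> ('j \<Rightarrow> nat \<Rightarrow> real) \<Rightarrow> 'j \<Rightarrow> nat \<Rightarrow> real" where
  "mulm n J V X = (\<lambda>j\<in>J. mulv n V (X j))"

lemma sets_sphere_cols [measurable_cong]: "sets (sphere_cols n J) = sets (colmat_space n J)"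
  unfolding colmat_space_def by (rule sets_PiM_cong) auto

lemma space_sphere_cols: "space (sphere_cols n J) = space (colmat_space n J)"
  using sets_eq_imp_space_eq[OF sets_sphere_cols] .

lemma product_prob_space_sphere: "product_prob_space (\<lambda>_. sphere_uniform n)"
  by (intro product_prob_spaceI prob_space_sphere_uniform)

lemma product_sigma_finite_sphere: "product_sigma_finite (\<lambda>_. sphere_uniform n)"
  by (rule product_prob_space.axioms(1)[OF product_prob_space_sphere])

lemma prob_space_sphere_cols: "prob_space (sphere_cols n J)"
  by (intro prob_space_PiM prob_space_sphere_uniform)

lemma measurable_mulm: "mulm n J V \<in> measurable (colmat_space n J) (colmat_space n J)"
  unfolding mulm_def[abs_def]
  by (subst (2) colmat_space_def) (intro measurable_restrict measurable_mulv measurable_colmat_proj)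

lemma mulm_in_space [simp]: "mulm n J V X \<in> space (colmat_space n J)"
  by (simp add: space_colmat mulm_def)

lemma emeasure_sphere_uniform_mulv:
  assumes "V \<in> orthogonal_group n" "A \<in> sets (vec_space n)"
  shows "emeasure (sphere_uniform n) (mulv n V -` A \<inter> space (vec_space n)) = emeasure (sphere_uniform n) A"
proof -
  have meas: "mulv n V -` A \<inter> space (vec_space n) \<in> sets (sphere_uniform n)"
    using assms(2) by (auto intro!: measurable_sets[OF measurable_mulv[OF measurable_ident_sets]])
  have "emeasure (sphere_uniform n) (mulv n V -` A \<inter> space (vec_space n)) =
     (\<integral>\<^sup>+x. indicator (mulv n V -` A \<inter> space (vec_space n)) x \<partial>sphere_uniform n)"
    using meas by simp
  also have "\<dots> = (\<integral>\<^sup>+x. indicator A (mulv n V x) \<partial>sphere_uniform n)"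
    by (intro nn_integral_cong) (auto simp: indicator_def space_sphere_uniform space_vec_space)
  also have "\<dots> = (\<integral>\<^sup>+x. indicator A x \<partial>sphere_uniform n)"
    using assms by (intro nn_integral_sphere_uniform_mulv) auto
  also have "\<dots> = emeasure (sphere_uniform n) A"
    using assms by simp
  finally show ?thesis .
qed

lemma distr_sphere_cols_mulm:
  fixes J :: "'j set"
  assumes V: "V \<in> orthogonal_group n" and "finite J"
  shows "distr (sphere_cols n J) (sphere_cols n J) (mulm n J V) = sphere_cols n J"
proof -
  interpret product_sigma_finite "\<lambda>_::'j. sphere_uniform n"
    by (rule product_sigma_finite_sphere)
  have meas: "mulm n J V \<in> measurable (sphere_cols n J) (sphere_cols n J)"
    using measurable_mulm by (simp cong: measurable_cong_sets add: sets_sphere_cols)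
  show ?thesis
  proof (rule PiM_eqI[OF assms(2)])
    fix A :: "'j \<Rightarrow> (nat \<Rightarrow> real) set" assume A: "\<And>j. j \<in> J \<Longrightarrow> A j \<in> sets (sphere_uniform n)"
    have A': "mulv n V -` A j \<inter> space (vec_space n) \<in> sets (sphere_uniform n)" if "j \<in> J" for j
      using A[OF that] by (auto intro!: measurable_sets[OF measurable_mulv[OF measurable_ident_sets]])
    have "emeasure (distr (sphere_cols n J) (sphere_cols n J) (mulm n J V)) (Pi\<^sub>E J A) =
      emeasure (sphere_cols n J) (mulm n J V -` Pi\<^sub>E J A \<inter> space (sphere_cols n J))"
      using A assms by (intro emeasure_distr meas sets_PiM_I_finite) auto
    also have "mulm n J V -` Pi\<^sub>E J A \<inter> space (sphere_cols n J) = Pi\<^sub>E J (\<lambda>j. mulv n V -` A j \<inter> space (vec_space n))"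
      by (auto simp: space_sphere_cols space_colmat mulm_def PiE_iff space_vec_space)
    also have "emeasure (sphere_cols n J) \<dots> = (\<Prod>j\<in>J. emeasure (sphere_uniform n) (mulv n V -` A j \<inter> space (vec_space n)))"
      using A' by (intro emeasure_PiM assms)
    also have "\<dots> = (\<Prod>j\<in>J. emeasure (sphere_uniform n) (A j))"
      using A by (intro prod.cong refl emeasure_sphere_uniform_mulv V) auto
    finally show "emeasure (distr (sphere_cols n J) (sphere_cols n J) (mulm n J V)) (Pi\<^sub>E J A) =
      (\<Prod>j\<in>J. emeasure (sphere_uniform n) (A j))" .
  qed simp
qed

lemma nn_integral_sphere_cols_insert:
  fixes J :: "'j set"
  assumes "finite J" "b \<notin> J" "f \<in> borel_measurable (colmat_space n (insert b J))"
  shows "(\<integral>\<^sup>+X. f X \<partial>sphere_cols n (insert b J)) =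
    (\<integral>\<^sup>+X. (\<integral>\<^sup>+x. f (X(b := x)) \<partial>sphere_uniform n) \<partial>sphere_cols n J)"
proof -
  interpret product_sigma_finite "\<lambda>_::'j. sphere_uniform n"
    by (rule product_sigma_finite_sphere)
  show ?thesis
    using assms by (intro product_nn_integral_insert) (auto simp: measurable_cong_sets[OF sets_sphere_cols refl])
qed

lemma gs_upd_max:
  fixes J :: "'j::linorder set"
  assumes "finite J" "\<And>a. a \<in> J \<Longrightarrow> a < b"
  shows "j \<in> J \<Longrightarrow> gs n (insert b J) (X(b := x)) j = gs n J X j"
    and "j \<in> J \<Longrightarrow> gs_resid n (insert b J) (X(b := x)) j = gs_resid n J X j"
    and "gs_resid n (insert b J) (X(b := x)) b = resid n J (gs n J X) x"
proof -
  have "\<And>l. l \<in> J \<Longrightarrow> (X(b := x)) l = X l"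
    using assms(2) by auto
  note ins = gs_insert_max[where J=J and b=b and X="X(b := x)" and X'=X and n=n, OF assms this]
  show "j \<in> J \<Longrightarrow> gs n (insert b J) (X(b := x)) j = gs n J X j"
    by (rule ins(1))
  show "j \<in> J \<Longrightarrow> gs_resid n (insert b J) (X(b := x)) j = gs_resid n J X j"
    by (rule ins(2))
  show "gs_resid n (insert b J) (X(b := x)) b = resid n J (gs n J X) x"
    using ins(3) by simp
qed

text \<open>For fixed earlier columns, which span fewer than \<open>n\<close> dimensions, a uniform
  last column almost surely has a nonzero residual.\<close>

lemma AE_sphere_cols_nondeg:
  fixes J :: "'j::linorder set"
  assumes "finite J" "card J \<le> n"
  shows "AE X in sphere_cols n J. gs_nondeg n J X"
  using assms
proof (induction J rule: finite_linorder_max_induct)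
  case empty
  show ?case by (simp add: gs_nondeg_def)
next
  case (insert b J)
  have b: "b \<notin> J" "\<And>a. a \<in> J \<Longrightarrow> a < b"
    using insert.hyps by auto
  have card: "card J < n"
    using insert.prems insert.hyps b by simp
  have [measurable]: "Measurable.pred (colmat_space n (insert b J)) (gs_nondeg n (insert b J))"
    using insert.hyps by (intro pred_gs_nondeg[OF measurable_ident_sets]) auto
  \<comment> \<open>Stated as a vanishing integral of an indicator, the claim allows the last column
    to be integrated first.\<close>
  let ?bad = "{X. \<not> gs_nondeg n (insert b J) X}"
  have ind: "(\<lambda>X. indicator ?bad X :: ennreal) \<in> borel_measurable (colmat_space n (insert b J))"
    by measurable
  have "(\<integral>\<^sup>+X. indicator ?bad X \<partial>sphere_cols n (insert b J)) =
    (\<integral>\<^sup>+X. (\<integral>\<^sup>+x. indicator ?bad (X(b := x)) \<partial>sphere_uniform n) \<partial>sphere_cols n J)"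
    using insert.hyps(1) b(1) ind by (rule nn_integral_sphere_cols_insert)
  also have "\<dots> = (\<integral>\<^sup>+X. 0 \<partial>sphere_cols n J)"
  proof (rule nn_integral_cong_AE)
    have "AE X in sphere_cols n J. gs_nondeg n J X"
      using card by (intro insert.IH) simp
    then show "AE X in sphere_cols n J. (\<integral>\<^sup>+x. indicator ?bad (X(b := x)) \<partial>sphere_uniform n) = 0"
    proof eventually_elim
      case (elim X)
      have "AE x in sphere_uniform n. L2_set (resid n J (gs n J X) x) {..<n} \<noteq> 0"
        using insert.hyps(1) card elim by (intro AE_sphere_uniform_resid orthonormal_gs)
      then have "AE x in sphere_uniform n. (indicator ?bad (X(b := x)) :: ennreal) = 0"
      proof eventually_elim
        case (elim x)
        then have "gs_nondeg n (insert b J) (X(b := x))"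
          using \<open>gs_nondeg n J X\<close> gs_upd_max[OF insert.hyps(1) b(2), where n=n and X=X and x=x]
          by (auto simp: gs_nondeg_def)
        then show ?case by simp
      qed
      then have "(\<integral>\<^sup>+x. indicator ?bad (X(b := x)) \<partial>sphere_uniform n) = (\<integral>\<^sup>+x. 0 \<partial>sphere_uniform n)"
        by (rule nn_integral_cong_AE)
      then show ?case by simp
    qed
  qed
  finally have "(\<integral>\<^sup>+X. indicator ?bad X \<partial>sphere_cols n (insert b J)) = 0"
    by simp
  then show ?case
    using ind by (subst (asm) nn_integral_0_iff_AE)
      (auto simp: indicator_def measurable_cong_sets[OF sets_sphere_cols refl])
qed

section \<open>Joint law of the chart coordinates of all columns\<close>

text \<open>Entry \<open>l\<close> of block \<open>j\<close> is the ratio of the entries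
  \<open>(l, j)\<close> and \<open>(j, j)\<close> of the triangular factor, see
  \<open>rmat_eq_chart_mat\<close>.\<close>

definition gs_chart :: "nat \<Rightarrow> 'j::linorder set \<Rightarrow> ('j \<Rightarrow> nat \<Rightarrow> real) \<Rightarrow> 'j \<Rightarrow> 'j \<Rightarrow> real" where
  "gs_chart n J X = (\<lambda>j\<in>J. chart_coords n {l\<in>J. l < j} (gs n J X) (X j))"

definition chart_space :: "'j::linorder set \<Rightarrow> ('j \<Rightarrow> 'j \<Rightarrow> real) measure" where
  "chart_space J = (\<Pi>\<^sub>M j\<in>J. \<Pi>\<^sub>M l\<in>{l\<in>J. l < j}. borel)"

text \<open>Lebesgue measure on the strictly upper triangular entries, grouped by columns.\<close>

definition chart_leb :: "'j::linorder set \<Rightarrow> ('j \<Rightarrow> 'j \<Rightarrow> real) measure" where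
  "chart_leb J = (\<Pi>\<^sub>M j\<in>J. lebprod {l\<in>J. l < j})"

lemma sets_chart_leb [measurable_cong]: "sets (chart_leb J) = sets (chart_space J)"
  unfolding chart_leb_def chart_space_def by (intro sets_PiM_cong refl sets_lebprod)

lemma product_sigma_finite_lebprod:
  assumes "finite J"
  shows "product_sigma_finite (\<lambda>j. lebprod {l\<in>J. l < j})"
  using assms by (intro product_sigma_finite.intro sigma_finite_lebprod) auto

lemma measurable_gs_chart:
  assumes "finite J"
  shows "gs_chart n J \<in> measurable (colmat_space n J) (chart_space J)"
  unfolding gs_chart_def[abs_def] chart_space_def
  using assms
  by (intro measurable_restrict measurable_chart_coords measurable_colmat_proj measurable_gs measurable_ident_sets) auto

lemma less_set_insert_max:
  fixes J :: "'j::linorder set"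
  assumes "\<And>a. a \<in> J \<Longrightarrow> a < b"
  shows "j \<in> J \<Longrightarrow> {l\<in>insert b J. l < j} = {l\<in>J. l < j}" "{l\<in>insert b J. l < b} = J"
  using assms by (auto dest: less_asym)

lemma gs_chart_upd_max:
  fixes J :: "'j::linorder set"
  assumes "finite J" "\<And>a. a \<in> J \<Longrightarrow> a < b"
  shows "gs_chart n (insert b J) (X(b := x)) = (gs_chart n J X)(b := chart_coords n J (gs n J X) x)"
proof
  fix j
  show "gs_chart n (insert b J) (X(b := x)) j = ((gs_chart n J X)(b := chart_coords n J (gs n J X) x)) j"
  proof (cases "j = b")
    case True
    then show ?thesis
      using less_set_insert_max(2)[OF assms(2)] gs_upd_max(1)[OF assms, where n=n and X=X and x=x]
      by (simp add: gs_chart_def) (intro chart_coords_cong, auto)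
  next
    case False
    then show ?thesis
      using less_set_insert_max(1)[OF assms(2)] gs_upd_max(1)[OF assms, where n=n and X=X and x=x]
      by (cases "j \<in> J") (simp_all add: gs_chart_def, intro chart_coords_cong, auto)
  qed
qed

text \<open>The blocks \<open>w j\<close> are independent with densities
  \<open>chart_factor ^ n / chart_mass\<close>; the masses stand on the left to avoid division.
  Induction on the largest column, whose block has the same law for every frame of earlier
  columns.\<close>

lemma nn_integral_gs_chart:
  fixes J :: "'j::linorder set"
  assumes "finite J" "card J \<le> n" "f \<in> borel_measurable (chart_space J)"
  shows "(\<Prod>j\<in>J. chart_mass n {l\<in>J. l < j}) * (\<integral>\<^sup>+X. f (gs_chart n J X) \<partial>sphere_cols n J) =
    (\<integral>\<^sup>+w. f w * (\<Prod>j\<in>J. ennreal (chart_factor {l\<in>J. l < j} (w j) ^ n)) \<partial>chart_leb J)"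
  using assms
proof (induction J arbitrary: f rule: finite_linorder_max_induct)
  case empty
  interpret product_sigma_finite "\<lambda>j::'j. lebprod {l\<in>{}. l < j}"
    by (rule product_sigma_finite_lebprod) simp
  show ?case
    by (simp add: chart_leb_def gs_chart_def PiM_empty nn_integral_count_space_finite)
next
  case (insert b J)
  have b: "b \<notin> J" "\<And>a. a \<in> J \<Longrightarrow> a < b"
    using insert.hyps by auto
  have card: "card J < n"
    using insert.prems insert.hyps b by simp
  note sets_eq = less_set_insert_max[OF b(2)]
  note [measurable] = insert.prems(2)
  interpret I: product_sigma_finite "\<lambda>j. lebprod {l\<in>insert b J. l < j}"
    using insert.hyps by (intro product_sigma_finite_lebprod) simp
  interpret B: sigma_finite_measure "lebprod J"
    using insert.hyps(1) by (rule sigma_finite_lebprod)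
  have chart_J: "(\<Pi>\<^sub>M j\<in>J. lebprod {l\<in>insert b J. l < j}) = chart_leb J"
    unfolding chart_leb_def by (intro PiM_cong refl) (simp only: sets_eq(1))
  have upd: "(\<lambda>(w, v). w(b := v)) \<in> measurable (chart_space J \<Otimes>\<^sub>M (\<Pi>\<^sub>M l\<in>J. borel)) (chart_space (insert b J))"
  proof -
    have "(\<lambda>(w, v). w(b := v)) \<in> measurable
      ((\<Pi>\<^sub>M j\<in>J. \<Pi>\<^sub>M l\<in>{l\<in>insert b J. l < j}. borel) \<Otimes>\<^sub>M (\<Pi>\<^sub>M l\<in>{l\<in>insert b J. l < b}. borel)) (chart_space (insert b J))"
      unfolding chart_space_def by (rule measurable_add_dim)
    also have "(\<Pi>\<^sub>M j\<in>J. \<Pi>\<^sub>M l\<in>{l\<in>insert b J. l < j}. borel) = (chart_space J :: ('j \<Rightarrow> 'j \<Rightarrow> real) measure)"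
      unfolding chart_space_def by (intro PiM_cong refl) (simp only: sets_eq(1))
    finally show ?thesis
      by (simp only: sets_eq(2))
  qed
  \<comment> \<open>\<open>f\<close> with the block of the last column integrated out; the induction
    hypothesis is applied to it.\<close>
  define F where "F = (\<lambda>w. \<integral>\<^sup>+v. f (w(b := v)) * ennreal (chart_factor J v ^ n) \<partial>lebprod J)"
  have fupd: "(\<lambda>(w, v). f (w(b := v))) \<in> borel_measurable (chart_space J \<Otimes>\<^sub>M lebprod J)"
  proof -
    have "(\<lambda>(w, v). f (w(b := v))) \<in> borel_measurable (chart_space J \<Otimes>\<^sub>M (\<Pi>\<^sub>M l\<in>J. borel))"
      using measurable_compose[OF upd insert.prems(2)] by (simp only: case_prod_unfold)
    then show ?thesis
      by (simp add: measurable_cong_sets[OF sets_pair_measure_cong[OF refl sets_lebprod] refl])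
  qed
  have fupd1: "(\<lambda>v. f (w(b := v))) \<in> borel_measurable (\<Pi>\<^sub>M l\<in>J. borel)" if "w \<in> space (chart_space J)" for w
    using measurable_compose[OF measurable_Pair1'[OF that] fupd]
    by (simp add: measurable_cong_sets[OF sets_lebprod refl])
  have F: "F \<in> borel_measurable (chart_space J)"
    unfolding F_def
  proof (intro B.borel_measurable_nn_integral)
    have "(\<lambda>p. (case p of (w, v) \<Rightarrow> f (w(b := v))) * ennreal (chart_factor J (snd p) ^ n)) \<in>
        borel_measurable (chart_space J \<Otimes>\<^sub>M lebprod J)"
      using fupd by (intro borel_measurable_times_ennreal) (auto intro: measurable_compose[OF measurable_snd])
    then show "(\<lambda>(w, v). f (w(b := v)) * ennreal (chart_factor J v ^ n)) \<in> borel_measurable (chart_space J \<Otimes>\<^sub>M lebprod J)"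
      by (simp add: case_prod_unfold)
  qed
  have gsm: "gs_chart n (insert b J) \<in> measurable (colmat_space n (insert b J)) (chart_space (insert b J))"
    using insert.hyps by (intro measurable_gs_chart) simp
  have prod_mass: "(\<Prod>j\<in>insert b J. chart_mass n {l\<in>insert b J. l < j}) =
      chart_mass n J * (\<Prod>j\<in>J. chart_mass n {l\<in>J. l < j})"
    using insert.hyps(1) b(1) sets_eq by simp
  have nondeg: "AE X in sphere_cols n J. gs_nondeg n J X"
    using insert.hyps card by (intro AE_sphere_cols_nondeg) auto
  have space: "gs_chart n J X \<in> space (chart_space J)" if "X \<in> space (sphere_cols n J)" for X
    using that measurable_space[OF measurable_gs_chart[OF insert.hyps(1), of n]] by (simp add: space_sphere_cols)
  have "(\<Prod>j\<in>insert b J. chart_mass n {l\<in>insert b J. l < j}) * (\<integral>\<^sup>+X. f (gs_chart n (insert b J) X) \<partial>sphere_cols n (insert b J))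
    = (\<Prod>j\<in>J. chart_mass n {l\<in>J. l < j}) * (chart_mass n J *
      (\<integral>\<^sup>+X. (\<integral>\<^sup>+x. f ((gs_chart n J X)(b := chart_coords n J (gs n J X) x)) \<partial>sphere_uniform n) \<partial>sphere_cols n J))"
  proof -
    have "f (gs_chart n (insert b J) (X(b := x))) = f ((gs_chart n J X)(b := chart_coords n J (gs n J X) x))" for X x
      using gs_chart_upd_max[OF insert.hyps(1) b(2)] by (rule arg_cong)
    then show ?thesis
      unfolding prod_mass
        nn_integral_sphere_cols_insert[OF insert.hyps(1) b(1) measurable_compose[OF gsm insert.prems(2)]]
      by (simp only: mult_ac)
  qed
  also have "chart_mass n J *
      (\<integral>\<^sup>+X. (\<integral>\<^sup>+x. f ((gs_chart n J X)(b := chart_coords n J (gs n J X) x)) \<partial>sphere_uniform n) \<partial>sphere_cols n J) =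
      (\<integral>\<^sup>+X. chart_mass n J * (\<integral>\<^sup>+x. f ((gs_chart n J X)(b := chart_coords n J (gs n J X) x)) \<partial>sphere_uniform n) \<partial>sphere_cols n J)"
  proof (rule nn_integral_cmult[symmetric])
    interpret S: sigma_finite_measure "sphere_uniform n"
      using prob_space_sphere_uniform[of n] by (simp add: prob_space_def finite_measure_def)
    have "(\<lambda>(X, x). X(b := x)) \<in> measurable (sphere_cols n J \<Otimes>\<^sub>M sphere_uniform n) (sphere_cols n (insert b J))"
      by (rule measurable_add_dim)
    from measurable_compose[OF this] measurable_compose[OF gsm insert.prems(2)]
    have "(\<lambda>p. f (gs_chart n (insert b J) ((fst p)(b := snd p)))) \<in> borel_measurable (sphere_cols n J \<Otimes>\<^sub>M sphere_uniform n)"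
      by (simp add: case_prod_unfold measurable_cong_sets[OF sets_sphere_cols refl])
    then show "(\<lambda>X. \<integral>\<^sup>+x. f ((gs_chart n J X)(b := chart_coords n J (gs n J X) x)) \<partial>sphere_uniform n)
        \<in> borel_measurable (sphere_cols n J)"
      using insert.hyps(1) b
      by (intro S.borel_measurable_nn_integral) (simp add: gs_chart_upd_max case_prod_unfold)
  qed
  also have "\<dots> = (\<integral>\<^sup>+X. F (gs_chart n J X) \<partial>sphere_cols n J)"
  proof (rule nn_integral_cong_AE)
    \<comment> \<open>For nondegenerate \<open>X\<close> the frame is orthonormal and disappears
      from the law of the new block, so \<open>X\<close> enters only through
      \<open>gs_chart n J X\<close>.\<close>
    show "AE X in sphere_cols n J. chart_mass n J *
      (\<integral>\<^sup>+x. f ((gs_chart n J X)(b := chart_coords n J (gs n J X) x)) \<partial>sphere_uniform n) = F (gs_chart n J X)"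
      using nondeg AE_space
    proof eventually_elim
      case (elim X)
      show ?case
        unfolding F_def using insert.hyps(1) card elim
        by (intro nn_integral_chart_coords orthonormal_gs fupd1 space)
    qed
  qed
  also have "(\<Prod>j\<in>J. chart_mass n {l\<in>J. l < j}) * \<dots> =
      (\<integral>\<^sup>+w. F w * (\<Prod>j\<in>J. ennreal (chart_factor {l\<in>J. l < j} (w j) ^ n)) \<partial>chart_leb J)"
    using card by (intro insert.IH F) simp
  also have "\<dots> = (\<integral>\<^sup>+w. (\<integral>\<^sup>+v. f (w(b := v)) * (\<Prod>j\<in>insert b J. ennreal (chart_factor {l\<in>insert b J. l < j} ((w(b := v)) j) ^ n))
      \<partial>lebprod J) \<partial>chart_leb J)"
  proof (rule nn_integral_cong)
    fix w assume "w \<in> space (chart_leb J)"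
    then have w: "w \<in> space (chart_space J)"
      using sets_eq_imp_space_eq[OF sets_chart_leb] by auto
    have prod: "(\<Prod>j\<in>insert b J. ennreal (chart_factor {l\<in>insert b J. l < j} ((w(b := v)) j) ^ n)) =
        ennreal (chart_factor J v ^ n) * (\<Prod>j\<in>J. ennreal (chart_factor {l\<in>J. l < j} (w j) ^ n))" for v
    proof -
      have "(\<Prod>j\<in>J. ennreal (chart_factor {l\<in>insert b J. l < j} ((w(b := v)) j) ^ n)) =
        (\<Prod>j\<in>J. ennreal (chart_factor {l\<in>J. l < j} (w j) ^ n))"
        using b(1) by (intro prod.cong refl) (auto simp: sets_eq(1) simp del: insert_iff)
      then show ?thesis
        using insert.hyps(1) b(1) by (simp add: sets_eq(2) del: insert_iff)
    qed
    show "F w * (\<Prod>j\<in>J. ennreal (chart_factor {l\<in>J. l < j} (w j) ^ n)) =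
      (\<integral>\<^sup>+v. f (w(b := v)) * (\<Prod>j\<in>insert b J. ennreal (chart_factor {l\<in>insert b J. l < j} ((w(b := v)) j) ^ n)) \<partial>lebprod J)"
      unfolding F_def prod mult.assoc[symmetric]
      using fupd1[OF w]
      by (intro nn_integral_multc[symmetric] borel_measurable_times_ennreal)
         (simp_all add: measurable_cong_sets[OF sets_lebprod refl])
  qed
  also have "\<dots> = (\<integral>\<^sup>+w. f w * (\<Prod>j\<in>insert b J. ennreal (chart_factor {l\<in>insert b J. l < j} (w j) ^ n)) \<partial>chart_leb (insert b J))"
  proof -
    have "(\<lambda>w. f w * (\<Prod>j\<in>insert b J. ennreal (chart_factor {l\<in>insert b J. l < j} (w j) ^ n))) \<in>
        borel_measurable (chart_leb (insert b J))"
    proof -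
      have "(\<lambda>w. chart_factor {l\<in>insert b J. l < j} (w j)) \<in> borel_measurable (chart_space (insert b J))" if "j \<in> insert b J" for j
        unfolding chart_space_def by (intro measurable_chart_factor measurable_component_singleton that)
      then have "(\<lambda>w. \<Prod>j\<in>insert b J. ennreal (chart_factor {l\<in>insert b J. l < j} (w j) ^ n)) \<in> borel_measurable (chart_space (insert b J))"
        by (intro borel_measurable_prod_ennreal measurable_compose[OF _ measurable_ennreal] borel_measurable_power) 
      then show ?thesis
        unfolding measurable_cong_sets[OF sets_chart_leb refl]
        by (intro borel_measurable_times_ennreal insert.prems(2))
    qed
    from I.product_nn_integral_insert[OF insert.hyps(1) b(1) this[unfolded chart_leb_def]]
    show ?thesis
      by (simp only: chart_J sets_eq(2) chart_leb_def[of "insert b J"])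
  qed
  finally show ?case .
qed

subsection \<open>Haar measure on the orthogonal group\<close>

lemma sets_orthonormal_cols [measurable]:
  assumes "finite J"
  shows "orthonormal_cols n J \<in> sets (colmat_space n J)"
proof -
  have [measurable]: "(\<lambda>Q. ip n (Q i) (Q j)) \<in> borel_measurable (colmat_space n J)" if "i \<in> J" "j \<in> J" for i j
    using that by (intro measurable_ip measurable_colmat_proj)
  have "Measurable.pred (colmat_space n J) (\<lambda>Q. \<forall>i\<in>J. \<forall>j\<in>J. ip n (Q i) (Q j) = (if i = j then 1 else 0))"
    using assms by (intro pred_intros_finite) auto
  then show ?thesis
    unfolding orthonormal_cols_def pred_def .
qed

lemma sets_orthonormal:
  assumes "finite J"
  shows "{Q \<in> space (colmat_space n J). orthonormal n J Q} \<in> sets (colmat_space n J)"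
proof -
  have "{Q \<in> space (colmat_space n J). orthonormal n J Q} = orthonormal_cols n J"
    by (auto simp: orthonormal_cols_def orthonormal_def space_colmat PiE_iff)
  then show ?thesis
    using sets_orthonormal_cols[OF assms, of n] by simp
qed

lemma mulm_orthonormal_iff:
  assumes "V \<in> orthogonal_group n" "Q \<in> space (colmat_space n J)"
  shows "mulm n J V Q \<in> orthonormal_cols n J \<longleftrightarrow> Q \<in> orthonormal_cols n J"
  using assms(2) by (auto simp: orthonormal_cols_def mulm_def ip_mulv[OF assms(1)] space_colmat)

lemma colmat_mult_eq_mulm: "colmat_mult n V = mulm n {..<n} V"
  by (auto simp: fun_eq_iff colmat_mult_def mulm_def mulv_def)

text \<open>The frame of \<open>n\<close> independent uniform columns has an invariant law: the
  columns are rotation invariant, and orthonormalization commutes with rotations. This law is then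
  restricted to the group, where it is concentrated.\<close>

lemma haar_exists: "\<exists>\<mu>. is_haar_orthogonal n \<mu>"
proof -
  let ?J = "{..<n}" and ?U = "sphere_cols n {..<n}" and ?C = "colmat_space n {..<n}" and ?O = "orthogonal_group n"
  let ?g = "\<lambda>X. \<lambda>j\<in>{..<n}. gs n {..<n} X j"
  interpret U: prob_space ?U
    by (rule prob_space_sphere_cols)
  have g: "?g \<in> measurable ?U ?C"
  proof -
    have "?g \<in> measurable ?C ?C"
      by (subst (2) colmat_space_def) (intro measurable_restrict measurable_gs measurable_ident_sets, auto)
    then show ?thesis
      by (simp only: measurable_cong_sets[OF sets_sphere_cols refl])
  qed
  define \<mu>0 where "\<mu>0 = distr ?U ?C ?g"
  interpret \<mu>0: prob_space \<mu>0
    unfolding \<mu>0_def by (rule U.prob_space_distr[OF g])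
  have sets0: "sets \<mu>0 = sets ?C" and space0: "space \<mu>0 = space ?C"
    by (simp_all add: \<mu>0_def)
  have O: "?O \<in> sets ?C"
    by (rule sets_orthonormal_cols) simp
  have AE_O: "AE Q in \<mu>0. Q \<in> ?O"
    unfolding \<mu>0_def
  proof (subst AE_distr_iff[OF g])
    show "{x \<in> space ?C. x \<in> ?O} \<in> sets ?C"
      using O by (simp add: Collect_conj_eq)
    have "AE X in ?U. gs_nondeg n ?J X"
      by (rule AE_sphere_cols_nondeg) auto
    then show "AE X in ?U. ?g X \<in> ?O"
    proof eventually_elim
      case (elim X)
      have "orthonormal n ?J (gs n ?J X)"
        using elim by (intro orthonormal_gs) auto
      then show ?case
        by (auto simp: orthonormal_cols_iff orthonormal_def)
    qed
  qed
  have inv: "emeasure \<mu>0 (mulm n ?J V -` B \<inter> space ?C) = emeasure \<mu>0 B" if V: "V \<in> ?O" and B: "B \<in> sets ?C" for V B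
  proof -
    have gV: "?g (mulm n ?J V X) = mulm n ?J V (?g X)" for X
    proof
      fix j
      show "?g (mulm n ?J V X) j = mulm n ?J V (?g X) j"
      proof (cases "j < n")
        case True
        have "gs n ?J (mulm n ?J V X) j = gs n ?J (\<lambda>j. mulv n V (X j)) j"
          using True by (intro gs_cong) (auto simp: mulm_def)
        then show ?thesis
          using True gs_mulv[OF V, of ?J X j] by (simp add: mulm_def)
      qed (simp add: mulm_def)
    qed
    have mV: "mulm n ?J V \<in> measurable ?U ?U"
      using measurable_mulm by (simp only: measurable_cong_sets[OF sets_sphere_cols sets_sphere_cols])
    have "emeasure \<mu>0 (mulm n ?J V -` B \<inter> space ?C) = emeasure ?U (?g -` (mulm n ?J V -` B \<inter> space ?C) \<inter> space ?U)"
      unfolding \<mu>0_def using B by (intro emeasure_distr g measurable_sets[OF measurable_mulm])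
    also have "?g -` (mulm n ?J V -` B \<inter> space ?C) \<inter> space ?U = mulm n ?J V -` (?g -` B \<inter> space ?U) \<inter> space ?U"
      using measurable_space[OF g] by (auto simp: gV space_sphere_cols)
    also have "emeasure ?U \<dots> = emeasure (distr ?U ?U (mulm n ?J V)) (?g -` B \<inter> space ?U)"
      using B by (intro emeasure_distr[symmetric] mV measurable_sets[OF g])
    also have "\<dots> = emeasure \<mu>0 B"
      using B by (simp add: distr_sphere_cols_mulm[OF V] \<mu>0_def emeasure_distr[OF g])
    finally show ?thesis .
  qed
  define \<mu> where "\<mu> = restrict_space \<mu>0 ?O"
  have sets: "sets \<mu> = sets (restrict_space ?C ?O)"
    unfolding \<mu>_def by (intro sets_restrict_space_cong sets0)
  have O_space: "?O \<subseteq> space ?C"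
    using sets.sets_into_space[OF O] .
  have space: "space \<mu> = ?O"
    using O_space by (auto simp: \<mu>_def space_restrict_space space0)
  have em: "emeasure \<mu> B = emeasure \<mu>0 B" if "B \<in> sets ?C" "B \<subseteq> ?O" for B
    unfolding \<mu>_def using that O by (intro emeasure_restrict_space) (auto simp: sets0 space0)
  have setsD: "B \<in> sets ?C \<and> B \<subseteq> ?O" if "B \<in> sets \<mu>" for B
    using that O O_space by (auto simp: sets sets_restrict_space)
  have "is_haar_orthogonal n \<mu>"
    unfolding is_haar_orthogonal_def
  proof (intro conjI ballI)
    show "prob_space \<mu>"
    proof
      have "emeasure \<mu> (space \<mu>) = emeasure \<mu>0 ?O"
        unfolding space using O by (rule em) simp
      also have "\<dots> = 1"
        using AE_O O by (intro \<mu>0.emeasure_eq_1_AE) (auto simp: sets0)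
      finally show "emeasure \<mu> (space \<mu>) = 1" .
    qed
    show "sets \<mu> = sets (restrict_space ?C ?O)"
      by (rule sets)
    fix V assume V: "V \<in> ?O"
    \<comment> \<open>Multiplication by \<open>V\<close> preserves orthogonality in both directions,
      so preimages in the group and in the whole space agree.\<close>
    have pre: "mulm n ?J V -` B \<inter> ?O = mulm n ?J V -` B \<inter> space ?C" if "B \<subseteq> ?O" for B
      using that mulm_orthonormal_iff[OF V, of _ ?J] O_space by auto
    have m\<mu>: "colmat_mult n V \<in> measurable \<mu> \<mu>"
    proof (rule measurableI)
      show "colmat_mult n V Q \<in> space \<mu>" if "Q \<in> space \<mu>" for Q
        using that mulm_orthonormal_iff[OF V, of Q ?J] O_space by (auto simp: space colmat_mult_eq_mulm)
      fix B assume "B \<in> sets \<mu>"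
      then have B: "B \<in> sets ?C" "B \<subseteq> ?O"
        using setsD by auto
      have "mulm n ?J V -` B \<inter> space ?C \<in> sets ?C"
        using B by (intro measurable_sets[OF measurable_mulm])
      then show "colmat_mult n V -` B \<inter> space \<mu> \<in> sets \<mu>"
        unfolding sets space colmat_mult_eq_mulm pre[OF B(2)] using pre[OF B(2)] O O_space
        by (subst sets_restrict_space_iff) auto
    qed
    show "distr \<mu> \<mu> (colmat_mult n V) = \<mu>"
    proof (rule measure_eqI)
      fix B assume "B \<in> sets (distr \<mu> \<mu> (colmat_mult n V))"
      then have B': "B \<in> sets \<mu>" by simp
      then have B: "B \<in> sets ?C" "B \<subseteq> ?O"
        using setsD by auto
      have "emeasure (distr \<mu> \<mu> (colmat_mult n V)) B = emeasure \<mu> (colmat_mult n V -` B \<inter> space \<mu>)"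
        by (rule emeasure_distr[OF m\<mu> B'])
      also have "colmat_mult n V -` B \<inter> space \<mu> = mulm n ?J V -` B \<inter> space ?C"
        unfolding space colmat_mult_eq_mulm by (rule pre[OF B(2)])
      also have "emeasure \<mu> \<dots> = emeasure \<mu>0 \<dots>"
        using B pre[OF B(2)] by (intro em measurable_sets[OF measurable_mulm]) auto
      also have "\<dots> = emeasure \<mu> B"
        using inv[OF V B(1)] em[OF B] by simp
      finally show "emeasure (distr \<mu> \<mu> (colmat_mult n V)) B = emeasure \<mu> B" .
    qed simp
  qed
  then show ?thesis ..
qed

lemma
  assumes "is_haar_orthogonal n \<mu>"
  shows sets_haar: "sets \<mu> = sets (restrict_space (colmat_space n {..<n}) (orthogonal_group n))"
    and space_haar: "space \<mu> = orthogonal_group n"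
    and distr_haar: "V \<in> orthogonal_group n \<Longrightarrow> distr \<mu> \<mu> (colmat_mult n V) = \<mu>"
proof -
  have O: "orthogonal_group n \<in> sets (colmat_space n {..<n})"
    by (rule sets_orthonormal_cols) simp
  show sets: "sets \<mu> = sets (restrict_space (colmat_space n {..<n}) (orthogonal_group n))"
    using assms by (simp add: is_haar_orthogonal_def)
  show "space \<mu> = orthogonal_group n"
    using sets_eq_imp_space_eq[OF sets] sets.sets_into_space[OF O] by (auto simp: space_restrict_space)
  show "V \<in> orthogonal_group n \<Longrightarrow> distr \<mu> \<mu> (colmat_mult n V) = \<mu>"
    using assms by (simp add: is_haar_orthogonal_def)
qed

lemma measurable_haar_colmat_mult:
  assumes haar: "is_haar_orthogonal n \<mu>" and V: "V \<in> orthogonal_group n"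
  shows "colmat_mult n V \<in> measurable \<mu> \<mu>"
proof (rule measurableI)
  show "colmat_mult n V U \<in> space \<mu>" if "U \<in> space \<mu>" for U
    using that mulm_orthonormal_iff[OF V, of U "{..<n}"]
    by (simp add: space_haar[OF haar] colmat_mult_eq_mulm orthogonal_group_colmat)
  fix A assume "A \<in> sets \<mu>"
  then obtain A' where A': "A = orthogonal_group n \<inter> A'" "A' \<in> sets (colmat_space n {..<n})"
    by (auto simp: sets_haar[OF haar] sets_restrict_space)
  have "colmat_mult n V -` A \<inter> space \<mu> =
    orthogonal_group n \<inter> (mulm n {..<n} V -` A' \<inter> space (colmat_space n {..<n}))"
    using mulm_orthonormal_iff[OF V, of _ "{..<n}"] orthogonal_group_colmat
    by (auto simp: space_haar[OF haar] colmat_mult_eq_mulm A'(1))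
  then show "colmat_mult n V -` A \<inter> space \<mu> \<in> sets \<mu>"
    unfolding sets_haar[OF haar] sets_restrict_space using measurable_sets[OF measurable_mulm A'(2)] by auto
qed

lemma card_lessThan_linorder:
  fixes j :: "'k::{finite,linorder}"
  assumes "CARD('k) \<le> n"
  shows "card {..<j} < n" and "inj (\<lambda>j::'k. card {..<j})"
proof -
  have "card {..<j} < CARD('k)"
    by (intro psubset_card_mono) auto
  then show "card {..<j} < n"
    using assms by simp
  have "card {..<i} < card {..<l}" if "i < l" for i l :: 'k
    using that by (intro psubset_card_mono) auto
  then show "inj (\<lambda>j::'k. card {..<j})"
    by (intro injI) (metis less_irrefl neqE)
qed

text \<open>
  Average over \<open>U\<^sup>T Q\<close> with \<open>U\<close> Haar distributed. If \<open>Q = W E\<close> with \<open>W\<close> orthogonal and \<open>E\<close> the first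
  columns of the identity, then left invariance removes \<open>W\<close> from \<open>U\<^sup>T Q = (W\<^sup>T U)\<^sup>T E\<close>.
\<close>

lemma invariant_measure_unique:
  fixes \<nu> :: "('k::{finite,linorder} \<Rightarrow> nat \<Rightarrow> real) measure"
  assumes haar: "is_haar_orthogonal n \<mu>" and k: "CARD('k) \<le> n"
    and fin: "finite_measure \<nu>" and sets\<nu>: "sets \<nu> = sets (colmat_space n UNIV)"
    and ortho: "AE Q in \<nu>. orthonormal n UNIV Q"
    and inv: "\<And>V B. V \<in> orthogonal_group n \<Longrightarrow> B \<in> sets (colmat_space n UNIV) \<Longrightarrow>
      emeasure \<nu> (mulm n UNIV V -` B \<inter> space (colmat_space n UNIV)) = emeasure \<nu> B"
    and B: "B \<in> sets (colmat_space n UNIV)"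
  shows "emeasure \<nu> B = emeasure \<nu> (space \<nu>) * emeasure \<mu> {U \<in> space \<mu>. first_cols (transp n U) \<in> B}"
proof -
  interpret \<mu>: prob_space \<mu>
    using haar by (simp add: is_haar_orthogonal_def)
  interpret \<nu>: finite_measure \<nu>
    by (rule fin)
  interpret P: pair_sigma_finite \<mu> \<nu>
    by unfold_locales
  let ?C = "colmat_space n (UNIV :: 'k set)"
  let ?idx = "\<lambda>j::'k. card {..<j}"
  note idx = card_lessThan_linorder(1)[OF k]
  note sets\<mu> = sets_haar[OF haar] and space\<mu> = space_haar[OF haar]
  have space\<nu>: "space \<nu> = space ?C"
    using sets_eq_imp_space_eq[OF sets\<nu>] .
  have proj: "(\<lambda>U. U j i) \<in> borel_measurable \<mu>" if "j < n" "i < n" for i j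
  proof -
    have "(\<lambda>U. U j) \<in> measurable (colmat_space n {..<n}) (vec_space n)"
      using that by (intro measurable_colmat_proj) auto
    then have "(\<lambda>U. U j i) \<in> borel_measurable (colmat_space n {..<n})"
      using that by (intro measurable_comp_PiM) auto
    then have "(\<lambda>U. U j i) \<in> borel_measurable (restrict_space (colmat_space n {..<n}) (orthogonal_group n))"
      by (rule measurable_restrict_space1)
    then show ?thesis
      by (simp only: measurable_cong_sets[OF sets\<mu> refl])
  qed
  have proj\<nu>: "(\<lambda>Q. Q j i) \<in> borel_measurable \<nu>" if "i < n" for i and j :: 'k
  proof -
    have "(\<lambda>Q. Q j i) \<in> borel_measurable ?C"
      using that by (intro measurable_comp_PiM[OF measurable_colmat_proj]) auto
    then show ?thesis
      by (simp only: measurable_cong_sets[OF sets\<nu> refl])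
  qed
  define rot :: "(nat \<Rightarrow> nat \<Rightarrow> real) \<times> ('k \<Rightarrow> nat \<Rightarrow> real) \<Rightarrow> 'k \<Rightarrow> nat \<Rightarrow> real" where
    "rot = (\<lambda>(U, Q). mulm n UNIV (transp n U) Q)"
  have rot_eq: "rot p = (\<lambda>j\<in>UNIV. \<lambda>i\<in>{..<n}. \<Sum>l<n. fst p i l * snd p j l)" for p
    by (auto simp: rot_def mulm_def mulv_def transp_def fun_eq_iff case_prod_unfold)
  have rot: "rot \<in> measurable (\<mu> \<Otimes>\<^sub>M \<nu>) ?C"
    unfolding rot_eq[abs_def] colmat_space_def
    by (intro measurable_restrict borel_measurable_sum borel_measurable_times
        measurable_compose[OF measurable_fst proj] measurable_compose[OF measurable_snd proj\<nu>]) auto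
  have ind: "(\<lambda>p. indicator B (rot p) :: ennreal) \<in> borel_measurable (\<mu> \<Otimes>\<^sub>M \<nu>)"
    using B by (intro measurable_compose[OF rot]) auto
  have fc: "(\<lambda>U. first_cols (transp n U) :: 'k \<Rightarrow> nat \<Rightarrow> real) \<in> measurable \<mu> ?C"
  proof -
    have "(\<lambda>U. first_cols (transp n U) :: 'k \<Rightarrow> nat \<Rightarrow> real) = (\<lambda>U. \<lambda>j\<in>UNIV. \<lambda>i\<in>{..<n}. U i (?idx j))"
      using idx by (auto simp: first_cols_def transp_def fun_eq_iff)
    then show ?thesis
      unfolding colmat_space_def by (simp only:) (intro measurable_restrict proj idx, auto)
  qed
  let ?S = "{U \<in> space \<mu>. first_cols (transp n U) \<in> B}"
  have S: "?S \<in> sets \<mu>"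
    using measurable_sets[OF fc B] by (simp add: vimage_def Int_def conj_commute)
  have "emeasure \<nu> B = (\<integral>\<^sup>+U. emeasure \<nu> B \<partial>\<mu>)"
    by (simp add: \<mu>.emeasure_space_1)
  \<comment> \<open>Each \<open>U\<close> is handled separately: its transpose is a rotation that
    leaves the measure in \<open>Q\<close> unchanged.\<close>
  also have "\<dots> = (\<integral>\<^sup>+U. (\<integral>\<^sup>+Q. indicator B (rot (U, Q)) \<partial>\<nu>) \<partial>\<mu>)"
  proof (rule nn_integral_cong)
    fix U assume "U \<in> space \<mu>"
    then have V: "transp n U \<in> orthogonal_group n"
      by (simp add: space\<mu> transp_in_orthogonal_group)
    let ?A = "mulm n UNIV (transp n U) -` B \<inter> space ?C"
    have A: "?A \<in> sets \<nu>"
      unfolding sets\<nu> by (rule measurable_sets[OF measurable_mulm B])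
    have "(\<integral>\<^sup>+Q. indicator B (rot (U, Q)) \<partial>\<nu>) = (\<integral>\<^sup>+Q. indicator ?A Q \<partial>\<nu>)"
      by (intro nn_integral_cong) (auto simp: rot_def indicator_def space\<nu>)
    also have "\<dots> = emeasure \<nu> B"
      using A inv[OF V B] by simp
    finally show "emeasure \<nu> B = (\<integral>\<^sup>+Q. indicator B (rot (U, Q)) \<partial>\<nu>)" ..
  qed
  also have "\<dots> = (\<integral>\<^sup>+Q. (\<integral>\<^sup>+U. indicator B (rot (U, Q)) \<partial>\<mu>) \<partial>\<nu>)"
  proof -
    have "(\<lambda>p. indicator B (rot p) :: ennreal) = case_prod (\<lambda>U Q. indicator B (rot (U, Q)))"
      by (rule ext) (simp only: case_prod_unfold prod.collapse)
    with ind have "case_prod (\<lambda>U Q. indicator B (rot (U, Q)) :: ennreal) \<in> borel_measurable (\<mu> \<Otimes>\<^sub>M \<nu>)"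
      by (simp only:)
    then show ?thesis
      by (rule P.Fubini'[symmetric])
  qed
  also have "\<dots> = (\<integral>\<^sup>+Q. emeasure \<mu> ?S \<partial>\<nu>)"
  proof (rule nn_integral_cong_AE)
    show "AE Q in \<nu>. (\<integral>\<^sup>+U. indicator B (rot (U, Q)) \<partial>\<mu>) = emeasure \<mu> ?S"
      using ortho
    proof eventually_elim
      case (elim Q)
      have "range ?idx \<subseteq> {..<n}"
        using idx by auto
      then obtain W where W0: "W \<in> orthogonal_group n" "\<And>j. j \<in> UNIV \<Longrightarrow> W (?idx j) = Q j"
        using orthonormal_extend[OF elim finite card_lessThan_linorder(2)[OF k]] by metis
      then have W: "W \<in> orthogonal_group n" "\<And>j. W (?idx j) = Q j"
        by simp_all
      note V = transp_in_orthogonal_group[OF W(1)]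
      have rotW: "rot (U, Q) = first_cols (transp n (colmat_mult n (transp n W) U))" for U
        using idx by (auto simp: rot_eq fun_eq_iff first_cols_def colmat_mult_def transp_def W(2) mult.commute)
      note cm = measurable_haar_colmat_mult[OF haar V]
      have "(\<integral>\<^sup>+U. indicator B (rot (U, Q)) \<partial>\<mu>) = (\<integral>\<^sup>+U. indicator ?S (colmat_mult n (transp n W) U) \<partial>\<mu>)"
        using measurable_space[OF cm] by (intro nn_integral_cong) (auto simp: rotW indicator_def)
      also have "\<dots> = (\<integral>\<^sup>+U. indicator ?S U \<partial>distr \<mu> \<mu> (colmat_mult n (transp n W)))"
        using S by (intro nn_integral_distr[symmetric] cm) simp
      also have "distr \<mu> \<mu> (colmat_mult n (transp n W)) = \<mu>"
        by (rule distr_haar[OF haar V])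
      finally show ?case
        using S by simp
    qed
  qed
  also have "\<dots> = emeasure \<nu> (space \<nu>) * emeasure \<mu> ?S"
    by (simp add: mult.commute)
  finally show ?thesis .
qed

lemma emeasure_haar_first_cols:
  fixes B :: "('k::{finite,linorder} \<Rightarrow> nat \<Rightarrow> real) set"
  assumes haar: "is_haar_orthogonal n \<mu>" and k: "CARD('k) \<le> n" and B: "B \<in> sets (colmat_space n UNIV)"
  shows "emeasure (distr \<mu> (colmat_space n UNIV) first_cols) B = emeasure \<mu> {U \<in> space \<mu>. first_cols (transp n U) \<in> B}"
proof -
  let ?C = "colmat_space n (UNIV :: 'k set)"
  let ?idx = "\<lambda>j::'k. card {..<j}"
  interpret \<mu>: prob_space \<mu>
    using haar by (simp add: is_haar_orthogonal_def)
  note idx = card_lessThan_linorder(1)[OF k]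
  note sets\<mu> = sets_haar[OF haar] and space\<mu> = space_haar[OF haar]
  have fc: "first_cols \<in> measurable \<mu> ?C"
  proof -
    have "(\<lambda>U. \<lambda>j\<in>UNIV. U (?idx j)) \<in> measurable (colmat_space n {..<n}) ?C"
      by (subst (2) colmat_space_def) (intro measurable_restrict measurable_colmat_proj, simp add: idx)
    moreover have "first_cols = (\<lambda>U. \<lambda>j\<in>UNIV. U (?idx j))"
      by (auto simp: first_cols_def fun_eq_iff)
    ultimately have "first_cols \<in> measurable (colmat_space n {..<n}) ?C"
      by (simp only:)
    then have "first_cols \<in> measurable (restrict_space (colmat_space n {..<n}) (orthogonal_group n)) ?C"
      by (rule measurable_restrict_space1)
    then show ?thesis
      by (simp only: measurable_cong_sets[OF sets\<mu> refl])
  qed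
  define \<nu> where "\<nu> = distr \<mu> ?C first_cols"
  interpret \<nu>: prob_space \<nu>
    unfolding \<nu>_def by (rule \<mu>.prob_space_distr[OF fc])
  have "emeasure \<nu> B = emeasure \<nu> (space \<nu>) * emeasure \<mu> {U \<in> space \<mu>. first_cols (transp n U) \<in> B}"
  proof (rule invariant_measure_unique[OF haar k _ _ _ _ B])
    show "finite_measure \<nu>" by unfold_locales
    show "sets \<nu> = sets ?C" by (simp add: \<nu>_def)
    have ortho: "orthonormal n UNIV (first_cols U :: 'k \<Rightarrow> nat \<Rightarrow> real)" if "U \<in> orthogonal_group n" for U
      using that idx
      by (auto simp: orthonormal_cols_iff orthonormal_def first_cols_def dest: injD[OF card_lessThan_linorder(2)[OF k]])
    have "AE U in \<mu>. orthonormal n UNIV (first_cols U :: 'k \<Rightarrow> nat \<Rightarrow> real)"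
      using ortho by (intro AE_I2) (simp add: space\<mu>)
    moreover have "{Q \<in> space ?C. orthonormal n UNIV Q} \<in> sets ?C"
      by (rule sets_orthonormal[OF finite])
    ultimately show "AE Q in \<nu>. orthonormal n UNIV Q"
      unfolding \<nu>_def by (subst AE_distr_iff[OF fc]) auto
    fix V A assume V: "V \<in> orthogonal_group n" and A: "A \<in> sets ?C"
    note cm = distr_haar[OF haar V]
    have pre: "first_cols -` (mulm n UNIV V -` A \<inter> space ?C) \<inter> space \<mu> =
      colmat_mult n V -` (first_cols -` A \<inter> space \<mu>) \<inter> space \<mu>"
    proof -
      have "mulm n UNIV V (first_cols U) = (first_cols (colmat_mult n V U) :: 'k \<Rightarrow> nat \<Rightarrow> real)" for U
        using idx by (auto simp: first_cols_def mulm_def mulv_colmat_mult)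
      moreover have "colmat_mult n V U \<in> space \<mu>" if "U \<in> space \<mu>" for U
        using that mulm_orthonormal_iff[OF V, of U "{..<n}"]
        by (simp add: space\<mu> colmat_mult_eq_mulm orthogonal_group_colmat)
      ultimately show ?thesis
        using measurable_space[OF fc] by auto
    qed
    have A': "first_cols -` A \<inter> space \<mu> \<in> sets \<mu>"
      by (rule measurable_sets[OF fc A])
    note cmm = measurable_haar_colmat_mult[OF haar V]
    have "emeasure \<nu> (mulm n UNIV V -` A \<inter> space ?C) = emeasure \<mu> (colmat_mult n V -` (first_cols -` A \<inter> space \<mu>) \<inter> space \<mu>)"
      unfolding \<nu>_def by (subst emeasure_distr[OF fc measurable_sets[OF measurable_mulm A]]) (simp only: pre)
    also have "\<dots> = emeasure (distr \<mu> \<mu> (colmat_mult n V)) (first_cols -` A \<inter> space \<mu>)"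
      by (rule emeasure_distr[OF cmm A', symmetric])
    also have "\<dots> = emeasure \<nu> A"
      unfolding cm \<nu>_def by (rule emeasure_distr[OF fc A, symmetric])
    finally show "emeasure \<nu> (mulm n UNIV V -` A \<inter> space ?C) = emeasure \<nu> A" .
  qed
  then show "emeasure (distr \<mu> ?C first_cols) B = emeasure \<mu> {U \<in> space \<mu>. first_cols (transp n U) \<in> B}"
    by (simp add: \<nu>_def[symmetric] \<nu>.emeasure_space_1)
qed

subsection \<open>Upper triangular matrices\<close>

text \<open>Descending induction: if all larger indices are fixed, injectivity forbids moving
  \<open>i\<close> up to one of them.\<close>

lemma permutes_increasing_imp_id:
  fixes p :: "'k::{finite,linorder} \<Rightarrow> 'k"
  assumes "p permutes UNIV" "\<And>i. i \<le> p i"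
  shows "p = id"
proof
  fix i :: 'k
  show "p i = id i"
  proof (induction "card {i<..}" arbitrary: i rule: less_induct)
    case less
    have "p j = j" if "i < j" for j
    proof -
      have "card {j<..} < card {i<..}"
        using that by (intro psubset_card_mono) auto
      then show ?thesis
        using less by simp
    qed
    moreover have "inj p"
      using assms(1) by (rule permutes_inj)
    ultimately have "\<not> i < p i"
      by (metis injD less_irrefl)
    then show ?case
      using assms(2)[of i] by simp
  qed
qed

text \<open>A permutation other than the identity moves some index down and thus picks an entry
  below the diagonal.\<close>

lemma det_upper_triangular:
  fixes R :: "'k::{finite,linorder} sqmat"
  assumes "upper_triangular R"
  shows "det R = (\<Prod>i\<in>UNIV. R $ i $ i)"
proof -
  have "det R = (\<Sum>p\<in>{p. p permutes (UNIV::'k set)}. of_int (sign p) * (\<Prod>i\<in>UNIV. R $ i $ p i))"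
    by (simp add: det_def)
  also have "\<dots> = (\<Sum>p\<in>{id}. of_int (sign p) * (\<Prod>i\<in>UNIV. R $ i $ p i))"
  proof (rule sum.mono_neutral_right)
    show "\<forall>p\<in>{p. p permutes (UNIV::'k set)} - {id}. of_int (sign p) * (\<Prod>i\<in>UNIV. R $ i $ p i) = 0"
    proof
      fix p assume p: "p \<in> {p. p permutes (UNIV::'k set)} - {id}"
      then obtain i where "\<not> i \<le> p i"
        using permutes_increasing_imp_id[of p] by auto
      then have "R $ i $ p i = 0"
        using assms by (simp add: upper_triangular_def)
      then have "(\<Prod>i\<in>UNIV. R $ i $ p i) = 0"
        by (intro prod_zero) auto
      then show "of_int (sign p) * (\<Prod>i\<in>UNIV. R $ i $ p i) = 0" by simp
    qed
  qed (auto simp: permutes_id finite_permutations)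
  finally show ?thesis by simp
qed

lemma upper_triangular_mult:
  assumes "upper_triangular R" "upper_triangular S"
  shows "upper_triangular (R ** S)" and "(R ** S) $ i $ i = R $ i $ i * S $ i $ i"
proof -
  have zero: "R $ i $ l * S $ l $ j = 0" if "l < i \<or> j < l" for i j l
    using that assms by (auto simp: upper_triangular_def)
  have "(R ** S) $ i $ j = 0" if "j < i" for i j
    using that unfolding matrix_matrix_mult_def by (auto intro!: sum.neutral zero)
  then show "upper_triangular (R ** S)"
    by (simp add: upper_triangular_def)
  have "(R ** S) $ i $ i = (\<Sum>l\<in>UNIV. R $ i $ l * S $ l $ i)"
    by (simp add: matrix_matrix_mult_def)
  also have "\<dots> = (\<Sum>l\<in>{i}. R $ i $ l * S $ l $ i)"
    proof (rule sum.mono_neutral_right)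
    show "\<forall>l\<in>UNIV - {i}. R $ i $ l * S $ l $ i = 0"
    proof
      fix l assume "l \<in> UNIV - {i}"
      then have "l < i \<or> i < l"
        by (auto elim: neqE)
      then show "R $ i $ l * S $ l $ i = 0"
        by (rule zero)
    qed
  qed auto
  finally show "(R ** S) $ i $ i = R $ i $ i * S $ i $ i" by simp
qed

text \<open>Back substitution: row \<open>i\<close> of \<open>R ** C\<close> involves only the rows
  of \<open>C\<close> from \<open>i\<close> on, and below row \<open>i\<close> the entries are
  already known to vanish.\<close>

lemma upper_triangular_right_inverse:
  fixes R C :: "'k::{finite,linorder} sqmat"
  assumes R: "upper_triangular R" "\<And>i. R $ i $ i \<noteq> 0" and C: "R ** C = mat 1"
  shows "upper_triangular C"
proof -
  have "C $ i $ j = 0" if "j < i" for i j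
    using that
  proof (induction "card {i<..}" arbitrary: i rule: less_induct)
    case less
    have IH: "C $ l $ j = 0" if "i < l" for l
    proof -
      have "card {l<..} < card {i<..}"
        using that by (intro psubset_card_mono) auto
      moreover have "j < l"
        using that less.prems by simp
      ultimately show ?thesis by (rule less.hyps)
    qed
    have "0 = (R ** C) $ i $ j"
      using less.prems by (simp add: C mat_def)
    also have "\<dots> = (\<Sum>l\<in>UNIV. R $ i $ l * C $ l $ j)"
      by (simp add: matrix_matrix_mult_def)
    also have "\<dots> = (\<Sum>l\<in>{i}. R $ i $ l * C $ l $ j)"
    proof (rule sum.mono_neutral_right)
      show "\<forall>l\<in>UNIV - {i}. R $ i $ l * C $ l $ j = 0"
        using IH R(1) by (auto simp: upper_triangular_def elim: neqE)
    qed auto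
    finally show ?case
      using R(2) by simp
  qed
  then show ?thesis
    by (simp add: upper_triangular_def)
qed

lemma upper_triangular_inverse:
  fixes R :: "'k::{finite,linorder} sqmat"
  assumes "upper_triangular R" "\<And>i. 0 < R $ i $ i"
  obtains C where "R ** C = mat 1" "C ** R = mat 1" "upper_triangular C" "\<And>i. 0 < C $ i $ i"
proof -
  have nz: "R $ i $ i \<noteq> 0" for i
    using assms(2)[of i] by simp
  then have "det R \<noteq> 0"
    by (simp add: det_upper_triangular[OF assms(1)])
  then have "invertible R"
    by (simp add: invertible_det_nz)
  then obtain C where C: "R ** C = mat 1" "C ** R = mat 1"
    unfolding invertible_def by blast
  have ut: "upper_triangular C"
    using assms(1) nz C(1) by (rule upper_triangular_right_inverse)
  have "0 < C $ i $ i" for i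
  proof -
    have "R $ i $ i * C $ i $ i = (R ** C) $ i $ i"
      by (rule upper_triangular_mult(2)[OF assms(1) ut, symmetric])
    also have "\<dots> = 1"
      unfolding C(1) by (simp add: mat_def)
    finally show ?thesis
      using assms(2)[of i] by (metis zero_less_mult_pos zero_less_one)
  qed
  then show thesis
    using that C ut by blast
qed

section \<open>The Frobenius norm and a weight peaked at the identity matrix\<close>

lemma sqmat_norm_eq: "(norm (M :: 'k::finite sqmat))\<^sup>2 = (\<Sum>i\<in>UNIV. \<Sum>j\<in>UNIV. (M $ i $ j)\<^sup>2)"
  by (simp add: norm_vec_def L2_set_def sum_nonneg)

lemma sqmat_norm_eq_trace: "(norm (M :: 'k::finite sqmat))\<^sup>2 = trace (transpose M ** M)"
  unfolding sqmat_norm_eq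
  by (subst sum.swap) (simp add: trace_def matrix_matrix_mult_def transpose_def power2_eq_square)

lemma sqmat_norm_minus_id:
  "(norm (M - mat 1 :: 'k::finite sqmat))\<^sup>2 = (norm M)\<^sup>2 - 2 * (\<Sum>i\<in>UNIV. M $ i $ i) + real CARD('k)"
proof -
  have "(M - mat 1) $ i $ j ^ 2 = (M $ i $ j)\<^sup>2 + (if j = i then 1 - 2 * M $ i $ i else 0)" for i j
    by (simp add: mat_def power2_eq_square algebra_simps)
  then have "(norm (M - mat 1))\<^sup>2 = (\<Sum>i\<in>UNIV. \<Sum>j\<in>UNIV. (M $ i $ j)\<^sup>2 + (if j = i then 1 - 2 * M $ i $ i else 0))"
    by (simp only: sqmat_norm_eq)
  also have "\<dots> = (norm M)\<^sup>2 + (\<Sum>i\<in>UNIV. 1 - 2 * M $ i $ i)"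
    by (simp add: sum.distrib sqmat_norm_eq)
  finally show ?thesis
    by (simp add: sum_subtractf sum_distrib_left)
qed

text \<open>
  Bounds for this weight reduce to bounds for \<open>\<Prod>\<^sub>i M\<^sub>i\<^sub>i\<close>, since \<open>\<parallel>M\<parallel>\<^sup>2 - k = \<parallel>M - 1\<parallel>\<^sup>2 + 2 \<Sum>\<^sub>i (M\<^sub>i\<^sub>i - 1)\<close>.
\<close>

definition tri_weight :: "'k::finite sqmat \<Rightarrow> real" where
  "tri_weight M = exp ((real CARD('k) - (norm M)\<^sup>2) / 2) * (\<Prod>i\<in>UNIV. M $ i $ i)"

text \<open>Apply \<open>1 + t \<le> exp t\<close> with \<open>t = M $ i $ i - 1\<close> to each
  diagonal entry; the linear terms cancel those in the expansion of the norm.\<close>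

lemma tri_weight_upper:
  fixes M :: "'k::finite sqmat"
  assumes "\<And>i. 0 \<le> M $ i $ i"
  shows "tri_weight M \<le> exp (- (norm (M - mat 1))\<^sup>2 / 2)"
proof -
  have "(\<Prod>i\<in>UNIV. M $ i $ i) \<le> (\<Prod>i\<in>UNIV. exp (M $ i $ i - 1))"
  proof (intro prod_mono conjI assms)
    show "M $ i $ i \<le> exp (M $ i $ i - 1)" for i
      using exp_ge_add_one_self[of "M $ i $ i - 1"] by simp
  qed
  also have "\<dots> = exp ((\<Sum>i\<in>UNIV. M $ i $ i) - real CARD('k))"
    by (simp add: exp_sum[symmetric] sum_subtractf)
  finally have "tri_weight M \<le> exp ((real CARD('k) - (norm M)\<^sup>2) / 2) * exp ((\<Sum>i\<in>UNIV. M $ i $ i) - real CARD('k))"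
    unfolding tri_weight_def by (intro mult_left_mono) auto
  also have "\<dots> = exp (- (norm (M - mat 1))\<^sup>2 / 2)"
    unfolding exp_add[symmetric] sqmat_norm_minus_id by (simp add: field_simps)
  finally show ?thesis .
qed

text \<open>The constant 2 is dictated by negative \<open>t\<close>, where \<open>ln (1 - s)\<close>
  is at least \<open>- s - 2 s\<^sup>2\<close> for \<open>s\<close> between 0 and 1/2.\<close>

lemma exp_quadratic_lower:
  fixes t :: real
  assumes "\<bar>t\<bar> \<le> 1 / 2"
  shows "exp (t - 2 * t\<^sup>2) \<le> 1 + t"
proof -
  have "t - 2 * t\<^sup>2 \<le> ln (1 + t)"
  proof (cases "0 \<le> t")
    case True
    then have "t - t\<^sup>2 \<le> ln (1 + t)"
      using assms by (intro ln_one_plus_pos_lower_bound) auto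
    moreover have "t - 2 * t\<^sup>2 \<le> t - t\<^sup>2"
      by simp
    ultimately show ?thesis by linarith
  next
    case False
    then show ?thesis
      using assms ln_one_minus_pos_lower_bound[of "- t"] by simp
  qed
  then have "exp (t - 2 * t\<^sup>2) \<le> exp (ln (1 + t))"
    by simp
  also have "\<dots> = 1 + t"
    using assms by (intro exp_ln) (auto simp: abs_le_iff)
  finally show ?thesis .
qed

lemma sqmat_component_le_norm: "\<bar>(M :: 'k::finite sqmat) $ i $ j\<bar> \<le> norm M"
  using component_le_norm_cart[of "M $ i" j] Finite_Cartesian_Product.norm_nth_le[of M i] by simp

text \<open>The norm contributes 1/2 to the exponent, and the diagonal product at most 2, since the
  squared diagonal deviations are part of the squared norm. The sum 5/2 is rounded up to 3.\<close>

lemma tri_weight_lower: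
  fixes M :: "'k::finite sqmat"
  assumes "norm (M - mat 1) \<le> 1 / 2"
  shows "exp (- 3 * (norm (M - mat 1))\<^sup>2) \<le> tri_weight M"
proof -
  define t where "t i = M $ i $ i - 1" for i
  have t: "\<bar>t i\<bar> \<le> 1 / 2" for i
    using sqmat_component_le_norm[of "M - mat 1" i i] assms by (simp add: t_def mat_def)
  have t2: "(\<Sum>i\<in>UNIV. (t i)\<^sup>2) \<le> (norm (M - mat 1))\<^sup>2"
  proof -
    have "(\<Sum>i\<in>UNIV. (t i)\<^sup>2) \<le> (\<Sum>i\<in>UNIV. \<Sum>j\<in>UNIV. ((M - mat 1) $ i $ j)\<^sup>2)"
    proof (rule sum_mono)
      fix i
      have "(t i)\<^sup>2 = ((M - mat 1) $ i $ i)\<^sup>2"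
        by (simp add: t_def mat_def)
      also have "\<dots> \<le> (\<Sum>j\<in>UNIV. ((M - mat 1) $ i $ j)\<^sup>2)"
        by (rule member_le_sum) auto
      finally show "(t i)\<^sup>2 \<le> (\<Sum>j\<in>UNIV. ((M - mat 1) $ i $ j)\<^sup>2)" .
    qed
    then show ?thesis
      by (simp only: sqmat_norm_eq)
  qed
  have "exp (- 3 * (norm (M - mat 1))\<^sup>2) \<le> exp ((real CARD('k) - (norm M)\<^sup>2) / 2 + ((\<Sum>i\<in>UNIV. t i) - 2 * (\<Sum>i\<in>UNIV. (t i)\<^sup>2)))"
  proof -
    have "(real CARD('k) - (norm M)\<^sup>2) / 2 + (\<Sum>i\<in>UNIV. t i) = - (norm (M - mat 1))\<^sup>2 / 2"
      by (simp add: sqmat_norm_minus_id t_def sum_subtractf field_simps)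
    moreover have "0 \<le> (norm (M - mat 1))\<^sup>2"
      by (rule zero_le_power2)
    ultimately show ?thesis
      unfolding exp_le_cancel_iff using t2 by linarith
  qed
  also have "\<dots> = exp ((real CARD('k) - (norm M)\<^sup>2) / 2) * (\<Prod>i\<in>UNIV. exp (t i - 2 * (t i)\<^sup>2))"
    by (simp add: exp_add exp_sum[symmetric] sum_subtractf sum_distrib_left)
  also have "\<dots> \<le> exp ((real CARD('k) - (norm M)\<^sup>2) / 2) * (\<Prod>i\<in>UNIV. 1 + t i)"
    using exp_quadratic_lower[OF t] by (intro mult_left_mono prod_mono) auto
  also have "\<dots> = tri_weight M"
    by (simp add: tri_weight_def t_def)
  finally show ?thesis .
qed

subsection \<open>Cholesky factorization\<close>

lemma quadratic_form: "v \<bullet> (S *v v) = (\<Sum>i\<in>UNIV. \<Sum>j\<in>UNIV. v $ i * S $ i $ j * v $ j)"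
  for S :: "'k::finite sqmat"
  by (simp add: inner_vec_def matrix_vector_mult_def sum_distrib_left mult.assoc)

text \<open>If the form vanished at \<open>v\<close>, its value at \<open>v + t S v\<close> would
  have no constant term; being nonnegative for both signs of \<open>t\<close>, it would have linear
  coefficient \<open>2 |S v|\<^sup>2 = 0\<close>, against invertibility.\<close>

lemma pos_semidef_nonzero_form:
  fixes S :: "'k::finite sqmat"
  assumes S: "pos_semidef S" and det: "det S \<noteq> 0" and v: "v \<noteq> 0"
  shows "0 < v \<bullet> (S *v v)"
proof (rule ccontr)
  assume "\<not> 0 < v \<bullet> (S *v v)"
  moreover have nonneg: "0 \<le> u \<bullet> (S *v u)" for u
    using S by (simp add: pos_semidef_def)
  ultimately have v0: "v \<bullet> (S *v v) = 0"
    using nonneg[of v] by linarith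
  have sym: "v \<bullet> (S *v w) = w \<bullet> (S *v v)" for w
  proof -
    have "transpose S = S"
      using S by (simp add: pos_semidef_def)
    then show ?thesis
      using dot_lmul_matrix[of v S w] transpose_matrix_vector[of S v] by (simp add: inner_commute)
  qed
  let ?w = "S *v v"
  have eq: "(v + t *\<^sub>R ?w) \<bullet> (S *v (v + t *\<^sub>R ?w)) = 2 * t * (?w \<bullet> ?w) + t\<^sup>2 * (?w \<bullet> (S *v ?w))" for t
    using v0 sym[of ?w]
    by (simp add: matrix_vector_right_distrib matrix_vector_mult_scaleR inner_add_left inner_add_right
        power2_eq_square algebra_simps)
  define a where "a = ?w \<bullet> (S *v ?w)"
  define b where "b = ?w \<bullet> ?w"
  have a: "0 \<le> a" using nonneg by (simp add: a_def)
  have b: "0 \<le> b" by (simp add: b_def)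
  have ge: "0 \<le> 2 * t * b + t\<^sup>2 * a" for t
    using nonneg[of "v + t *\<^sub>R ?w"] eq by (simp add: a_def b_def)
  have "b = 0"
  proof (rule ccontr)
    assume "b \<noteq> 0"
    then have bpos: "0 < b" using b by simp
    \<comment> \<open>The linear term dominates at this point; the added 1 covers
      \<open>a = 0\<close>.\<close>
    define t where "t = - b / (a + 1)"
    have "0 \<le> 2 * t * b + t\<^sup>2 * a"
      by (rule ge)
    also have "\<dots> \<le> 2 * t * b + t\<^sup>2 * (a + 1)"
      by (simp add: mult_left_mono)
    also have "\<dots> = 2 * t * b + t * (t * (a + 1))"
      by (simp add: power2_eq_square)
    also have "t * (a + 1) = - b"
      using a by (simp add: t_def)
    also have "2 * t * b + t * - b = t * b"
      by simp
    also have "\<dots> < 0"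
      using a bpos by (simp add: t_def mult_neg_pos divide_neg_pos)
    finally show False by simp
  qed
  then have "S *v v = 0"
    by (simp add: b_def)
  moreover have "invertible S"
    using det by (simp add: invertible_det_nz)
  then obtain T where "T ** S = mat 1"
    by (auto simp: invertible_def)
  ultimately have "v = 0"
    by (metis matrix_left_invertible_ker)
  then show False using v by simp
qed

text \<open>Elimination of the smallest index: \<open>s'\<close> is the Schur complement of the
  entry \<open>s b b\<close>, it is again positive definite, and its factor is completed by row
  \<open>b\<close>. Restricting the index set leaves the type unchanged.\<close>

lemma cholesky_on_set:
  fixes s :: "'k::linorder \<Rightarrow> 'k \<Rightarrow> real"
  assumes "finite J" "\<And>i j. s i j = s j i"
    "\<And>v. \<exists>j\<in>J. v j \<noteq> 0 \<Longrightarrow> 0 < (\<Sum>i\<in>J. \<Sum>j\<in>J. v i * s i j * v j)"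
  shows "\<exists>R. (\<forall>i\<in>J. 0 < R i i) \<and> (\<forall>i j. j < i \<longrightarrow> R i j = 0) \<and>
    (\<forall>i\<in>J. \<forall>j\<in>J. s i j = (\<Sum>l\<in>J. R l i * R l j))"
  using assms
proof (induction J arbitrary: s rule: finite_linorder_min_induct)
  case empty
  show ?case by (intro exI[of _ "\<lambda>_ _. 0"]) auto
next
  case (insert b J)
  have b: "b \<notin> J" "\<And>a. a \<in> J \<Longrightarrow> b < a"
    using insert.hyps by auto
  note sym = insert.prems(1)
  define c where "c = s b b"
  have "0 < (\<Sum>i\<in>insert b J. \<Sum>j\<in>insert b J. (if i = b then 1 else 0) * s i j * (if j = b then 1 else 0))"
    by (intro insert.prems(2)) auto
  also have "\<dots> = (\<Sum>i\<in>insert b J. if i = b then c else 0)"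
    using insert.hyps(1) by (intro sum.cong refl) (auto simp: c_def if_distrib cong: if_cong)
  also have "\<dots> = c"
    using insert.hyps(1) by simp
  finally have c: "0 < c" .
  define s' where "s' i j = s i j - s b i * s b j / c" for i j
  have "\<exists>R. (\<forall>i\<in>J. 0 < R i i) \<and> (\<forall>i j. j < i \<longrightarrow> R i j = 0) \<and>
    (\<forall>i\<in>J. \<forall>j\<in>J. s' i j = (\<Sum>l\<in>J. R l i * R l j))"
  proof (rule insert.IH)
    show "s' i j = s' j i" for i j
      using sym[of i j] by (simp add: s'_def mult.commute)
    fix v :: "'k \<Rightarrow> real" assume v: "\<exists>j\<in>J. v j \<noteq> 0"
    define e where "e = (\<Sum>j\<in>J. s b j * v j)"
    define F where "F = (\<Sum>i\<in>J. \<Sum>j\<in>J. v i * s i j * v j)"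
    \<comment> \<open>Completes the square in coordinate \<open>b\<close>: the form of
      \<open>s\<close> at \<open>u\<close> equals the form of \<open>s'\<close> at
      \<open>v\<close>.\<close>
    define u where "u = v(b := - e / c)"
    have u: "u b = - e / c" "\<And>j. j \<in> J \<Longrightarrow> u j = v j"
      using b(1) by (auto simp: u_def)
    have e': "(\<Sum>j\<in>J. v j * s j b) = e"
      using sym by (simp add: e_def mult.commute)
    have "\<exists>j\<in>insert b J. u j \<noteq> 0"
      using v b(1) by (auto simp: u_def)
    then have "0 < (\<Sum>i\<in>insert b J. \<Sum>j\<in>insert b J. u i * s i j * u j)"
      by (rule insert.prems(2))
    also have "\<dots> = u b * c * u b + u b * (\<Sum>j\<in>J. s b j * u j) + ((\<Sum>i\<in>J. u i * s i b) * u b + (\<Sum>i\<in>J. \<Sum>j\<in>J. u i * s i j * u j))"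
      using insert.hyps(1) b(1) by (simp add: sum.distrib c_def sum_distrib_left sum_distrib_right mult.assoc)
    also have "\<dots> = u b * c * u b + u b * e + (e * u b + F)"
      using u(2) by (simp add: e_def F_def e'[unfolded e_def] cong: sum.cong)
    also have "\<dots> = F - e * e / c"
      using c by (simp add: u field_simps)
    also have "e * e / c = (\<Sum>i\<in>J. \<Sum>j\<in>J. v i * (s b i * s b j / c) * v j)"
      by (simp add: e_def sum_product sum_divide_distrib mult_ac)
    also have "F - \<dots> = (\<Sum>i\<in>J. \<Sum>j\<in>J. v i * s' i j * v j)"
      by (simp add: F_def s'_def sum_subtractf[symmetric] algebra_simps)
    finally show "0 < (\<Sum>i\<in>J. \<Sum>j\<in>J. v i * s' i j * v j)" .
  qed
  then obtain R where R: "\<And>i. i \<in> J \<Longrightarrow> 0 < R i i" "\<And>i j. j < i \<Longrightarrow> R i j = 0"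
    "\<And>i j. i \<in> J \<Longrightarrow> j \<in> J \<Longrightarrow> s' i j = (\<Sum>l\<in>J. R l i * R l j)"
    by blast
  \<comment> \<open>The guard on \<open>j\<close> keeps row \<open>b\<close> zero at the indices
    below \<open>b\<close>, which do not belong to \<open>insert b J\<close>.\<close>
  define T where "T l j = (if l = b then (if j \<in> insert b J then s b j / sqrt c else 0) else R l j)" for l j
  have Tb: "T b i * T b j = s b i * s b j / c" if "i \<in> insert b J" "j \<in> insert b J" for i j
    using that c by (simp add: T_def)
  have TJ: "T l j = R l j" if "l \<in> J" for l j
    using that b(1) by (auto simp: T_def)
  have Rb: "R l b = 0" if "l \<in> J" for l
    using that b(2) R(2) by auto
  have sum: "(\<Sum>l\<in>insert b J. T l i * T l j) = s b i * s b j / c + (\<Sum>l\<in>J. R l i * R l j)"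
    if "i \<in> insert b J" "j \<in> insert b J" for i j
    using insert.hyps(1) b(1) Tb[OF that] by (simp add: TJ cong: sum.cong)
  show ?case
  proof (intro exI[of _ T] conjI ballI allI impI)
    show "0 < T i i" if "i \<in> insert b J" for i
      using that R(1) c by (auto simp: T_def c_def)
    show "T i j = 0" if "j < i" for i j
      using that R(2) b(2) by (auto simp: T_def dest: less_asym)
    show "s i j = (\<Sum>l\<in>insert b J. T l i * T l j)" if ij: "i \<in> insert b J" "j \<in> insert b J" for i j
    proof (cases "i = b \<or> j = b")
      case True
      then have "(\<Sum>l\<in>J. R l i * R l j) = 0"
        by (intro sum.neutral) (auto simp: Rb)
      then show ?thesis
        using True c sym[of i b] unfolding sum[OF ij] by (auto simp: c_def)
    next
      case False
      then show ?thesis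
        using ij R(3)[of i j] unfolding sum[OF ij] by (simp add: s'_def)
    qed
  qed
qed

lemma cholesky_exists:
  fixes S :: "'k::{finite,linorder} sqmat"
  assumes "pos_semidef S" "det S \<noteq> 0"
  obtains R where "is_right_cholesky S R"
proof -
  have "transpose S = S"
    using assms(1) by (simp add: pos_semidef_def)
  then have sym: "S $ i $ j = S $ j $ i" for i j
    unfolding vec_eq_iff transpose_def by simp
  have "0 < (\<Sum>i\<in>UNIV. \<Sum>j\<in>UNIV. v i * S $ i $ j * v j)" if "\<exists>j\<in>UNIV. v j \<noteq> 0" for v :: "'k \<Rightarrow> real"
  proof -
    have "(\<chi> i. v i) \<noteq> 0"
      using that by (auto simp: vec_eq_iff)
    from pos_semidef_nonzero_form[OF assms this] show ?thesis
      by (simp add: quadratic_form)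
  qed
  from cholesky_on_set[OF finite, of "\<lambda>i j. S $ i $ j", OF sym this] obtain R where
    R: "\<And>i. 0 < R i i" "\<And>i j. j < i \<Longrightarrow> R i j = 0" "\<And>i j. S $ i $ j = (\<Sum>l\<in>UNIV. R l i * R l j)"
    by auto
  have "is_right_cholesky S (\<chi> i j. R i j)"
    using R by (auto simp: is_right_cholesky_def upper_triangular_def vec_eq_iff matrix_matrix_mult_def transpose_def)
  then show thesis by (rule that)
qed

lemma tri_weight_eq_1_imp:
  fixes M :: "'k::finite sqmat"
  assumes "\<And>i. 0 \<le> M $ i $ i" "1 \<le> tri_weight M"
  shows "M = mat 1"
proof -
  have "1 \<le> exp (- (norm (M - mat 1))\<^sup>2 / 2)"
    by (rule order_trans[OF assms(2) tri_weight_upper[OF assms(1)]])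
  then have "(norm (M - mat 1))\<^sup>2 \<le> 0" by simp
  then show ?thesis by simp
qed

lemma norm_mat_1: "(norm (mat 1 :: 'k::finite sqmat))\<^sup>2 = real CARD('k)"
  using sqmat_norm_minus_id[of "mat 1 :: 'k sqmat"] by (simp add: mat_def)

lemma tri_weight_mat_1 [simp]: "tri_weight (mat 1 :: 'k::finite sqmat) = 1"
  by (simp add: tri_weight_def norm_mat_1) (simp add: mat_def)

text \<open>The equality case of \<open>tri_weight_upper\<close>: with \<open>C\<close> inverse to
  \<open>R'\<close>, the matrix \<open>R ** C\<close> satisfies \<open>M\<^sup>T M = 1\<close> and
  has diagonal product 1, so its weight is 1 and it is the identity.\<close>

lemma cholesky_unique:
  fixes S :: "'k::{finite,linorder} sqmat"
  assumes "is_right_cholesky S R" "is_right_cholesky S R'"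
  shows "R = R'"
proof -
  have R: "upper_triangular R" "\<And>i. 0 < R $ i $ i" "S = transpose R ** R"
    and R': "upper_triangular R'" "\<And>i. 0 < R' $ i $ i" "S = transpose R' ** R'"
    using assms by (auto simp: is_right_cholesky_def)
  obtain C where C: "R' ** C = mat 1" "C ** R' = mat 1" "upper_triangular C" "\<And>i. 0 < C $ i $ i"
    using upper_triangular_inverse[OF R'(1,2)] by blast
  let ?M = "R ** C"
  have diag: "?M $ i $ i = R $ i $ i * C $ i $ i" for i
    using upper_triangular_mult(2)[OF R(1) C(3)] .
  have "transpose ?M ** ?M = transpose C ** S ** C"
    by (simp add: matrix_transpose_mul matrix_mul_assoc R(3))
  also have "\<dots> = transpose (R' ** C) ** (R' ** C)"
    by (simp add: matrix_transpose_mul matrix_mul_assoc R'(3))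
  finally have "(norm ?M)\<^sup>2 = real CARD('k)"
    by (simp add: sqmat_norm_eq_trace C(1)) (simp add: trace_def mat_def transpose_def matrix_matrix_mult_def
       if_distrib[of "\<lambda>x. x * _"] cong: if_cong)
  moreover have "(det R)\<^sup>2 = (det R')\<^sup>2"
    using R(3) R'(3) by (metis det_mul det_transpose power2_eq_square)
  then have "(\<Prod>i\<in>UNIV. R $ i $ i) = (\<Prod>i\<in>UNIV. R' $ i $ i)"
    using R R' by (simp add: det_upper_triangular power2_eq_iff_nonneg prod_nonneg less_imp_le)
  moreover have "(\<Prod>i\<in>UNIV. R' $ i $ i * C $ i $ i) = 1"
    using upper_triangular_mult(2)[OF R'(1) C(3), symmetric] by (simp add: C(1)) (simp add: mat_def)
  ultimately have "tri_weight ?M = 1"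
    by (simp add: tri_weight_def diag prod.distrib)
  then have "?M = mat 1"
    using R(2) C(4) by (intro tri_weight_eq_1_imp) (auto simp: diag intro!: mult_nonneg_nonneg less_imp_le)
  then have "?M ** R' = R'"
    by simp
  then show ?thesis
    by (simp add: matrix_mul_assoc[symmetric] C(2))
qed

subsection \<open>The optimal upper triangular matrix\<close>

definition unit_columns :: "'k::finite sqmat \<Rightarrow> bool" where
  "unit_columns R \<longleftrightarrow> (\<forall>j. (\<Sum>i\<in>UNIV. (R $ i $ j)\<^sup>2) = 1)"

text \<open>This is the function \<open>G\<close> of the overview.\<close>

definition rate :: "real \<Rightarrow> 'k::finite sqmat \<Rightarrow> 'k sqmat \<Rightarrow> real" where
  "rate \<beta> A R = exp (\<beta> * trace (A ** (transpose R ** R))) * (\<Prod>i\<in>UNIV. R $ i $ i)"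

lemma trace_gram: "trace (A ** (transpose R ** R)) = (\<Sum>a\<in>UNIV. \<Sum>b\<in>UNIV. A $ a $ b * (\<Sum>i\<in>UNIV. R $ i $ a * R $ i $ b))"
  for A R :: "'k::finite sqmat"
  by (simp add: trace_def matrix_matrix_mult_def transpose_def mult.commute)

lemma compact_unit_upper_triangular:
  "compact {R :: 'k::{finite,linorder} sqmat. upper_triangular R \<and> (\<forall>i. 0 \<le> R $ i $ i) \<and> unit_columns R}"
proof -
  let ?K = "{R :: 'k sqmat. upper_triangular R \<and> (\<forall>i. 0 \<le> R $ i $ i) \<and> unit_columns R}"
  have "norm R \<le> sqrt (real CARD('k))" if "R \<in> ?K" for R
  proof -
    have "(norm R)\<^sup>2 = (\<Sum>j\<in>UNIV. \<Sum>i\<in>UNIV. (R $ i $ j)\<^sup>2)"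
      unfolding sqmat_norm_eq by (rule sum.swap)
    also have "\<dots> = real CARD('k)"
      using that by (simp add: unit_columns_def)
    finally show ?thesis
      by (simp add: real_le_rsqrt)
  qed
  then have "bounded ?K"
    by (rule boundedI)
  moreover have "closed ?K"
  proof -
    have 1: "closed {R :: 'k sqmat. j < i \<longrightarrow> R $ i $ j = 0}" for i j
      by (cases "j < i") (auto intro!: closed_Collect_eq continuous_intros)
    have 2: "closed {R :: 'k sqmat. 0 \<le> R $ i $ i}" for i
      by (intro closed_Collect_le continuous_intros)
    have 3: "closed {R :: 'k sqmat. (\<Sum>i\<in>UNIV. (R $ i $ j)\<^sup>2) = 1}" for j
      by (intro closed_Collect_eq continuous_intros)
    show ?thesis
      unfolding upper_triangular_def unit_columns_def
      by (intro closed_Collect_conj closed_Collect_all 1 2 3)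
  qed
  ultimately show ?thesis
    by (simp add: compact_eq_bounded_closed)
qed

text \<open>Compactness requires diagonals that are merely nonnegative. A maximizer still has a
  positive diagonal, because \<open>rate\<close> vanishes when a diagonal entry does and is positive
  at the identity.\<close>

lemma rate_maximizer:
  fixes A :: "'k::{finite,linorder} sqmat"
  obtains R where "upper_triangular R" "\<And>i. 0 < R $ i $ i" "unit_columns R"
    "\<And>T. upper_triangular T \<Longrightarrow> (\<And>i. 0 \<le> T $ i $ i) \<Longrightarrow> unit_columns T \<Longrightarrow> rate \<beta> A T \<le> rate \<beta> A R"
proof -
  let ?K = "{R :: 'k sqmat. upper_triangular R \<and> (\<forall>i. 0 \<le> R $ i $ i) \<and> unit_columns R}"
  have id: "mat 1 \<in> ?K"
    by (auto simp: upper_triangular_def unit_columns_def mat_def if_distrib[of "\<lambda>x. x\<^sup>2"] cong: if_cong)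
  have "continuous_on ?K (rate \<beta> A)"
    unfolding rate_def trace_gram by (intro continuous_intros)
  then obtain R where R: "R \<in> ?K" "\<And>T. T \<in> ?K \<Longrightarrow> rate \<beta> A T \<le> rate \<beta> A R"
    using continuous_attains_sup[OF compact_unit_upper_triangular] id by blast
  have "0 < rate \<beta> A (mat 1)"
    by (auto simp: rate_def mat_def intro!: mult_pos_pos prod_pos)
  also have "\<dots> \<le> rate \<beta> A R"
    using R(2) id by blast
  finally have "rate \<beta> A R \<noteq> 0"
    by simp
  then have "(\<Prod>i\<in>UNIV. R $ i $ i) \<noteq> 0"
    unfolding rate_def by (metis mult_zero_right)
  then have "R $ i $ i \<noteq> 0" for i
    by auto
  then have "0 < R $ i $ i" for i
    using R(1) by (auto simp: less_le)
  then show thesis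
    using R by (intro that[of R]) auto
qed

text \<open>
  Differentiate along the curve \<open>(r + t v) / \<parallel>r + t v\<parallel>\<close>, where
  \<open>v\<close> is the component of the gradient orthogonal to \<open>r\<close>.
\<close>

lemma column_critical:
  fixes r h :: "'k::{finite,linorder} \<Rightarrow> real"
  assumes r: "(\<Sum>i\<in>UNIV. (r i)\<^sup>2) = 1" "\<And>i. j < i \<Longrightarrow> r i = 0" "0 < r j"
    and max: "\<And>u. (\<Sum>i\<in>UNIV. (u i)\<^sup>2) = 1 \<Longrightarrow> (\<And>i. j < i \<Longrightarrow> u i = 0) \<Longrightarrow> 0 \<le> u j \<Longrightarrow>
      exp (\<Sum>i\<in>UNIV. h i * u i) * u j \<le> exp (\<Sum>i\<in>UNIV. h i * r i) * r j"
  obtains c where "\<And>i. i \<le> j \<Longrightarrow> h i + (if i = j then 1 / r j else 0) = c * r i"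
proof -
  \<comment> \<open>The gradient at \<open>r\<close> of
    \<open>(\<Sum>i. h i * u i) + ln (u j)\<close>, restricted to the free coordinates
    \<open>i \<le> j\<close>.\<close>
  define g where "g i = (if i \<le> j then h i + (if i = j then 1 / r j else 0) else 0)" for i
  define c where "c = (\<Sum>i\<in>UNIV. g i * r i)"
  define v where "v i = g i - c * r i" for i
  define V where "V = (\<Sum>i\<in>UNIV. (v i)\<^sup>2)"
  define a where "a = (\<Sum>i\<in>UNIV. h i * r i)"
  define b where "b = (\<Sum>i\<in>UNIV. h i * v i)"
  have v0: "v i = 0" if "j < i" for i
    using that r(2) by (simp add: v_def g_def)
  have V: "0 \<le> V"
    by (simp add: V_def sum_nonneg)
  have vr: "(\<Sum>i\<in>UNIV. v i * r i) = 0"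
  proof -
    have "(\<Sum>i\<in>UNIV. v i * r i) = c - c * (\<Sum>i\<in>UNIV. (r i)\<^sup>2)"
      by (simp add: v_def c_def left_diff_distrib sum_subtractf sum_distrib_left power2_eq_square mult.assoc)
    then show ?thesis by (simp add: r(1))
  qed
  have "V = (\<Sum>i\<in>UNIV. g i * v i) - c * (\<Sum>i\<in>UNIV. v i * r i)"
    unfolding V_def by (simp add: sum_distrib_left sum_subtractf[symmetric] v_def power2_eq_square algebra_simps)
  then have Vg: "V = (\<Sum>i\<in>UNIV. g i * v i)"
    by (simp add: vr)
  also have "\<dots> = (\<Sum>i\<in>UNIV. h i * v i + (if i = j then v j / r j else 0))"
    using v0 by (intro sum.cong refl) (auto simp: g_def algebra_simps)
  \<comment> \<open>The right side is the derivative of the logarithmic objective along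
    \<open>v\<close> at 0. A vanishing derivative therefore forces \<open>v = 0\<close>, and the
    gradient is a multiple of \<open>r\<close>.\<close>
  finally have Vb: "V = b + v j / r j"
    by (simp add: sum.distrib b_def)
  have norm_t: "(\<Sum>i\<in>UNIV. (r i + t * v i)\<^sup>2) = 1 + t\<^sup>2 * V" for t
  proof -
    have "(\<Sum>i\<in>UNIV. (r i + t * v i)\<^sup>2) = (\<Sum>i\<in>UNIV. (r i)\<^sup>2) + 2 * t * (\<Sum>i\<in>UNIV. v i * r i) + t\<^sup>2 * V"
      by (simp add: V_def sum_distrib_left sum.distrib[symmetric] power2_eq_square algebra_simps)
    then show ?thesis by (simp add: r(1) vr)
  qed
  define \<phi> where "\<phi> t = (a + t * b) / sqrt (1 + t\<^sup>2 * V) + ln (r j + t * v j) - ln (1 + t\<^sup>2 * V) / 2" for t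
  have "(\<phi> has_real_derivative (b + v j / r j)) (at 0)"
    unfolding \<phi>_def using r(3)
    by (auto intro!: derivative_eq_intros simp: field_simps)
  moreover
  \<comment> \<open>Within this range the coordinate \<open>j\<close> of the curve stays positive,
    so the curve is admissible and its logarithm is defined.\<close>
  define d where "d = r j / (\<bar>v j\<bar> + 1)"
  have d: "0 < d"
    using r(3) by (simp add: d_def)
  have "\<phi> t \<le> \<phi> 0" if t: "\<bar>0 - t\<bar> < d" for t
  proof -
    define s where "s = sqrt (1 + t\<^sup>2 * V)"
    have s2: "s\<^sup>2 = 1 + t\<^sup>2 * V" and s: "0 < s"
      using V by (simp_all add: s_def add_pos_nonneg)
    have "\<bar>t * v j\<bar> \<le> \<bar>t\<bar> * (\<bar>v j\<bar> + 1)"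
      by (simp add: abs_mult mult_left_mono)
    also have "\<dots> < r j"
      using t r(3) by (simp add: d_def pos_less_divide_eq)
    finally have pos: "0 < r j + t * v j"
      by linarith
    define u where "u i = (r i + t * v i) / s" for i
    have hu: "(\<Sum>i\<in>UNIV. h i * u i) = (a + t * b) / s"
      by (simp add: u_def a_def b_def sum_divide_distrib[symmetric] sum_distrib_left sum.distrib[symmetric] algebra_simps)
    have "exp (\<Sum>i\<in>UNIV. h i * u i) * u j \<le> exp (\<Sum>i\<in>UNIV. h i * r i) * r j"
    proof (rule max)
      show "(\<Sum>i\<in>UNIV. (u i)\<^sup>2) = 1"
        using s norm_t[of t] unfolding s2[symmetric]
        by (simp add: u_def power_divide sum_divide_distrib[symmetric])
      show "u i = 0" if "j < i" for i
        using that by (simp add: u_def r(2) v0)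
      show "0 \<le> u j"
        using pos s by (simp add: u_def)
    qed
    then have "ln (exp ((a + t * b) / s) * ((r j + t * v j) / s)) \<le> ln (exp a * r j)"
      using pos s r(3) unfolding hu by (simp add: u_def a_def)
    then have "(a + t * b) / s + (ln (r j + t * v j) - ln s) \<le> a + ln (r j)"
      using pos s r(3) by (simp add: ln_mult ln_div)
    moreover have "ln s = ln (1 + t\<^sup>2 * V) / 2"
      using V by (simp add: s_def ln_sqrt add_pos_nonneg)
    ultimately show ?thesis
      by (simp add: \<phi>_def s_def)
  qed
  ultimately have "b + v j / r j = 0"
    by (intro DERIV_local_max[of \<phi> _ 0 d]) (use d in auto)
  then have "V = 0"
    by (simp add: Vb)
  then have "v i = 0" for i
    by (simp add: V_def sum_nonneg_eq_0_iff)
  then have "g i = c * r i" for i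
    by (simp add: v_def)
  then show thesis
    using that[of c] by (metis g_def)
qed

definition replace_column :: "'k::finite sqmat \<Rightarrow> 'k \<Rightarrow> ('k \<Rightarrow> real) \<Rightarrow> 'k sqmat" where
  "replace_column R j u = (\<chi> i a. if a = j then u i else R $ i $ a)"

text \<open>As a function of one unit column the trace is affine: the only quadratic term is
  \<open>A $ j $ j\<close> times the squared length of the column. Symmetry of \<open>A\<close>
  merges the two cross terms into the factor 2.\<close>

lemma trace_gram_replace_column:
  fixes A :: "'k::finite sqmat"
  assumes "transpose A = A"
  obtains c where "\<And>u. (\<Sum>i\<in>UNIV. (u i)\<^sup>2) = 1 \<Longrightarrow>
    trace (A ** (transpose (replace_column R j u) ** replace_column R j u)) =
      c + (\<Sum>i\<in>UNIV. (\<Sum>a\<in>UNIV - {j}. 2 * A $ a $ j * R $ i $ a) * u i)"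
proof -
  have "transpose A $ b $ a = A $ a $ b" for a b
    by (simp add: transpose_def)
  then have sym: "A $ b $ a = A $ a $ b" for a b
    unfolding assms .
  define c where "c = A $ j $ j + (\<Sum>a\<in>UNIV - {j}. \<Sum>b\<in>UNIV - {j}. A $ a $ b * (\<Sum>i\<in>UNIV. R $ i $ a * R $ i $ b))"
  have "trace (A ** (transpose (replace_column R j u) ** replace_column R j u)) =
      c + (\<Sum>i\<in>UNIV. (\<Sum>a\<in>UNIV - {j}. 2 * A $ a $ j * R $ i $ a) * u i)"
    if u: "(\<Sum>i\<in>UNIV. (u i)\<^sup>2) = 1" for u
  proof -
    let ?T = "replace_column R j u"
    define f where "f a b = A $ a $ b * (\<Sum>i\<in>UNIV. ?T $ i $ a * ?T $ i $ b)" for a b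
    have fsym: "f b a = f a b" for a b
      by (simp add: f_def sym[of a b] mult.commute[of "?T $ _ $ a"])
    have fjj: "f j j = A $ j $ j"
      using u by (simp add: f_def replace_column_def power2_eq_square)
    have faj: "f a j = A $ a $ j * (\<Sum>i\<in>UNIV. R $ i $ a * u i)" if "a \<in> UNIV - {j}" for a
      using that by (simp add: f_def replace_column_def)
    have fab: "f a b = A $ a $ b * (\<Sum>i\<in>UNIV. R $ i $ a * R $ i $ b)" if "a \<in> UNIV - {j}" "b \<in> UNIV - {j}" for a b
      using that by (simp add: f_def replace_column_def)
    have split: "(\<Sum>a\<in>UNIV. g a) = g j + (\<Sum>a\<in>UNIV - {j}. g a)" for g :: "'k \<Rightarrow> real"
      by (rule sum.remove) auto
    have "trace (A ** (transpose ?T ** ?T)) = (\<Sum>a\<in>UNIV. \<Sum>b\<in>UNIV. f a b)"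
      by (simp add: trace_gram f_def)
    also have "\<dots> = (\<Sum>a\<in>UNIV. f a j + (\<Sum>b\<in>UNIV - {j}. f a b))"
      by (intro sum.cong refl split)
    also have "\<dots> = f j j + (\<Sum>b\<in>UNIV - {j}. f j b) + (\<Sum>a\<in>UNIV - {j}. f a j + (\<Sum>b\<in>UNIV - {j}. f a b))"
      by (rule split)
    also have "\<dots> = f j j + (\<Sum>a\<in>UNIV - {j}. 2 * f a j) + (\<Sum>a\<in>UNIV - {j}. \<Sum>b\<in>UNIV - {j}. f a b)"
    proof -
      have "(\<Sum>b\<in>UNIV - {j}. f j b) = (\<Sum>b\<in>UNIV - {j}. f b j)"
        by (intro sum.cong refl fsym)
      then show ?thesis
        by (simp add: sum.distrib sum_distrib_left[symmetric])
    qed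
    also have "(\<Sum>a\<in>UNIV - {j}. \<Sum>b\<in>UNIV - {j}. f a b) =
        (\<Sum>a\<in>UNIV - {j}. \<Sum>b\<in>UNIV - {j}. A $ a $ b * (\<Sum>i\<in>UNIV. R $ i $ a * R $ i $ b))"
      by (intro sum.cong refl fab)
    also have "(\<Sum>a\<in>UNIV - {j}. 2 * f a j) = (\<Sum>a\<in>UNIV - {j}. \<Sum>i\<in>UNIV. 2 * A $ a $ j * R $ i $ a * u i)"
      by (intro sum.cong refl) (simp only: faj sum_distrib_left mult.assoc)
    also have "\<dots> = (\<Sum>i\<in>UNIV. \<Sum>a\<in>UNIV - {j}. 2 * A $ a $ j * R $ i $ a * u i)"
      by (rule sum.swap)
    finally show ?thesis
      by (simp add: c_def fjj sum_distrib_right)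
  qed
  then show thesis by (rule that)
qed

text \<open>With \<open>W = \<Lambda> - 2 \<beta> A\<close>, criticality of column \<open>j\<close>
  determines the entries of \<open>R ** W\<close> with \<open>i \<le> j\<close>. They suffice for
  the upper triangle of \<open>R W R\<^sup>T\<close>, and symmetry supplies the rest.\<close>

lemma critical_equation:
  fixes A R :: "'k::{finite,linorder} sqmat"
  assumes A: "transpose A = A"
    and R: "upper_triangular R" "\<And>i. 0 < R $ i $ i" "unit_columns R"
    and max: "\<And>T. upper_triangular T \<Longrightarrow> (\<And>i. 0 \<le> T $ i $ i) \<Longrightarrow> unit_columns T \<Longrightarrow> rate \<beta> A T \<le> rate \<beta> A R"
  obtains \<Lambda> where "R ** ((\<chi> i j. (if i = j then \<Lambda> i else 0) - 2 * \<beta> * A $ i $ j) ** transpose R) = mat 1"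
proof -
  have "\<exists>c. \<forall>i\<le>j. \<beta> * (\<Sum>a\<in>UNIV - {j}. 2 * A $ a $ j * R $ i $ a) + (if i = j then 1 / R $ j $ j else 0) = c * R $ i $ j" for j
  proof -
    let ?h = "\<lambda>i. \<Sum>a\<in>UNIV - {j}. 2 * A $ a $ j * R $ i $ a"
    obtain c where c: "\<And>u. (\<Sum>i\<in>UNIV. (u i)\<^sup>2) = 1 \<Longrightarrow>
      trace (A ** (transpose (replace_column R j u) ** replace_column R j u)) = c + (\<Sum>i\<in>UNIV. ?h i * u i)"
      using trace_gram_replace_column[OF A] by blast
    define D where "D = exp (\<beta> * c) * (\<Prod>i\<in>UNIV - {j}. R $ i $ i)"
    have D: "0 < D"
      unfolding D_def using R(2) by (intro mult_pos_pos prod_pos) auto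
    \<comment> \<open>With the other columns fixed, \<open>rate\<close> takes the form treated in
      \<open>column_critical\<close>, up to the positive factor \<open>D\<close>.\<close>
    have rate: "rate \<beta> A (replace_column R j u) = D * (exp (\<Sum>i\<in>UNIV. \<beta> * ?h i * u i) * u j)"
      if "(\<Sum>i\<in>UNIV. (u i)\<^sup>2) = 1" for u
    proof -
      have "(\<Prod>i\<in>UNIV. replace_column R j u $ i $ i) = u j * (\<Prod>i\<in>UNIV - {j}. R $ i $ i)"
        by (subst prod.remove[of _ j]) (auto simp: replace_column_def intro!: prod.cong)
      moreover have "\<beta> * (c + (\<Sum>i\<in>UNIV. ?h i * u i)) = \<beta> * c + (\<Sum>i\<in>UNIV. \<beta> * ?h i * u i)"
        by (simp add: distrib_left sum_distrib_left[of \<beta> _ UNIV] mult.assoc)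
      ultimately show ?thesis
        unfolding rate_def c[OF that] by (simp add: D_def exp_add mult_ac)
    qed
    have Rj: "replace_column R j (\<lambda>i. R $ i $ j) = R"
      by (simp add: replace_column_def vec_eq_iff)
    have unit: "(\<Sum>i\<in>UNIV. (R $ i $ j)\<^sup>2) = 1"
      using R(3) by (simp add: unit_columns_def)
    obtain d where "\<And>i. i \<le> j \<Longrightarrow> \<beta> * ?h i + (if i = j then 1 / R $ j $ j else 0) = d * R $ i $ j"
    proof (rule column_critical[of "\<lambda>i. R $ i $ j" j "\<lambda>i. \<beta> * ?h i"])
      show "(\<Sum>i\<in>UNIV. (R $ i $ j)\<^sup>2) = 1" by (rule unit)
      show "R $ i $ j = 0" if "j < i" for i
        using that R(1) by (simp add: upper_triangular_def)
      show "0 < R $ j $ j" by (rule R(2))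
      fix u :: "'k \<Rightarrow> real" assume u: "(\<Sum>i\<in>UNIV. (u i)\<^sup>2) = 1" "\<And>i. j < i \<Longrightarrow> u i = 0" "0 \<le> u j"
      have "rate \<beta> A (replace_column R j u) \<le> rate \<beta> A (replace_column R j (\<lambda>i. R $ i $ j))"
        unfolding Rj
      proof (rule max)
        show "upper_triangular (replace_column R j u)"
          using R(1) u(2) by (simp add: upper_triangular_def replace_column_def)
        show "0 \<le> replace_column R j u $ i $ i" for i
          using u(3) R(2)[of i] by (simp add: replace_column_def)
        show "unit_columns (replace_column R j u)"
          unfolding unit_columns_def
        proof
          show "(\<Sum>i\<in>UNIV. (replace_column R j u $ i $ a)\<^sup>2) = 1" for a
            using R(3) u(1) by (cases "a = j") (simp_all add: unit_columns_def replace_column_def)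
        qed
      qed
      then show "exp (\<Sum>i\<in>UNIV. \<beta> * ?h i * u i) * u j \<le> exp (\<Sum>i\<in>UNIV. \<beta> * ?h i * R $ i $ j) * R $ j $ j"
        using D unfolding rate[OF u(1)] rate[OF unit] by simp
    qed (rule that)
    then show ?thesis by blast
  qed
  then have "\<exists>c. \<forall>j. \<forall>i\<le>j. \<beta> * (\<Sum>a\<in>UNIV - {j}. 2 * A $ a $ j * R $ i $ a) +
      (if i = j then 1 / R $ j $ j else 0) = c j * R $ i $ j"
    by (intro choice allI)
  then obtain c where c: "\<And>i j. i \<le> j \<Longrightarrow>
      \<beta> * (\<Sum>a\<in>UNIV - {j}. 2 * A $ a $ j * R $ i $ a) + (if i = j then 1 / R $ j $ j else 0) = c j * R $ i $ j"
    by blast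
  \<comment> \<open>The extra term compensates for the diagonal entry of \<open>A\<close>, which the
    sums over \<open>a\<close> different from \<open>j\<close> leave out.\<close>
  define \<Lambda> where "\<Lambda> j = c j + 2 * \<beta> * A $ j $ j" for j
  define W :: "'k sqmat" where "W = (\<chi> i j. (if i = j then \<Lambda> i else 0) - 2 * \<beta> * A $ i $ j)"
  define P where "P = R ** (W ** transpose R)"
  have N: "(R ** W) $ i $ j = (if i = j then 1 / R $ j $ j else 0)" if "i \<le> j" for i j
  proof -
    have "(R ** W) $ i $ j = (\<Sum>l\<in>UNIV. (if l = j then R $ i $ j * \<Lambda> j else 0) - 2 * \<beta> * (R $ i $ l * A $ l $ j))"
      unfolding matrix_matrix_mult_def W_def by (auto intro!: sum.cong simp: algebra_simps)
    also have "\<dots> = R $ i $ j * \<Lambda> j - 2 * \<beta> * (\<Sum>l\<in>UNIV. R $ i $ l * A $ l $ j)"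
      by (simp add: sum_subtractf sum_distrib_left)
    also have "(\<Sum>l\<in>UNIV. R $ i $ l * A $ l $ j) = R $ i $ j * A $ j $ j + (\<Sum>l\<in>UNIV - {j}. R $ i $ l * A $ l $ j)"
      by (rule sum.remove) auto
    also have "R $ i $ j * \<Lambda> j - 2 * \<beta> * (R $ i $ j * A $ j $ j + (\<Sum>l\<in>UNIV - {j}. R $ i $ l * A $ l $ j)) =
       c j * R $ i $ j - \<beta> * (\<Sum>a\<in>UNIV - {j}. 2 * A $ a $ j * R $ i $ a)"
      by (simp add: \<Lambda>_def algebra_simps sum_distrib_left)
    also have "\<dots> = (if i = j then 1 / R $ j $ j else 0)"
      using c[OF that] by linarith
    finally show ?thesis .
  qed
  \<comment> \<open>\<open>R $ j $ l\<close> vanishes for \<open>l < j\<close>, so only entries of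
    \<open>R ** W\<close> with \<open>i \<le> j \<le> l\<close> occur, and these are known.\<close>
  have Pu: "P $ i $ j = (if i = j then 1 else 0)" if "i \<le> j" for i j
  proof -
    have "P $ i $ j = (\<Sum>l\<in>UNIV. (R ** W) $ i $ l * R $ j $ l)"
      unfolding P_def matrix_mul_assoc by (simp add: matrix_matrix_mult_def[of "R ** W"] transpose_def)
    also have "\<dots> = (\<Sum>l\<in>UNIV. if l = i then (if i = j then 1 else 0) else 0)"
    proof (rule sum.cong[OF refl])
      fix l
      show "(R ** W) $ i $ l * R $ j $ l = (if l = i then (if i = j then 1 else 0) else 0)"
      proof (cases "l < j")
        case True
        then have "R $ j $ l = 0"
          using R(1) by (simp add: upper_triangular_def)
        then show ?thesis using True by auto
      next
        case False
        then have "i \<le> l" using that by simp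
        then show ?thesis
          using N[of i l] R(2)[of i] False that by auto
      qed
    qed
    finally show ?thesis by simp
  qed
  have At: "A $ b $ a = A $ a $ b" for a b
  proof -
    have "transpose A $ b $ a = A $ a $ b" by (simp add: transpose_def)
    then show ?thesis unfolding A .
  qed
  have "transpose W = W"
    by (simp add: W_def vec_eq_iff transpose_def At)
  then have "transpose P = P"
    by (simp add: P_def matrix_transpose_mul matrix_mul_assoc)
  then have Psym: "P $ j $ i = P $ i $ j" for i j
    unfolding vec_eq_iff transpose_def by simp
  have "P $ i $ j = (if i = j then 1 else 0)" for i j
    using Pu[of i j] Pu[of j i] Psym[of i j] by (cases "i \<le> j") auto
  then have "P = mat 1"
    by (simp add: vec_eq_iff mat_def)
  then show thesis
    using that[of \<Lambda>] by (simp only: P_def W_def)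
qed

lemma trace_transpose_mult_self: "trace (C ** (transpose C ** (transpose R ** R))) = (norm (R ** C :: 'k::finite sqmat))\<^sup>2"
proof -
  have "(norm (R ** C))\<^sup>2 = trace ((transpose C ** (transpose R ** R)) ** C)"
    by (simp add: sqmat_norm_eq_trace matrix_transpose_mul matrix_mul_assoc)
  also have "\<dots> = trace (C ** (transpose C ** (transpose R ** R)))"
    by (rule trace_mul_sym)
  finally show ?thesis ..
qed

text \<open>
  Since \<open>S\<inverse> = \<Lambda> - 2 \<beta> A\<close> for the maximizer \<open>S = R\<^sup>T R\<close>, the objective is, relative to its maximum,
  a function of \<open>M = T R\<inverse>\<close> alone.
\<close>

lemma optimal_triangular:
  fixes A :: "'k::{finite,linorder} sqmat"
  assumes A: "transpose A = A"
  obtains R C where "upper_triangular R" "\<And>i. 0 < R $ i $ i" "unit_columns R"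
    "upper_triangular C" "\<And>i. 0 < C $ i $ i" "R ** C = mat 1" "C ** R = mat 1"
    "\<And>T. upper_triangular T \<Longrightarrow> unit_columns T \<Longrightarrow> rate \<beta> A T = rate \<beta> A R * tri_weight (T ** C)"
proof -
  obtain R where R: "upper_triangular R" "\<And>i. 0 < R $ i $ i" "unit_columns R"
    and max: "\<And>T. upper_triangular T \<Longrightarrow> (\<And>i. 0 \<le> T $ i $ i) \<Longrightarrow> unit_columns T \<Longrightarrow> rate \<beta> A T \<le> rate \<beta> A R"
    using rate_maximizer by blast
  obtain \<Lambda> where \<Lambda>: "R ** ((\<chi> i j. (if i = j then \<Lambda> i else 0) - 2 * \<beta> * A $ i $ j) ** transpose R) = mat 1"
    using critical_equation[OF A R max] by blast
  obtain C where C: "R ** C = mat 1" "C ** R = mat 1" "upper_triangular C" "\<And>i. 0 < C $ i $ i"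
    using upper_triangular_inverse[OF R(1,2)] by blast
  define W :: "'k sqmat" where "W = (\<chi> i j. (if i = j then \<Lambda> i else 0) - 2 * \<beta> * A $ i $ j)"
  have tRC: "transpose R ** transpose C = mat 1"
    using C(2) by (simp add: matrix_transpose_mul[symmetric])
  have "C ** transpose C = C ** (R ** (W ** transpose R)) ** transpose C"
    using \<Lambda> by (simp add: W_def)
  also have "\<dots> = (C ** R) ** W ** (transpose R ** transpose C)"
    by (simp add: matrix_mul_assoc)
  also have "\<dots> = W"
    by (simp add: C(2) tRC)
  finally have W: "W = C ** transpose C" ..
  \<comment> \<open>\<open>|T C|\<^sup>2\<close> is the trace of \<open>W T\<^sup>T T\<close>. Unit
    columns turn its diagonal part into the constant \<open>\<Sum>j. \<Lambda> j\<close>; the rest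
    is \<open>- 2 \<beta>\<close> times the trace in \<open>rate\<close>.\<close>
  have rate: "rate \<beta> A T = exp (((\<Sum>j\<in>UNIV. \<Lambda> j) - (norm (T ** C))\<^sup>2) / 2) * (\<Prod>i\<in>UNIV. T $ i $ i)"
    if T: "unit_columns T" for T
  proof -
    have "(norm (T ** C))\<^sup>2 = trace (W ** (transpose T ** T))"
      by (simp add: W matrix_mul_assoc[symmetric] trace_transpose_mult_self)
    also have "\<dots> = (\<Sum>a\<in>UNIV. \<Sum>b\<in>UNIV. (if b = a then \<Lambda> a * (\<Sum>i\<in>UNIV. T $ i $ a * T $ i $ a) else 0)
        - 2 * \<beta> * (A $ a $ b * (\<Sum>i\<in>UNIV. T $ i $ a * T $ i $ b)))"
      unfolding trace_gram W_def by (intro sum.cong refl) (auto simp: left_diff_distrib)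
    also have "\<dots> = (\<Sum>a\<in>UNIV. \<Lambda> a * (\<Sum>i\<in>UNIV. T $ i $ a * T $ i $ a)) - 2 * \<beta> * trace (A ** (transpose T ** T))"
      by (simp add: sum_subtractf trace_gram sum_distrib_left)
    also have "\<dots> = (\<Sum>a\<in>UNIV. \<Lambda> a) - 2 * \<beta> * trace (A ** (transpose T ** T))"
      using T by (simp add: unit_columns_def power2_eq_square)
    finally have "\<beta> * trace (A ** (transpose T ** T)) = ((\<Sum>j\<in>UNIV. \<Lambda> j) - (norm (T ** C))\<^sup>2) / 2"
      by simp
    then show ?thesis
      by (simp add: rate_def)
  qed
  have "rate \<beta> A T = rate \<beta> A R * tri_weight (T ** C)" if T: "upper_triangular T" "unit_columns T" for T
  proof -
    have "T $ i $ i = (T ** C) $ i $ i * R $ i $ i" for i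
    proof -
      have "T = (T ** C) ** R"
        by (simp add: matrix_mul_assoc[symmetric] C(2))
      then show ?thesis
        using upper_triangular_mult(2)[OF upper_triangular_mult(1)[OF T(1) C(3)] R(1), of i] by simp
    qed
    then have "(\<Prod>i\<in>UNIV. T $ i $ i) = (\<Prod>i\<in>UNIV. (T ** C) $ i $ i) * (\<Prod>i\<in>UNIV. R $ i $ i)"
      by (simp add: prod.distrib[symmetric])
    moreover have "exp (((\<Sum>j\<in>UNIV. \<Lambda> j) - (norm (T ** C))\<^sup>2) / 2) =
        exp (((\<Sum>j\<in>UNIV. \<Lambda> j) - real CARD('k)) / 2) * exp ((real CARD('k) - (norm (T ** C))\<^sup>2) / 2)"
      by (simp add: exp_add[symmetric] diff_divide_distrib)
    ultimately show ?thesis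
      by (simp add: rate[OF T(2)] rate[OF R(3)] C(1) norm_mat_1 tri_weight_def)
  qed
  then show thesis
    using that R C by blast
qed

section \<open>The log-determinant program in terms of Cholesky factors\<close>

text \<open>The factor 1/2 before the log-determinant compensates for \<open>det S\<close> being the
  square of the diagonal product of \<open>R\<close>.\<close>

lemma objective_cholesky:
  fixes R :: "'k::{finite,linorder} sqmat"
  assumes "is_right_cholesky S R"
  shows "objective \<beta> A S = ereal (ln (rate \<beta> A R))"
proof -
  have R: "upper_triangular R" "\<And>i. 0 < R $ i $ i" "S = transpose R ** R"
    using assms by (auto simp: is_right_cholesky_def)
  define p where "p = (\<Prod>i\<in>UNIV. R $ i $ i)"
  have p: "0 < p"
    using R(2) by (auto simp: p_def intro!: prod_pos)
  have "det S = p * p"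
    by (simp add: R(3) det_mul det_transpose det_upper_triangular[OF R(1)] p_def)
  then have "logdet S = ereal (2 * ln p)"
    using p by (simp add: logdet_def ln_mult)
  moreover have "ln (rate \<beta> A R) = \<beta> * trace (A ** S) + ln p"
    using p by (simp add: rate_def p_def[symmetric] ln_mult R(3))
  ultimately show ?thesis
    by (simp add: objective_def)
qed

lemma unit_columns_cholesky:
  assumes "is_right_cholesky S R"
  shows "(\<forall>i. S $ i $ i = 1) \<longleftrightarrow> unit_columns R"
  using assms by (auto simp: is_right_cholesky_def unit_columns_def matrix_matrix_mult_def transpose_def power2_eq_square)

lemma pos_semidef_gram: "pos_semidef (transpose R ** R)"
proof -
  have "v \<bullet> ((transpose R ** R) *v v) = (R *v v) \<bullet> (R *v v)" for v
  proof -
    have "(transpose R ** R) *v v = transpose R *v (R *v v)"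
      by (simp add: matrix_vector_mul_assoc)
    then show ?thesis
      using dot_lmul_matrix[of "R *v v" R v] transpose_matrix_vector[of R "R *v v"] by (simp add: inner_commute)
  qed
  then show ?thesis
    by (simp add: pos_semidef_def matrix_transpose_mul)
qed

text \<open>Singular matrices have objective \<open>-\<infinity>\<close>. Any other feasible matrix
  has a Cholesky factor \<open>U\<close> with unit columns, and its comparison with \<open>R\<close>
  amounts to \<open>tri_weight (U ** C) \<le> 1\<close>, with equality only for
  \<open>U = R\<close>.\<close>

lemma optimal_iff:
  fixes A R C :: "'k::{finite,linorder} sqmat"
  assumes R: "upper_triangular R" "\<And>i. 0 < R $ i $ i" "unit_columns R"
    and C: "upper_triangular C" "\<And>i. 0 < C $ i $ i" "R ** C = mat 1" "C ** R = mat 1"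
    and rate: "\<And>T. upper_triangular T \<Longrightarrow> unit_columns T \<Longrightarrow> rate \<beta> A T = rate \<beta> A R * tri_weight (T ** C)"
  shows "is_optimal \<beta> A S \<longleftrightarrow> S = transpose R ** R"
proof -
  let ?S = "transpose R ** R"
  have chol: "is_right_cholesky ?S R"
    using R by (simp add: is_right_cholesky_def)
  have feas: "feasible ?S"
    using unit_columns_cholesky[OF chol] R(3) by (simp add: feasible_def pos_semidef_gram)
  have rate_pos: "0 < rate \<beta> A T" if "\<And>i. 0 < T $ i $ i" for T :: "'k sqmat"
    unfolding rate_def using that by (intro mult_pos_pos prod_pos) auto
  have cmp: "objective \<beta> A T \<le> objective \<beta> A ?S \<and> (objective \<beta> A ?S \<le> objective \<beta> A T \<longrightarrow> T = ?S)"
    if T: "feasible T" for T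
  proof (cases "det T = 0")
    case True
    then have "objective \<beta> A T = - \<infinity>"
      by (simp add: objective_def logdet_def)
    then show ?thesis
      by (simp add: objective_cholesky[OF chol])
  next
    case False
    have "pos_semidef T"
      using T by (simp add: feasible_def)
    then obtain U where U: "is_right_cholesky T U"
      using cholesky_exists False by blast
    then have U': "upper_triangular U" "\<And>i. 0 < U $ i $ i" "T = transpose U ** U"
      by (auto simp: is_right_cholesky_def)
    have Uunit: "unit_columns U"
      using T unit_columns_cholesky[OF U] by (simp add: feasible_def)
    have diag: "0 \<le> (U ** C) $ i $ i" for i
      using U'(2)[of i] C(2)[of i] by (simp add: upper_triangular_mult(2)[OF U'(1) C(1)])
    have "tri_weight (U ** C) \<le> exp (- (norm (U ** C - mat 1))\<^sup>2 / 2)"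
      by (rule tri_weight_upper[OF diag])
    also have "\<dots> \<le> 1"
      by simp
    finally have le: "tri_weight (U ** C) \<le> 1" .
    have "rate \<beta> A U = rate \<beta> A R * tri_weight (U ** C)"
      by (rule rate[OF U'(1) Uunit])
    then have iff: "rate \<beta> A R \<le> rate \<beta> A U \<longleftrightarrow> 1 \<le> tri_weight (U ** C)"
      and le': "rate \<beta> A U \<le> rate \<beta> A R"
      using rate_pos[OF R(2)] le by simp_all
    have "T = ?S" if "1 \<le> tri_weight (U ** C)"
    proof -
      have "U ** C = mat 1"
        using diag that by (rule tri_weight_eq_1_imp)
      then have "U ** C ** R = R"
        by simp
      then have "U = R"
        by (simp add: matrix_mul_assoc[symmetric] C(4))
      then show ?thesis
        using U'(3) by simp
    qed
    then show ?thesis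
      using iff le' rate_pos[OF R(2)] rate_pos[OF U'(2)]
      by (simp add: objective_cholesky[OF chol] objective_cholesky[OF U])
  qed
  show ?thesis
    using cmp feas unfolding is_optimal_def by blast
qed

subsection \<open>The triangular factor\<close>

text \<open>The triangular factor as read off the recursion, a total function whose measurability
  needs no case distinction on the rank.\<close>

definition rmat :: "nat \<Rightarrow> ('k::{finite,linorder} \<Rightarrow> nat \<Rightarrow> real) \<Rightarrow> 'k sqmat" where
  "rmat n X = (\<chi> i j. if i < j then ip n (gs n UNIV X i) (X j)
     else if i = j then L2_set (gs_resid n UNIV X j) {..<n} else 0)"

lemma rmat_upper_triangular: "upper_triangular (rmat n X)"
  by (auto simp: upper_triangular_def rmat_def dest: less_asym)

lemma rmat_decomposition:
  assumes "i < n"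
  shows "X j i = (\<Sum>l\<in>UNIV. gs n UNIV X l i * rmat n X $ l $ j)"
proof -
  have "(\<Sum>l\<in>UNIV. gs n UNIV X l i * rmat n X $ l $ j) =
      gs n UNIV X j i * rmat n X $ j $ j + (\<Sum>l\<in>UNIV - {j}. gs n UNIV X l i * rmat n X $ l $ j)"
    by (rule sum.remove) auto
  also have "(\<Sum>l\<in>UNIV - {j}. gs n UNIV X l i * rmat n X $ l $ j) =
      (\<Sum>l\<in>{l\<in>UNIV. l < j}. gs n UNIV X l i * ip n (gs n UNIV X l) (X j))"
    by (rule sum.mono_neutral_cong_right) (auto simp: rmat_def)
  finally show ?thesis
    using gs_decomposition[of UNIV i n X j] assms by (simp add: rmat_def)
qed

lemma gram_of_factorization:
  fixes R :: "'k::finite sqmat"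
  assumes "orthonormal n UNIV Q" "\<And>j i. i < n \<Longrightarrow> X j i = (\<Sum>l\<in>UNIV. Q l i * R $ l $ j)"
  shows "ip n (Q l) (X j) = R $ l $ j" and "ip n (X a) (X b) = (\<Sum>i\<in>UNIV. R $ i $ a * R $ i $ b)"
proof -
  have X: "ip n y (X j) = (\<Sum>l\<in>UNIV. R $ l $ j * ip n y (Q l))" for y j
  proof -
    have "ip n y (X j) = ip n y (\<lambda>i. \<Sum>l\<in>UNIV. R $ l $ j * Q l i)"
      using assms(2) by (intro ip_cong) (auto simp: mult.commute)
    then show ?thesis
      by (simp add: ip_sum_right ip_scale_right)
  qed
  show QX: "ip n (Q l) (X j) = R $ l $ j" for l j
    unfolding X by (rule orthonormal_sum_ip[OF assms(1)]) auto
  show "ip n (X a) (X b) = (\<Sum>i\<in>UNIV. R $ i $ a * R $ i $ b)"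
    unfolding X by (simp add: ip_commute[of n "X a"] QX mult.commute)
qed

lemma rmat_diag_pos_iff: "gs_nondeg n UNIV X \<longleftrightarrow> (\<forall>j. 0 < rmat n X $ j $ j)"
  by (simp add: gs_nondeg_def rmat_def less_le)

lemma gram_rmat:
  assumes "gs_nondeg n UNIV X"
  shows "ip n (gs n UNIV X l) (X j) = rmat n X $ l $ j"
    and "ip n (X a) (X b) = (\<Sum>i\<in>UNIV. rmat n X $ i $ a * rmat n X $ i $ b)"
  using gram_of_factorization[OF orthonormal_gs[OF finite assms] rmat_decomposition] by blast+

section \<open>Existence and uniqueness of the factorization\<close>

text \<open>Both directions pass through \<open>rmat\<close>: in the nondegenerate case
  \<open>X c = 0\<close> gives \<open>R c = 0\<close>; conversely a zero diagonal entry makes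
  \<open>R\<close> singular.\<close>

lemma full_column_rank_iff: "full_column_rank n X \<longleftrightarrow> gs_nondeg n UNIV X"
  for X :: "'k::{finite,linorder} \<Rightarrow> nat \<Rightarrow> real"
proof
  assume nd: "gs_nondeg n UNIV X"
  obtain C where C: "C ** rmat n X = mat 1"
    using upper_triangular_inverse[OF rmat_upper_triangular, of n X] nd[unfolded rmat_diag_pos_iff] by blast
  show "full_column_rank n X"
    unfolding full_column_rank_def
  proof (intro allI impI)
    fix c :: "'k \<Rightarrow> real" and j assume c: "\<forall>i<n. (\<Sum>j\<in>UNIV. c j * X j i) = 0"
    have "(rmat n X *v (\<chi> j. c j)) $ l = 0" for l
    proof -
      have "(rmat n X *v (\<chi> j. c j)) $ l = ip n (gs n UNIV X l) (\<lambda>i. \<Sum>j\<in>UNIV. c j * X j i)"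
        by (simp add: matrix_vector_mult_def gram_rmat(1)[OF nd, symmetric] ip_sum_right ip_scale_right mult.commute)
      also have "\<dots> = ip n (gs n UNIV X l) (\<lambda>i. 0)"
        using c by (intro ip_cong) auto
      finally show ?thesis by (simp add: ip_def)
    qed
    then have "rmat n X *v (\<chi> j. c j) = 0"
      by (simp add: vec_eq_iff)
    then have "(\<chi> j. c j) = (0 :: (real, 'k) vec)"
      using C matrix_left_invertible_ker[of "rmat n X"] by blast
    then show "c j = 0"
      by (simp add: vec_eq_iff)
  qed
next
  assume fr: "full_column_rank n X"
  show "gs_nondeg n UNIV X"
  proof (rule ccontr)
    assume "\<not> gs_nondeg n UNIV X"
    then obtain j where "rmat n X $ j $ j = 0"
      by (auto simp: gs_nondeg_def rmat_def)
    then have "det (rmat n X) = 0"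
      unfolding det_upper_triangular[OF rmat_upper_triangular] by (intro prod_zero) auto
    then have "\<not> invertible (rmat n X)"
      by (simp add: invertible_det_nz)
    then have "\<not> (\<exists>B. B ** rmat n X = mat 1)"
      by (simp add: invertible_left_inverse)
    then obtain c where c: "rmat n X *v c = 0" "c \<noteq> 0"
      using matrix_left_invertible_ker[of "rmat n X"] by blast
    \<comment> \<open>The identity \<open>X = Q R\<close> also holds in the degenerate case, where
      \<open>Q\<close> need not be orthonormal, so the kernel of \<open>R\<close> is contained in
      that of \<open>X\<close>.\<close>
    have "(\<Sum>j\<in>UNIV. c $ j * X j i) = 0" if "i < n" for i
    proof -
      have "(\<Sum>j\<in>UNIV. c $ j * X j i) = (\<Sum>j\<in>UNIV. \<Sum>l\<in>UNIV. gs n UNIV X l i * (rmat n X $ l $ j * c $ j))"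
        by (simp add: rmat_decomposition[OF that, of X] sum_distrib_left mult_ac)
      also have "\<dots> = (\<Sum>l\<in>UNIV. gs n UNIV X l i * (rmat n X *v c) $ l)"
        by (subst sum.swap) (simp add: matrix_vector_mult_def sum_distrib_left)
      finally show ?thesis
        using c by simp
    qed
    then have "\<forall>j. c $ j = 0"
      using fr by (simp add: full_column_rank_def)
    then show False
      using c(2) by (simp add: vec_eq_iff)
  qed
qed

lemma is_qr_gs:
  assumes "gs_nondeg n UNIV X"
  shows "is_qr n X (gs n UNIV X, rmat n X)"
  using assms orthonormal_gs[OF finite assms] rmat_diag_pos_iff[of n X] rmat_decomposition
  by (auto simp: is_qr_def orthonormal_cols_iff rmat_upper_triangular)

text \<open>Both triangular factors are Cholesky factors of the Gram matrix of \<open>X\<close>,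
  hence equal; then \<open>Q = X R\<^sup>-\<^sup>1\<close> on the rows below \<open>n\<close>, and
  extensionality fixes the remaining values.\<close>

lemma is_qr_unique:
  fixes X :: "'k::{finite,linorder} \<Rightarrow> nat \<Rightarrow> real"
  assumes "is_qr n X (Q, R)" "is_qr n X (Q', R')"
  shows "(Q, R) = (Q', R')"
proof -
  have Q: "orthonormal n UNIV Q" "upper_triangular R" "\<And>j. 0 < R $ j $ j"
      "\<And>j i. i < n \<Longrightarrow> X j i = (\<Sum>l\<in>UNIV. Q l i * R $ l $ j)"
    and Q': "orthonormal n UNIV Q'" "upper_triangular R'" "\<And>j. 0 < R' $ j $ j"
      "\<And>j i. i < n \<Longrightarrow> X j i = (\<Sum>l\<in>UNIV. Q' l i * R' $ l $ j)"
    using assms by (auto simp: is_qr_def orthonormal_cols_iff)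
  have "transpose R ** R = transpose R' ** R'"
    using gram_of_factorization(2)[where X=X, OF Q(1,4)] gram_of_factorization(2)[where X=X, OF Q'(1,4)]
    by (simp add: vec_eq_iff matrix_matrix_mult_def transpose_def)
  then have R: "R = R'"
    using Q(2,3) Q'(2,3) by (intro cholesky_unique[of "transpose R ** R"]) (auto simp: is_right_cholesky_def)
  obtain C where C: "R ** C = mat 1"
    using upper_triangular_inverse[OF Q(2,3)] by blast
  have recover: "T m i = (\<Sum>j\<in>UNIV. X j i * C $ j $ m)"
    if "\<And>j. X j i = (\<Sum>l\<in>UNIV. T l i * R $ l $ j)" for T m i
  proof -
    have "(\<Sum>j\<in>UNIV. X j i * C $ j $ m) = (\<Sum>j\<in>UNIV. \<Sum>l\<in>UNIV. T l i * (R $ l $ j * C $ j $ m))"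
      by (simp add: that sum_distrib_right mult.assoc)
    also have "\<dots> = (\<Sum>l\<in>UNIV. T l i * (R ** C) $ l $ m)"
      by (subst sum.swap) (simp add: matrix_matrix_mult_def sum_distrib_left)
    also have "\<dots> = T m i"
      by (simp add: C mat_def if_distrib cong: if_cong)
    finally show ?thesis ..
  qed
  have "Q m i = Q' m i" for m i
  proof (cases "i < n")
    case True
    then show ?thesis
      using recover[of i Q m] recover[of i Q' m] Q(4) Q'(4) R by simp
  next
    case False
    then show ?thesis
      using Q(1) Q'(1) by (auto simp: orthonormal_def extensional_def)
  qed
  then show ?thesis
    using R by (auto simp: fun_eq_iff)
qed

lemma gram_schmidt_eq:
  "gram_schmidt n X = (if gs_nondeg n UNIV X then (gs n UNIV X, rmat n X) else (\<lambda>j. \<lambda>i\<in>{..<n}. 0, 0))"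
proof -
  have "(THE QR. is_qr n X QR) = (gs n UNIV X, rmat n X)" if "gs_nondeg n UNIV X"
    using is_qr_gs[OF that] is_qr_unique[of n X] by (intro the_equality) auto
  then show ?thesis
    by (simp add: gram_schmidt_def full_column_rank_iff)
qed

lemma borel_measurable_sqmat:
  fixes f :: "'a \<Rightarrow> 'k::finite sqmat"
  assumes "\<And>i j. (\<lambda>x. f x $ i $ j) \<in> borel_measurable N"
  shows "f \<in> borel_measurable N"
proof (subst borel_measurable_euclidean_space, rule ballI)
  fix b :: "'k sqmat" assume "b \<in> Basis"
  then obtain i j where "b = axis i (axis j 1)"
    by (auto simp: Basis_vec_def)
  then show "(\<lambda>x. f x \<bullet> b) \<in> borel_measurable N"
    using assms[of i j] by (simp add: inner_axis)
qed

lemma measurable_rmat: "rmat n \<in> borel_measurable (colmat_space n UNIV)"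
proof (rule borel_measurable_sqmat)
  fix i j :: 'a
  show "(\<lambda>X. rmat n X $ i $ j) \<in> borel_measurable (colmat_space n UNIV)"
    by (cases "i < j"; cases "i = j")
      (auto simp: rmat_def intro!: measurable_ip measurable_gs measurable_colmat_proj
        measurable_L2_set_gs_resid measurable_ident_sets)
qed

lemma gs_mulm:
  assumes "V \<in> orthogonal_group n"
  shows "gs n UNIV (mulm n UNIV V X) = mulm n UNIV V (gs n UNIV X)"
    and "rmat n (mulm n UNIV V X) = rmat n X"
proof -
  have m: "mulm n UNIV V X = (\<lambda>j. mulv n V (X j))" for X
    by (simp add: mulm_def fun_eq_iff)
  show "gs n UNIV (mulm n UNIV V X) = mulm n UNIV V (gs n UNIV X)"
    unfolding m by (rule ext) (rule gs_mulv[OF assms finite])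
  show "rmat n (mulm n UNIV V X) = rmat n X"
    unfolding m rmat_def gs_mulv[OF assms finite] gs_resid_mulv[OF assms finite]
    by (simp only: ip_mulv[OF assms] L2_set_mulv[OF assms])
qed

subsection \<open>Independence of the two factors under invariant laws\<close>

text \<open>Collects the facts on the law of \<open>X\<close> from which independence and the
  uniform law of the frame follow.\<close>

locale invariant_model =
  prob_space P for P :: "('k::{finite,linorder} \<Rightarrow> nat \<Rightarrow> real) measure" +
  fixes n :: nat
  assumes sets_P: "sets P = sets (colmat_space n UNIV)"
    and dim: "CARD('k) \<le> n"
    and invariant: "\<And>V B. V \<in> orthogonal_group n \<Longrightarrow> B \<in> sets (colmat_space n UNIV) \<Longrightarrow>
      emeasure P (mulm n UNIV V -` B \<inter> space (colmat_space n UNIV)) = emeasure P B"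
    and nondeg: "AE X in P. gs_nondeg n UNIV X"
begin

lemma space_P: "space P = space (colmat_space n UNIV)"
  using sets_eq_imp_space_eq[OF sets_P] .

lemma measurable_gs_P: "gs n UNIV \<in> measurable P (colmat_space n UNIV)"
proof -
  have "(\<lambda>X. \<lambda>j\<in>UNIV. gs n UNIV X j) \<in> measurable (colmat_space n (UNIV :: 'k set)) (colmat_space n UNIV)"
    by (subst (2) colmat_space_def) (intro measurable_restrict measurable_gs measurable_ident_sets, auto)
  then show ?thesis
    by (simp add: restrict_UNIV measurable_cong_sets[OF sets_P refl])
qed

lemma measurable_rmat_P: "rmat n \<in> borel_measurable P"
  using measurable_rmat by (simp only: measurable_cong_sets[OF sets_P refl])

text \<open>For fixed \<open>D\<close>, the law of the frame on the event that \<open>rmat\<close>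
  lies in \<open>D\<close> is a finite invariant measure, since rotations do not change
  \<open>rmat\<close>. It is therefore a multiple of the uniform law. The product form gives
  independence and uniformity together.\<close>

lemma joint_law:
  assumes haar: "is_haar_orthogonal n \<mu>" and B: "B \<in> sets (colmat_space n UNIV)" and D: "D \<in> sets borel"
  shows "emeasure P (gs n UNIV -` B \<inter> rmat n -` D \<inter> space P) =
    emeasure P (rmat n -` D \<inter> space P) * emeasure (distr \<mu> (colmat_space n UNIV) first_cols) B"
proof -
  let ?C = "colmat_space n (UNIV :: 'k set)"
  have Dm: "rmat n -` D \<inter> space P \<in> sets P"
    by (rule measurable_sets[OF measurable_rmat_P D])
  \<comment> \<open>\<open>P\<close> restricted to the event, without conditioning, so that an event
    of probability zero causes no division problem.\<close>
  define PD where "PD = density P (indicator (rmat n -` D \<inter> space P))"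
  have PD: "emeasure PD A = emeasure P (rmat n -` D \<inter> space P \<inter> A)" if "A \<in> sets P" for A
    using Dm that unfolding PD_def by (rule emeasure_restricted)
  have gsPD: "gs n UNIV \<in> measurable PD ?C"
    using measurable_gs_P by (simp add: PD_def cong: measurable_cong_sets)
  define \<nu> where "\<nu> = distr PD ?C (gs n UNIV)"
  have \<nu>: "emeasure \<nu> A = emeasure P (gs n UNIV -` A \<inter> rmat n -` D \<inter> space P)" if "A \<in> sets ?C" for A
  proof -
    have "emeasure \<nu> A = emeasure PD (gs n UNIV -` A \<inter> space P)"
      using emeasure_distr[OF gsPD that] by (simp add: \<nu>_def PD_def)
    also have "\<dots> = emeasure P (rmat n -` D \<inter> space P \<inter> (gs n UNIV -` A \<inter> space P))"
      by (intro PD measurable_sets[OF measurable_gs_P that])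
    finally show ?thesis
      by (simp add: Int_ac)
  qed
  have sets\<nu>: "sets \<nu> = sets ?C"
    by (simp add: \<nu>_def)
  have total: "emeasure \<nu> (space \<nu>) = emeasure P (rmat n -` D \<inter> space P)"
  proof -
    have "gs n UNIV -` space ?C \<inter> rmat n -` D \<inter> space P = rmat n -` D \<inter> space P"
      using measurable_space[OF measurable_gs_P] by auto
    then show ?thesis
      using \<nu>[OF sets.top] by (simp add: \<nu>_def)
  qed
  have "emeasure \<nu> B = emeasure \<nu> (space \<nu>) * emeasure \<mu> {U \<in> space \<mu>. first_cols (transp n U) \<in> B}"
  proof (rule invariant_measure_unique[OF haar dim _ sets\<nu> _ _ B])
    show "finite_measure \<nu>"
      by (rule finite_measureI) (simp add: total)
    have "AE X in P. orthonormal n UNIV (gs n UNIV X)"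
      using nondeg by eventually_elim (rule orthonormal_gs[OF finite])
    then have "AE X in PD. orthonormal n UNIV (gs n UNIV X)"
      unfolding PD_def using Dm by (subst AE_density) auto
    moreover have "{Q \<in> space ?C. orthonormal n UNIV Q} \<in> sets ?C"
      by (rule sets_orthonormal[OF finite])
    ultimately show "AE Q in \<nu>. orthonormal n UNIV Q"
      unfolding \<nu>_def by (subst AE_distr_iff[OF gsPD]) auto
    fix V A assume V: "V \<in> orthogonal_group n" and A: "A \<in> sets ?C"
    have mV: "mulm n UNIV V -` A \<inter> space ?C \<in> sets ?C"
      by (rule measurable_sets[OF measurable_mulm A])
    let ?E = "gs n UNIV -` A \<inter> rmat n -` D \<inter> space P"
    have "?E = (gs n UNIV -` A \<inter> space P) \<inter> (rmat n -` D \<inter> space P)"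
      by auto
    then have E: "?E \<in> sets ?C"
      using measurable_sets[OF measurable_gs_P A] Dm unfolding sets_P[symmetric] by auto
    have "gs n UNIV -` (mulm n UNIV V -` A \<inter> space ?C) \<inter> rmat n -` D \<inter> space P = mulm n UNIV V -` ?E \<inter> space ?C"
      using measurable_space[OF measurable_gs_P] by (auto simp: gs_mulm[OF V] space_P)
    then show "emeasure \<nu> (mulm n UNIV V -` A \<inter> space ?C) = emeasure \<nu> A"
      using invariant[OF V E] by (simp add: \<nu>[OF mV] \<nu>[OF A])
  qed
  then show ?thesis
    by (simp add: \<nu>[OF B] total emeasure_haar_first_cols[OF haar dim B])
qed

end

subsection \<open>The law of the triangular factor in the chart\<close>

text \<open>The inverse of the chart: column \<open>j\<close> has entries \<open>w j i\<close> above
  the diagonal, 1 on it, and is then scaled to unit length.\<close>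

definition chart_mat :: "('k::{finite,linorder} \<Rightarrow> 'k \<Rightarrow> real) \<Rightarrow> 'k sqmat" where
  "chart_mat w = (\<chi> i j. (if i < j then w j i else if i = j then 1 else 0) * chart_factor {..<j} (w j))"

lemma below_UNIV: "{l\<in>UNIV. l < j} = {..<j}"
  by auto

lemma chart_mat_upper_triangular: "upper_triangular (chart_mat w)"
  by (auto simp: upper_triangular_def chart_mat_def dest: less_asym)

lemma chart_mat_diag: "chart_mat w $ j $ j = chart_factor {..<j} (w j)"
  by (simp add: chart_mat_def)

lemma sum_upper_column:
  fixes j :: "'k::{finite,linorder}"
  shows "(\<Sum>i\<in>UNIV. (if i < j then v i else if i = j then 1 else 0)\<^sup>2) = 1 + (\<Sum>i<j. (v i)\<^sup>2 :: real)"
proof -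
  have "(\<Sum>i\<in>UNIV. (if i < j then v i else if i = j then 1 else 0)\<^sup>2) =
      1 + (\<Sum>i\<in>UNIV - {j}. (if i < j then v i else if i = j then 1 else 0)\<^sup>2)"
    by (subst sum.remove[of _ j]) auto
  also have "(\<Sum>i\<in>UNIV - {j}. (if i < j then v i else if i = j then 1 else 0)\<^sup>2) = (\<Sum>i<j. (v i)\<^sup>2)"
    by (rule sum.mono_neutral_cong_right) auto
  finally show ?thesis .
qed

lemma chart_factor_sq: "(chart_factor I v)\<^sup>2 * (1 + (\<Sum>i\<in>I. (v i)\<^sup>2)) = 1"
proof -
  have "0 < 1 + (\<Sum>i\<in>I. (v i)\<^sup>2)"
    by (simp add: add_pos_nonneg sum_nonneg)
  then show ?thesis
    by (simp add: chart_factor_def power_divide)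
qed

lemma chart_mat_unit_columns: "unit_columns (chart_mat w)"
  unfolding unit_columns_def
proof
  fix j
  have "(\<Sum>i\<in>UNIV. (chart_mat w $ i $ j)\<^sup>2) =
      (\<Sum>i\<in>UNIV. (if i < j then w j i else if i = j then 1 else 0)\<^sup>2) * (chart_factor {..<j} (w j))\<^sup>2"
    by (simp add: chart_mat_def power_mult_distrib sum_distrib_right)
  also have "\<dots> = 1"
    unfolding sum_upper_column by (subst mult.commute) (rule chart_factor_sq)
  finally show "(\<Sum>i\<in>UNIV. (chart_mat w $ i $ j)\<^sup>2) = 1" .
qed

lemma measurable_chart_mat: "chart_mat \<in> borel_measurable (chart_space UNIV)"
proof (rule borel_measurable_sqmat)
  fix i j :: 'a
  have wj: "(\<lambda>w. w j) \<in> measurable (chart_space UNIV) (\<Pi>\<^sub>M l\<in>{..<j}. borel)"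
    unfolding chart_space_def below_UNIV by (rule measurable_component_singleton) simp
  have fac: "(\<lambda>w. chart_factor {..<j} (w j)) \<in> borel_measurable (chart_space UNIV)"
    by (rule measurable_chart_factor[OF wj])
  have "(\<lambda>w. w j i) \<in> borel_measurable (chart_space UNIV)" if "i < j"
    using that by (intro measurable_comp_PiM[OF wj]) simp
  then show "(\<lambda>w. chart_mat w $ i $ j) \<in> borel_measurable (chart_space UNIV)"
    using fac by (cases "i < j"; cases "i = j") (auto simp: chart_mat_def)
qed

text \<open>The ratios determine a column up to its positive diagonal entry, and unit length
  determines that entry.\<close>

lemma chart_mat_eqI:
  assumes R: "upper_triangular R" "\<And>j. 0 < R $ j $ j" "unit_columns R"
    and w: "\<And>i j. i < j \<Longrightarrow> w j i = R $ i $ j / R $ j $ j"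
  shows "chart_mat w = R"
proof -
  have col: "R $ i $ j = (if i < j then w j i else if i = j then 1 else 0) * R $ j $ j" for i j
    using w[of i j] R(2)[of j] R(1)
    by (cases i j rule: linorder_cases) (auto simp: upper_triangular_def)
  have diag: "R $ j $ j = chart_factor {..<j} (w j)" for j
  proof -
    have "1 = (\<Sum>i\<in>UNIV. (R $ i $ j)\<^sup>2)"
      using R(3) by (simp add: unit_columns_def)
    also have "\<dots> = (\<Sum>i\<in>UNIV. (if i < j then w j i else if i = j then 1 else 0)\<^sup>2) * (R $ j $ j)\<^sup>2"
      by (subst col) (simp add: power_mult_distrib sum_distrib_right)
    also have "\<dots> = (1 + (\<Sum>i<j. (w j i)\<^sup>2)) * (R $ j $ j)\<^sup>2"
      by (simp only: sum_upper_column)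
    finally have s: "(1 + (\<Sum>i<j. (w j i)\<^sup>2)) * (R $ j $ j)\<^sup>2 = 1" ..
    have "(R $ j $ j)\<^sup>2 = (chart_factor {..<j} (w j))\<^sup>2 * (1 + (\<Sum>i<j. (w j i)\<^sup>2)) * (R $ j $ j)\<^sup>2"
      by (simp only: chart_factor_sq mult_1)
    also have "\<dots> = (chart_factor {..<j} (w j))\<^sup>2"
      by (simp only: mult.assoc s mult_1_right)
    finally show ?thesis
      using R(2)[of j] chart_factor_pos[of "{..<j}" "w j"] by (simp add: power2_eq_iff_nonneg)
  qed
  show ?thesis
    unfolding vec_eq_iff chart_mat_def using col diag by simp
qed

lemma rmat_eq_chart_mat:
  assumes nd: "gs_nondeg n UNIV X" and unit: "\<And>j. ip n (X j) (X j) = 1"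
  shows "rmat n X = chart_mat (gs_chart n UNIV X)"
proof (rule chart_mat_eqI[symmetric])
  show "0 < rmat n X $ j $ j" for j
    using nd by (simp add: rmat_diag_pos_iff)
  show "unit_columns (rmat n X)"
    using unit by (simp add: unit_columns_def gram_rmat(2)[OF nd] power2_eq_square)
  show "gs_chart n UNIV X j i = rmat n X $ i $ j / rmat n X $ j $ j" if "i < j" for i j
    using that by (simp add: gs_chart_def chart_coords_def gram_rmat(1)[OF nd])
      (simp add: rmat_def gs_resid_def)
qed (rule rmat_upper_triangular)

lemma AE_sphere_cols_unit:
  assumes "0 < n"
  shows "AE X in sphere_cols n (UNIV :: 'k::finite set). \<forall>j. ip n (X j) (X j) = 1"
proof -
  have "AE X in sphere_cols n (UNIV :: 'k set). ip n (X j) (X j) = 1" for j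
    by (rule AE_PiM_component[where P="\<lambda>x. ip n x x = 1"])
       (auto intro: prob_space_sphere_uniform AE_sphere_uniform_unit assms)
  then show ?thesis
    by (simp add: AE_all_countable)
qed

lemma nvector_weight_eq:
  fixes X :: "'k::{finite,linorder} \<Rightarrow> nat \<Rightarrow> real"
  assumes "gs_nondeg n UNIV X"
  shows "nvector_weight \<beta> A n X = exp (\<beta> * trace (A ** (transpose (rmat n X) ** rmat n X))) ^ n"
proof -
  have "(\<Sum>i\<in>UNIV. \<Sum>j\<in>UNIV. ip n (X i) (X j) * A $ i $ j) = trace (A ** (transpose (rmat n X) ** rmat n X))"
    by (simp add: trace_gram gram_rmat(2)[OF assms] mult.commute)
  then show ?thesis
    by (simp add: nvector_weight_def exp_of_nat_mult[symmetric] mult_ac)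
qed

text \<open>The unnormalized law of the triangular factor; its normalization appears only through
  the value at \<open>UNIV\<close>.\<close>

definition chart_integral :: "real \<Rightarrow> 'k::{finite,linorder} sqmat \<Rightarrow> nat \<Rightarrow> 'k sqmat set \<Rightarrow> ennreal" where
  "chart_integral \<beta> A n B =
     (\<integral>\<^sup>+w. indicator B (chart_mat w) * ennreal (rate \<beta> A (chart_mat w) ^ n) \<partial>chart_leb UNIV)"

lemma borel_measurable_trace_gram: "(\<lambda>R :: 'k sqmat. trace (A ** (transpose R ** R))) \<in> borel_measurable borel"
  for A :: "'k::finite sqmat"
  unfolding trace_gram by (intro borel_measurable_continuous_onI continuous_intros)

lemma measurable_nvector_weight:
  "nvector_weight \<beta> A n \<in> borel_measurable (colmat_space n (UNIV :: 'k::finite set))"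
proof -
  have [measurable]: "(\<lambda>X. ip n (X i) (X j)) \<in> borel_measurable (colmat_space n (UNIV :: 'k set))" for i j
    by (intro measurable_ip measurable_colmat_proj) auto
  show ?thesis
    unfolding nvector_weight_def[abs_def] by measurable
qed

lemma orthonormal_exists:
  assumes "finite I" "card I \<le> n"
  obtains q :: "'i \<Rightarrow> nat \<Rightarrow> real" where "orthonormal n I q"
proof -
  obtain h :: "'i \<Rightarrow> nat" where h: "inj_on h I" "h ` I \<subseteq> {..<n}"
    using obtain_embedding[OF assms] .
  have "orthonormal n ({} :: nat set) (\<lambda>_ _. 0)"
    by (simp add: orthonormal_def)
  then obtain W where "W \<in> orthogonal_group n"
    using orthonormal_extend[of n "{} :: nat set" _ id] by auto
  then have "orthonormal n I (\<lambda>i. W (h i))"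
    using h by (auto simp: orthonormal_cols_iff orthonormal_def inj_on_eq_iff image_subset_iff)
  then show thesis by (rule that)
qed

definition total_chart_mass :: "nat \<Rightarrow> 'k::{finite,linorder} itself \<Rightarrow> ennreal" where
  "total_chart_mass n _ = (\<Prod>j\<in>(UNIV :: 'k set). chart_mass n {..<j})"

lemma total_chart_mass_bounds:
  assumes "CARD('k::{finite,linorder}) \<le> n"
  shows "total_chart_mass n TYPE('k) \<noteq> 0" "total_chart_mass n TYPE('k) \<noteq> \<infinity>"
proof -
  have m: "chart_mass n {..<j} \<noteq> 0 \<and> chart_mass n {..<j} \<noteq> \<infinity>" for j :: 'k
  proof -
    have "card {..<j} < n"
      by (rule card_lessThan_linorder(1)[OF assms])
    then obtain q where q: "orthonormal n {..<j} q"
      using orthonormal_exists[of "{..<j}" n] by auto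
    show ?thesis
      using chart_mass_pos[OF q _ \<open>card {..<j} < n\<close>, of "\<lambda>_. 0"] chart_mass_finite[OF q _ \<open>card {..<j} < n\<close>, of "\<lambda>_. 0"]
      by simp
  qed
  then show "total_chart_mass n TYPE('k) \<noteq> 0" "total_chart_mass n TYPE('k) \<noteq> \<infinity>"
    by (auto simp: total_chart_mass_def ennreal_prod_eq_top)
qed

text \<open>The chart densities multiply to the \<open>n\<close>-th power of the diagonal product of
  \<open>R\<close>. Together with the weight, also an \<open>n\<close>-th power, this is exactly
  \<open>rate ^ n\<close>.\<close>

lemma nn_integral_rmat_weight:
  fixes A :: "'k::{finite,linorder} sqmat"
  assumes n: "CARD('k) \<le> n" and B: "B \<in> sets borel"
  shows "total_chart_mass n TYPE('k) *
      (\<integral>\<^sup>+X. indicator B (rmat n X) * ennreal (nvector_weight \<beta> A n X) \<partial>sphere_cols n UNIV) =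
    chart_integral \<beta> A n B"
proof -
  have n0: "0 < n"
    using n by (rule less_le_trans[rotated]) simp
  define g :: "'k sqmat \<Rightarrow> ennreal" where
    "g R = indicator B R * ennreal (exp (\<beta> * trace (A ** (transpose R ** R))) ^ n)" for R
  have g: "g \<in> borel_measurable borel"
    unfolding g_def using B borel_measurable_trace_gram[of A] by measurable
  have "(\<integral>\<^sup>+X. indicator B (rmat n X) * ennreal (nvector_weight \<beta> A n X) \<partial>sphere_cols n UNIV) =
      (\<integral>\<^sup>+X. g (chart_mat (gs_chart n UNIV X)) \<partial>sphere_cols n UNIV)"
  proof (rule nn_integral_cong_AE)
    have "AE X in sphere_cols n (UNIV :: 'k set). gs_nondeg n UNIV X"
      using n by (intro AE_sphere_cols_nondeg) auto
    then show "AE X in sphere_cols n UNIV. indicator B (rmat n X) * ennreal (nvector_weight \<beta> A n X) =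
        g (chart_mat (gs_chart n UNIV X))"
      using AE_sphere_cols_unit[OF n0]
    proof eventually_elim
      case (elim X)
      then have "rmat n X = chart_mat (gs_chart n UNIV X)"
        by (intro rmat_eq_chart_mat) auto
      then show ?case
        using elim by (simp add: g_def nvector_weight_eq)
    qed
  qed
  also have "total_chart_mass n TYPE('k) * \<dots> =
      (\<integral>\<^sup>+w. g (chart_mat w) * (\<Prod>j\<in>UNIV. ennreal (chart_factor {..<j} (w j) ^ n)) \<partial>chart_leb UNIV)"
    using nn_integral_gs_chart[of "UNIV :: 'k set" n "\<lambda>w. g (chart_mat w)"] n
      measurable_compose[OF measurable_chart_mat g]
    unfolding below_UNIV total_chart_mass_def by simp
  also have "\<dots> = chart_integral \<beta> A n B"
    unfolding chart_integral_def
  proof (rule nn_integral_cong)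
    fix w :: "'k \<Rightarrow> 'k \<Rightarrow> real"
    have "(\<Prod>j\<in>UNIV. ennreal (chart_factor {..<j} (w j) ^ n)) = ennreal ((\<Prod>j\<in>UNIV. chart_mat w $ j $ j) ^ n)"
      by (simp add: prod_ennreal chart_mat_diag prod_power_distrib less_imp_le[OF chart_factor_pos])
    then show "g (chart_mat w) * (\<Prod>j\<in>UNIV. ennreal (chart_factor {..<j} (w j) ^ n)) =
        indicator B (chart_mat w) * ennreal (rate \<beta> A (chart_mat w) ^ n)"
      by (simp add: g_def rate_def power_mult_distrib ennreal_mult' mult.assoc)
  qed
  finally show ?thesis .
qed

subsection \<open>The n-vector model\<close>

lemma abs_ip_unit_le:
  assumes "ip n x x = 1" "ip n y y = 1"
  shows "\<bar>ip n x y\<bar> \<le> 1"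
proof -
  have "0 \<le> (\<Sum>i<n. (x i - s * y i)\<^sup>2)" for s
    by (simp add: sum_nonneg)
  also have "(\<Sum>i<n. (x i - s * y i)\<^sup>2) = ip n x x - 2 * s * ip n x y + s\<^sup>2 * ip n y y" for s
    by (simp add: ip_def sum_distrib_left sum.distrib[symmetric] sum_subtractf[symmetric] power2_eq_square algebra_simps)
  finally have "0 \<le> 1 - 2 * s * ip n x y + s\<^sup>2" for s
    using assms by simp
  from this[of 1] this[of "- 1"] show ?thesis
    by (simp add: abs_le_iff)
qed

text \<open>Ensures that dividing by the partition function in \<open>nvector_model\<close> is
  meaningful: Cauchy-Schwarz bounds the weight almost surely, and a positive weight has a positive
  integral.\<close>

lemma sphere_cols_weight:
  fixes A :: "'k::{finite,linorder} sqmat"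
  assumes n: "0 < n"
  shows "integrable (sphere_cols n UNIV) (nvector_weight \<beta> A n)"
    and "0 < (\<integral>X. nvector_weight \<beta> A n X \<partial>sphere_cols n UNIV)"
    and "(\<integral>\<^sup>+X. ennreal (nvector_weight \<beta> A n X) \<partial>sphere_cols n UNIV) =
      ennreal (\<integral>X. nvector_weight \<beta> A n X \<partial>sphere_cols n UNIV)"
proof -
  interpret U: prob_space "sphere_cols n (UNIV :: 'k set)"
    by (rule prob_space_sphere_cols)
  have meas: "nvector_weight \<beta> A n \<in> borel_measurable (sphere_cols n UNIV)"
    using measurable_nvector_weight by (simp only: measurable_cong_sets[OF sets_sphere_cols refl])
  have pos: "0 < nvector_weight \<beta> A n X" for X
    by (simp add: nvector_weight_def)
  show int: "integrable (sphere_cols n UNIV) (nvector_weight \<beta> A n)"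
  proof (rule U.integrable_const_bound[OF _ meas])
    show "AE X in sphere_cols n UNIV. norm (nvector_weight \<beta> A n X) \<le>
        exp (\<bar>\<beta>\<bar> * real n * (\<Sum>i\<in>UNIV. \<Sum>j\<in>UNIV. \<bar>A $ i $ j\<bar>))"
      using AE_sphere_cols_unit[OF n]
    proof eventually_elim
      case (elim X)
      have "\<bar>\<Sum>i\<in>UNIV. \<Sum>j\<in>UNIV. ip n (X i) (X j) * A $ i $ j\<bar> \<le> (\<Sum>i\<in>UNIV. \<Sum>j\<in>UNIV. \<bar>ip n (X i) (X j) * A $ i $ j\<bar>)"
        by (intro order_trans[OF sum_abs] sum_mono sum_abs)
      also have "\<dots> \<le> (\<Sum>i\<in>UNIV. \<Sum>j\<in>UNIV. \<bar>A $ i $ j\<bar>)"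
        using elim abs_ip_unit_le by (intro sum_mono) (simp add: abs_mult mult_left_le_one_le)
      finally have "\<bar>\<beta> * real n * (\<Sum>i\<in>UNIV. \<Sum>j\<in>UNIV. ip n (X i) (X j) * A $ i $ j)\<bar> \<le>
          \<bar>\<beta>\<bar> * real n * (\<Sum>i\<in>UNIV. \<Sum>j\<in>UNIV. \<bar>A $ i $ j\<bar>)"
        by (simp add: abs_mult mult_left_mono)
      then show ?case
        by (simp add: nvector_weight_def abs_le_iff)
    qed
  qed
  show eq: "(\<integral>\<^sup>+X. ennreal (nvector_weight \<beta> A n X) \<partial>sphere_cols n UNIV) =
      ennreal (\<integral>X. nvector_weight \<beta> A n X \<partial>sphere_cols n UNIV)"
    using int pos by (intro nn_integral_eq_integral) (auto intro: less_imp_le)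
  have "(\<integral>\<^sup>+X. ennreal (nvector_weight \<beta> A n X) \<partial>sphere_cols n UNIV) \<noteq> 0"
  proof
    assume "(\<integral>\<^sup>+X. ennreal (nvector_weight \<beta> A n X) \<partial>sphere_cols n UNIV) = 0"
    then have "AE X in sphere_cols n UNIV. ennreal (nvector_weight \<beta> A n X) = 0"
      using meas by (subst (asm) nn_integral_0_iff_AE) auto
    then have "AE X in sphere_cols n (UNIV :: 'k set). False"
    proof eventually_elim
      case (elim X)
      then show ?case
        using pos[of X] by (simp add: ennreal_eq_0_iff)
    qed
    then show False by simp
  qed
  then show "0 < (\<integral>X. nvector_weight \<beta> A n X \<partial>sphere_cols n UNIV)"
    unfolding eq by (simp add: ennreal_eq_0_iff not_le)
qed

lemma sets_nvector_model: "sets (nvector_model \<beta> A n) = sets (colmat_space n UNIV)"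
  by (simp add: nvector_model_def Let_def sets_sphere_cols)

lemma emeasure_nvector_model:
  fixes A :: "'k::{finite,linorder} sqmat"
  assumes "0 < n" and B: "B \<in> sets (colmat_space n UNIV)"
  shows "emeasure (nvector_model \<beta> A n) B =
    (\<integral>\<^sup>+X. indicator B X * ennreal (nvector_weight \<beta> A n X) \<partial>sphere_cols n UNIV) /
    (\<integral>\<^sup>+X. ennreal (nvector_weight \<beta> A n X) \<partial>sphere_cols n UNIV)"
proof -
  let ?U = "sphere_cols n (UNIV :: 'k set)"
  define Z where "Z = (\<integral>X. nvector_weight \<beta> A n X \<partial>?U)"
  have Z: "0 < Z"
    unfolding Z_def by (rule sphere_cols_weight(2)[OF assms(1)])
  have meas: "nvector_weight \<beta> A n \<in> borel_measurable ?U"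
    using measurable_nvector_weight by (simp only: measurable_cong_sets[OF sets_sphere_cols refl])
  have B': "B \<in> sets ?U"
    using B by (simp add: sets_sphere_cols)
  have "emeasure (nvector_model \<beta> A n) B = (\<integral>\<^sup>+X. ennreal (nvector_weight \<beta> A n X / Z) * indicator B X \<partial>?U)"
    unfolding nvector_model_def Let_def Z_def[symmetric] using meas B' by (intro emeasure_density) auto
  also have "\<dots> = (\<integral>\<^sup>+X. indicator B X * ennreal (nvector_weight \<beta> A n X) / ennreal Z \<partial>?U)"
    using Z by (intro nn_integral_cong) (auto simp: indicator_def divide_ennreal nvector_weight_def)
  also have "\<dots> = (\<integral>\<^sup>+X. indicator B X * ennreal (nvector_weight \<beta> A n X) \<partial>?U) / ennreal Z"
    using meas B' by (intro nn_integral_divide) auto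
  finally show ?thesis
    by (simp add: sphere_cols_weight(3)[OF assms(1)] Z_def)
qed

lemma nvector_weight_mulm:
  "V \<in> orthogonal_group n \<Longrightarrow> nvector_weight \<beta> A n (mulm n UNIV V X) = nvector_weight \<beta> A n X"
  by (simp add: nvector_weight_def mulm_def ip_mulv)

lemma invariant_model_nvector:
  fixes A :: "'k::{finite,linorder} sqmat"
  assumes n: "CARD('k) \<le> n"
  shows "invariant_model (nvector_model \<beta> A n) n"
proof -
  let ?U = "sphere_cols n (UNIV :: 'k set)" and ?C = "colmat_space n (UNIV :: 'k set)"
  have n0: "0 < n"
    using n by (rule less_le_trans[rotated]) simp
  note Z = sphere_cols_weight(2,3)[OF n0, of \<beta> A]
  have space: "space (nvector_model \<beta> A n) = space ?C"
    using sets_eq_imp_space_eq[OF sets_nvector_model] .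
  have meas: "nvector_weight \<beta> A n \<in> borel_measurable ?U"
    using measurable_nvector_weight by (simp only: measurable_cong_sets[OF sets_sphere_cols refl])
  interpret prob_space "nvector_model \<beta> A n"
  proof
    have "(\<integral>\<^sup>+X. indicator (space ?C) X * ennreal (nvector_weight \<beta> A n X) \<partial>?U) =
        (\<integral>\<^sup>+X. ennreal (nvector_weight \<beta> A n X) \<partial>?U)"
      by (intro nn_integral_cong) (simp add: space_sphere_cols)
    then show "emeasure (nvector_model \<beta> A n) (space (nvector_model \<beta> A n)) = 1"
      using Z by (simp add: emeasure_nvector_model[OF n0] space ennreal_divide_self)
  qed
  show ?thesis
  proof unfold_locales
    show "sets (nvector_model \<beta> A n) = sets ?C"
      by (rule sets_nvector_model)
    show "CARD('k) \<le> n" by (rule n)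
    have "AE X in ?U. gs_nondeg n UNIV X"
      using n by (intro AE_sphere_cols_nondeg) auto
    then show "AE X in nvector_model \<beta> A n. gs_nondeg n UNIV X"
      unfolding nvector_model_def Let_def using meas by (subst AE_density) auto
    fix V B assume V: "V \<in> orthogonal_group n" and B: "B \<in> sets ?C"
    have mV: "mulm n UNIV V \<in> measurable ?U ?U"
      using measurable_mulm by (simp only: measurable_cong_sets[OF sets_sphere_cols sets_sphere_cols])
    have "(\<integral>\<^sup>+X. indicator (mulm n UNIV V -` B \<inter> space ?C) X * ennreal (nvector_weight \<beta> A n X) \<partial>?U) =
        (\<integral>\<^sup>+X. indicator B (mulm n UNIV V X) * ennreal (nvector_weight \<beta> A n (mulm n UNIV V X)) \<partial>?U)"
      by (intro nn_integral_cong) (auto simp: nvector_weight_mulm[OF V] indicator_def space_sphere_cols)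
    also have "\<dots> = (\<integral>\<^sup>+X. indicator B X * ennreal (nvector_weight \<beta> A n X) \<partial>distr ?U ?U (mulm n UNIV V))"
      using B meas by (intro nn_integral_distr[symmetric] mV) (simp add: sets_sphere_cols)
    also have "\<dots> = (\<integral>\<^sup>+X. indicator B X * ennreal (nvector_weight \<beta> A n X) \<partial>?U)"
      by (simp add: distr_sphere_cols_mulm[OF V])
    finally show "emeasure (nvector_model \<beta> A n) (mulm n UNIV V -` B \<inter> space ?C) = emeasure (nvector_model \<beta> A n) B"
      using B by (simp add: emeasure_nvector_model[OF n0] measurable_sets[OF measurable_mulm])
  qed
qed

text \<open>Chart masses and partition function cancel, so the law of \<open>rmat\<close> is a
  quotient of chart integrals, written without division. Finiteness comes from that of the same two
  constants.\<close>

lemma emeasure_nvector_model_rmat: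
  fixes A :: "'k::{finite,linorder} sqmat"
  assumes n: "CARD('k) \<le> n" and B: "B \<in> sets borel"
  shows "emeasure (nvector_model \<beta> A n) (rmat n -` B \<inter> space (colmat_space n UNIV)) * chart_integral \<beta> A n UNIV =
      chart_integral \<beta> A n B"
    and "chart_integral \<beta> A n UNIV \<noteq> \<infinity>"
proof -
  let ?U = "sphere_cols n (UNIV :: 'k set)" and ?m = "total_chart_mass n TYPE('k)"
  have n0: "0 < n"
    using n by (rule less_le_trans[rotated]) simp
  note Z = sphere_cols_weight(2,3)[OF n0, of \<beta> A]
  have total: "?m * (\<integral>\<^sup>+X. ennreal (nvector_weight \<beta> A n X) \<partial>?U) = chart_integral \<beta> A n UNIV"
    using nn_integral_rmat_weight[OF n, of UNIV \<beta> A] by simp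
  show "chart_integral \<beta> A n UNIV \<noteq> \<infinity>"
    unfolding total[symmetric] Z(2) using total_chart_mass_bounds[OF n] by (simp add: ennreal_mult_eq_top_iff)
  have S: "rmat n -` B \<inter> space (colmat_space n UNIV) \<in> sets (colmat_space n UNIV)"
    by (rule measurable_sets[OF measurable_rmat B])
  have "(\<integral>\<^sup>+X. indicator (rmat n -` B \<inter> space (colmat_space n UNIV)) X * ennreal (nvector_weight \<beta> A n X) \<partial>?U) =
      (\<integral>\<^sup>+X. indicator B (rmat n X) * ennreal (nvector_weight \<beta> A n X) \<partial>?U)" (is "?l = ?r")
    by (intro nn_integral_cong) (auto simp: indicator_def space_sphere_cols)
  then have "emeasure (nvector_model \<beta> A n) (rmat n -` B \<inter> space (colmat_space n UNIV)) * chart_integral \<beta> A n UNIV =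
      ?r / ennreal (\<integral>X. nvector_weight \<beta> A n X \<partial>?U) * (?m * ennreal (\<integral>X. nvector_weight \<beta> A n X \<partial>?U))"
    by (simp add: emeasure_nvector_model[OF n0 S] total[symmetric] Z(2))
  also have "\<dots> = ?m * ?r"
    using Z(1) by (subst ennreal_divide_times, subst ennreal_mult_divide_eq) (auto simp: mult.commute)
  also have "\<dots> = chart_integral \<beta> A n B"
    by (rule nn_integral_rmat_weight[OF n B])
  finally show "emeasure (nvector_model \<beta> A n) (rmat n -` B \<inter> space (colmat_space n UNIV)) * chart_integral \<beta> A n UNIV =
      chart_integral \<beta> A n B" .
qed

subsection \<open>Concentration of the triangular factor\<close>

text \<open>One unit of the constant 2 is due to the change of the vector, the other to the change
  of its norm. The columns normalized in the chart have an entry 1, hence norm at least 1.\<close>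

lemma normalize_lipschitz:
  fixes a b :: "'a::real_normed_vector"
  assumes "a \<noteq> 0" "1 \<le> norm b"
  shows "norm (a /\<^sub>R norm a - b /\<^sub>R norm b) \<le> 2 * norm (a - b)"
proof -
  have b: "0 < norm b"
    using assms(2) by linarith
  have a: "0 < norm a"
    using assms(1) by simp
  have "a /\<^sub>R norm a - b /\<^sub>R norm b = (a - b) /\<^sub>R norm b + (inverse (norm a) - inverse (norm b)) *\<^sub>R a"
    by (simp add: algebra_simps)
  also have "norm \<dots> \<le> norm ((a - b) /\<^sub>R norm b) + norm ((inverse (norm a) - inverse (norm b)) *\<^sub>R a)"
    by (rule norm_triangle_ineq)
  also have "norm ((inverse (norm a) - inverse (norm b)) *\<^sub>R a) = \<bar>norm b - norm a\<bar> / norm b"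
  proof -
    have "inverse (norm a) - inverse (norm b) = (norm b - norm a) / (norm a * norm b)"
      using a b by (simp add: field_simps)
    then show ?thesis
      using a b by (simp add: abs_mult)
  qed
  also have "norm ((a - b) /\<^sub>R norm b) = norm (a - b) / norm b"
    by (simp add: divide_inverse_commute)
  also have "norm (a - b) / norm b + \<bar>norm b - norm a\<bar> / norm b \<le> norm (a - b) / norm b + norm (a - b) / norm b"
    using norm_triangle_ineq3[of b a]
    by (intro add_left_mono divide_right_mono) (simp_all add: norm_minus_commute)
  also have "\<dots> \<le> 2 * norm (a - b)"
  proof -
    have "norm (a - b) / norm b \<le> norm (a - b) / 1"
      using assms(2) by (intro divide_left_mono) auto
    then show ?thesis by simp
  qed
  finally show ?thesis .
qed

text \<open>A crude count: an entry moves by at most \<open>2 k e\<close>, from the sum norm of a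
  column, and there are \<open>k\<^sup>2\<close> entries.\<close>

lemma chart_mat_lipschitz:
  fixes w v :: "'k::{finite,linorder} \<Rightarrow> 'k \<Rightarrow> real"
  assumes "0 \<le> e" "\<And>i j. i < j \<Longrightarrow> \<bar>w j i - v j i\<bar> \<le> e"
  shows "norm (chart_mat w - chart_mat v) \<le> 2 * real CARD('k) ^ 3 * e"
proof -
  define y :: "('k \<Rightarrow> 'k \<Rightarrow> real) \<Rightarrow> 'k \<Rightarrow> (real, 'k) vec" where
    "y u j = (\<chi> i. if i < j then u j i else if i = j then 1 else 0)" for u j
  have ny: "norm (y u j) = sqrt (1 + (\<Sum>i<j. (u j i)\<^sup>2))" for u j
    by (simp add: norm_vec_def L2_set_def y_def sum_upper_column)
  have ny1: "1 \<le> norm (y u j)" for u j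
    by (simp add: ny sum_nonneg)
  have cm: "chart_mat u $ i $ j = (y u j /\<^sub>R norm (y u j)) $ i" for u i j
    unfolding ny vector_scaleR_component by (simp add: chart_mat_def chart_factor_def y_def divide_inverse)
  have entry: "\<bar>chart_mat w $ i $ j - chart_mat v $ i $ j\<bar> \<le> 2 * real CARD('k) * e" for i j
  proof -
    have "\<bar>chart_mat w $ i $ j - chart_mat v $ i $ j\<bar> = \<bar>(y w j /\<^sub>R norm (y w j) - y v j /\<^sub>R norm (y v j)) $ i\<bar>"
      by (simp only: cm vector_minus_component)
    also have "\<dots> \<le> norm (y w j /\<^sub>R norm (y w j) - y v j /\<^sub>R norm (y v j))"
      by (rule component_le_norm_cart)
    also have "\<dots> \<le> 2 * norm (y w j - y v j)"
      using ny1[of w j] ny1[of v j] by (intro normalize_lipschitz) auto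
    also have "norm (y w j - y v j) \<le> (\<Sum>l\<in>UNIV. \<bar>(y w j - y v j) $ l\<bar>)"
      by (rule norm_le_l1_cart)
    also have "\<dots> \<le> (\<Sum>l\<in>(UNIV :: 'k set). e)"
      using assms by (intro sum_mono) (auto simp: y_def)
    finally show ?thesis by simp
  qed
  have "norm (chart_mat w - chart_mat v) \<le> (\<Sum>i\<in>UNIV. norm ((chart_mat w - chart_mat v) $ i))"
    unfolding norm_vec_def[of "chart_mat w - chart_mat v"] by (rule L2_set_le_sum) auto
  also have "\<dots> \<le> (\<Sum>i\<in>UNIV. \<Sum>j\<in>UNIV. \<bar>(chart_mat w - chart_mat v) $ i $ j\<bar>)"
    by (intro sum_mono norm_le_l1_cart)
  also have "\<dots> \<le> (\<Sum>i\<in>(UNIV :: 'k set). \<Sum>j\<in>(UNIV :: 'k set). 2 * real CARD('k) * e)"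
    using entry by (intro sum_mono) simp
  also have "\<dots> = 2 * real CARD('k) ^ 3 * e"
    by (simp add: power3_eq_cube)
  finally show ?thesis .
qed

lemma emeasure_chart_leb_cell:
  fixes v :: "'k::{finite,linorder} \<Rightarrow> 'k \<Rightarrow> real"
  assumes "0 \<le> e"
  defines "cell \<equiv> \<Pi>\<^sub>E j\<in>UNIV. \<Pi>\<^sub>E i\<in>{..<j}. {v j i - e..v j i + e}"
  shows "emeasure (chart_leb UNIV) cell = ennreal ((2 * e) ^ (\<Sum>j\<in>(UNIV :: 'k set). card {..<j}))"
    and "cell \<in> sets (chart_leb UNIV)"
proof -
  interpret product_sigma_finite "\<lambda>j::'k. lebprod {..<j}"
    using product_sigma_finite_lebprod[of "UNIV :: 'k set"] unfolding below_UNIV by simp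
  have cell_j: "(\<Pi>\<^sub>E i\<in>{..<j}. {v j i - e..v j i + e}) \<in> sets (lebprod {..<j})" for j
    by (intro sets_PiM_I_finite) auto
  have "emeasure (chart_leb UNIV) cell = (\<Prod>j\<in>UNIV. emeasure (lebprod {..<j}) (\<Pi>\<^sub>E i\<in>{..<j}. {v j i - e..v j i + e}))"
    unfolding chart_leb_def below_UNIV cell_def by (intro emeasure_PiM cell_j finite)
  also have "\<dots> = (\<Prod>j\<in>(UNIV :: 'k set). ennreal ((2 * e) ^ card {..<j}))"
  proof (rule prod.cong[OF refl])
    show "emeasure (lebprod {..<j}) (\<Pi>\<^sub>E i\<in>{..<j}. {v j i - e..v j i + e}) = ennreal ((2 * e) ^ card {..<j})" for j
      using emeasure_lebprod_cube[of "{..<j}" "\<lambda>_. e" "v j"] assms(1) by simp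
  qed
  also have "\<dots> = ennreal (\<Prod>j\<in>(UNIV :: 'k set). (2 * e) ^ card {..<j})"
    using assms(1) by (intro prod_ennreal) auto
  finally show "emeasure (chart_leb UNIV) cell = ennreal ((2 * e) ^ (\<Sum>j\<in>(UNIV :: 'k set). card {..<j}))"
    by (simp add: power_sum)
  show "cell \<in> sets (chart_leb UNIV)"
    unfolding chart_leb_def below_UNIV cell_def by (intro sets_PiM_I_finite cell_j finite)
qed

lemma matrix_sub_rdistrib: "(A - B) ** C = A ** C - B ** C" for A B :: "real^'n^'m"
  by (simp add: vec_eq_iff matrix_matrix_mult_def left_diff_distrib sum_subtractf)

lemma matrix_mult_right_bounded:
  fixes S :: "'k::finite sqmat"
  obtains K where "0 < K" "\<And>M :: 'k sqmat. norm (M ** S) \<le> K * norm M"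
proof -
  have "linear (\<lambda>M :: 'k sqmat. M ** S)"
    by (intro linearI)
      (simp_all add: vec_eq_iff matrix_matrix_mult_def distrib_right sum.distrib sum_distrib_left mult.assoc)
  then show thesis
    using linear_bounded_pos[of "\<lambda>M :: 'k sqmat. M ** S"] that by auto
qed

text \<open>Laplace's method with explicit bounds: the chart integral over the tail is bounded
  above, the one over everything below, and their quotient is the probability.\<close>

lemma rmat_deviation:
  fixes A R C :: "'k::{finite,linorder} sqmat"
  assumes R: "upper_triangular R" "\<And>i. 0 < R $ i $ i" "unit_columns R"
    and C: "upper_triangular C" "\<And>i. 0 < C $ i $ i" "R ** C = mat 1" "C ** R = mat 1"
    and rate: "\<And>T. upper_triangular T \<Longrightarrow> unit_columns T \<Longrightarrow> rate \<beta> A T = rate \<beta> A R * tri_weight (T ** C)"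
  shows "\<exists>(K::real) (c::real) (p::nat) (N::nat). 0 < c \<and> (\<forall>n\<ge>N. \<forall>d\<ge>0.
      measure (nvector_model \<beta> A n) (rmat n -` {T. d \<le> norm (T - R)} \<inter> space (colmat_space n UNIV))
        \<le> K * real n ^ p * exp (- c * real (n - CARD('k)) * d\<^sup>2))"
proof -
  define G where "G = rate \<beta> A R"
  have G: "0 < G"
    unfolding G_def rate_def using R(2) by (intro mult_pos_pos prod_pos) auto
  obtain K1 where K1: "0 < K1" "\<And>M :: 'k sqmat. norm (M ** R) \<le> K1 * norm M"
    using matrix_mult_right_bounded[of R] by blast
  obtain K2 where K2: "0 < K2" "\<And>M :: 'k sqmat. norm (M ** C) \<le> K2 * norm M"
    using matrix_mult_right_bounded[of C] by blast
  \<comment> \<open>For \<open>M = T ** C\<close> one has \<open>T - R = (M - 1) R\<close>, so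
    distance \<open>d\<close> from \<open>R\<close> forces \<open>|M - 1| \<ge> d / K1\<close>, and
    the exponent in \<open>tri_weight_upper\<close> becomes \<open>c d\<^sup>2\<close>.\<close>
  define c where "c = 1 / (2 * K1\<^sup>2)"
  have c: "0 < c"
    using K1(1) by (simp add: c_def)
  have rate_nonneg: "0 \<le> rate \<beta> A (chart_mat w)" for w
    unfolding rate_def chart_mat_diag by (intro mult_nonneg_nonneg prod_nonneg) (auto intro: less_imp_le chart_factor_pos)
  have upper: "rate \<beta> A (chart_mat w) \<le> G * exp (- c * d\<^sup>2)" if d: "0 \<le> d" "d \<le> norm (chart_mat w - R)" for w d
  proof -
    let ?T = "chart_mat w"
    let ?M = "?T ** C"
    have diag: "0 \<le> ?M $ i $ i" for i
      using C(2)[of i] chart_factor_pos[of "{..<i}" "w i"]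
      by (simp add: upper_triangular_mult(2)[OF chart_mat_upper_triangular C(1)] chart_mat_diag)
    have "?T - R = (?M - mat 1) ** R"
      by (simp add: matrix_sub_rdistrib matrix_mul_assoc[symmetric] C(4))
    then have "d \<le> K1 * norm (?M - mat 1)"
      using K1(2)[of "?M - mat 1"] d(2) by simp
    then have "d\<^sup>2 \<le> (K1 * norm (?M - mat 1))\<^sup>2"
      using d(1) by (rule power_mono)
    then have "c * d\<^sup>2 \<le> (norm (?M - mat 1))\<^sup>2 / 2"
      using K1(1) by (simp add: c_def power_mult_distrib field_simps)
    then have "exp (- (norm (?M - mat 1))\<^sup>2 / 2) \<le> exp (- c * d\<^sup>2)"
      by simp
    then have "tri_weight ?M \<le> exp (- c * d\<^sup>2)"
      using tri_weight_upper[OF diag] by linarith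
    then show ?thesis
      unfolding rate[OF chart_mat_upper_triangular chart_mat_unit_columns] G_def[symmetric]
      using G by (simp add: mult_left_mono)
  qed
  \<comment> \<open>The chart coordinates of the optimum.\<close>
  define v where "v j i = R $ i $ j / R $ j $ j" for i j
  have v: "chart_mat v = R"
    by (intro chart_mat_eqI R) (simp add: v_def)
  define L where "L = K2 * (2 * real CARD('k) ^ 3)"
  have L: "0 \<le> L"
    using K2(1) by (simp add: L_def)
  have lower: "G * exp (- 3 * (L * e)\<^sup>2) \<le> rate \<beta> A (chart_mat w)"
    if "0 \<le> e" "\<And>i j. i < j \<Longrightarrow> \<bar>w j i - v j i\<bar> \<le> e" "L * e \<le> 1 / 2" for w e
  proof -
    let ?T = "chart_mat w"
    let ?M = "?T ** C"
    have "?M - mat 1 = (?T - R) ** C"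
      by (simp add: matrix_sub_rdistrib C(3))
    then have "norm (?M - mat 1) \<le> K2 * norm (?T - R)"
      using K2(2)[of "?T - R"] by simp
    also have "\<dots> \<le> K2 * (2 * real CARD('k) ^ 3 * e)"
      using chart_mat_lipschitz[of e w v, OF that(1,2)] K2(1) by (intro mult_left_mono) (auto simp: v)
    finally have le: "norm (?M - mat 1) \<le> L * e"
      by (simp add: L_def mult.assoc)
    then have "(norm (?M - mat 1))\<^sup>2 \<le> (L * e)\<^sup>2"
      by (rule power_mono) simp
    then have "exp (- 3 * (L * e)\<^sup>2) \<le> exp (- 3 * (norm (?M - mat 1))\<^sup>2)"
      by simp
    also have "\<dots> \<le> tri_weight ?M"
      using le that(3) by (intro tri_weight_lower) linarith
    finally show ?thesis
      unfolding rate[OF chart_mat_upper_triangular chart_mat_unit_columns] G_def[symmetric]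
      using G by (simp add: mult_left_mono)
  qed
  \<comment> \<open>The dimension of the chart, which governs the volume of the cell below.\<close>
  define p where "p = (\<Sum>j\<in>(UNIV :: 'k set). card {..<j})"
  define k where "k = CARD('k)"
  \<comment> \<open>From here on \<open>L / n \<le> 1 / 2\<close>, the range in which
    \<open>tri_weight_lower\<close> applies.\<close>
  define N where "N = max (CARD('k)) (nat \<lceil>2 * L\<rceil> + 1)"
  define I where "I = enn2real (chart_integral \<beta> A k UNIV)"
  \<comment> \<open>The model lemmas are used here at the boundary dimension
    \<open>n = CARD('k)\<close>: they make \<open>rate ^ k\<close> integrable over the
    chart.\<close>
  have I: "chart_integral \<beta> A k UNIV = ennreal I"
    using emeasure_nvector_model_rmat(2)[where n=k and \<beta>=\<beta> and A=A and B=UNIV] by (simp add: I_def k_def less_top)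
  have I0: "0 \<le> I"
    by (simp add: I_def)
  \<comment> \<open>Lower bound on the cell of half side \<open>1 / n\<close> around
    \<open>v\<close>, times its volume. At this size \<open>n\<close> times the squared deviation
    stays bounded, so relative to \<open>G ^ n\<close> only the volume factor decays.\<close>
  define lo where "lo n = (G * exp (- 3 * (L / real n)\<^sup>2)) ^ n * (2 / real n) ^ p" for n
  have total_lower: "ennreal (lo n) \<le> chart_integral \<beta> A n UNIV" if n: "N \<le> n" for n
  proof -
    have n0: "0 < real n"
      using n by (simp add: N_def)
    have "2 * L \<le> real n"
      using n by (simp add: N_def) linarith
    then have Ln: "L * (1 / real n) \<le> 1 / 2"
      using n0 by (simp add: field_simps)
    define cell where "cell = (\<Pi>\<^sub>E j\<in>UNIV. \<Pi>\<^sub>E i\<in>{..<j}. {v j i - 1 / real n..v j i + 1 / real n})"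
    have cell: "emeasure (chart_leb UNIV) cell = ennreal ((2 / real n) ^ p)" "cell \<in> sets (chart_leb UNIV)"
      using emeasure_chart_leb_cell[of "1 / real n" v] by (simp_all add: cell_def p_def)
    have "ennreal (lo n) = (\<integral>\<^sup>+w. ennreal ((G * exp (- 3 * (L / real n)\<^sup>2)) ^ n) * indicator cell w \<partial>chart_leb UNIV)"
      using cell G by (simp add: lo_def nn_integral_cmult_indicator ennreal_mult')
    also have "\<dots> \<le> chart_integral \<beta> A n UNIV"
      unfolding chart_integral_def
    proof (rule nn_integral_mono)
      fix w :: "'k \<Rightarrow> 'k \<Rightarrow> real"
      have "(G * exp (- 3 * (L / real n)\<^sup>2)) ^ n \<le> rate \<beta> A (chart_mat w) ^ n" if w: "w \<in> cell"
      proof (rule power_mono)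
        have "\<bar>w j i - v j i\<bar> \<le> 1 / real n" if "i < j" for i j
        proof -
          have "w j \<in> (\<Pi>\<^sub>E i\<in>{..<j}. {v j i - 1 / real n..v j i + 1 / real n})"
            using w by (auto simp: cell_def)
          then have "w j i \<in> {v j i - 1 / real n..v j i + 1 / real n}"
            using that by (auto simp: PiE_iff)
          then show ?thesis by (auto simp: abs_le_iff)
        qed
        then show "G * exp (- 3 * (L / real n)\<^sup>2) \<le> rate \<beta> A (chart_mat w)"
          using lower[of "1 / real n" w] Ln by simp
        show "0 \<le> G * exp (- 3 * (L / real n)\<^sup>2)"
          using G by simp
      qed
      then show "ennreal ((G * exp (- 3 * (L / real n)\<^sup>2)) ^ n) * indicator cell w
          \<le> indicator UNIV (chart_mat w) * ennreal (rate \<beta> A (chart_mat w) ^ n)"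
        by (auto simp: indicator_def intro: ennreal_leI)
    qed
    finally show ?thesis .
  qed
  \<comment> \<open>Only \<open>n - k\<close> factors are estimated by the tail bound; the other
    \<open>k\<close> are left inside the integral, which they keep finite.\<close>
  have far_upper: "chart_integral \<beta> A n {T. d \<le> norm (T - R)} \<le> ennreal ((G * exp (- c * d\<^sup>2)) ^ (n - k) * I)"
    if n: "k \<le> n" and d: "0 \<le> d" for n d
  proof -
    have "chart_integral \<beta> A n {T. d \<le> norm (T - R)} \<le>
      (\<integral>\<^sup>+w. ennreal ((G * exp (- c * d\<^sup>2)) ^ (n - k)) * (indicator UNIV (chart_mat w) * ennreal (rate \<beta> A (chart_mat w) ^ k)) \<partial>chart_leb UNIV)"
      unfolding chart_integral_def
    proof (rule nn_integral_mono)
      fix w :: "'k \<Rightarrow> 'k \<Rightarrow> real"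
      have "rate \<beta> A (chart_mat w) ^ n \<le> (G * exp (- c * d\<^sup>2)) ^ (n - k) * rate \<beta> A (chart_mat w) ^ k"
        if "d \<le> norm (chart_mat w - R)"
      proof -
        have "rate \<beta> A (chart_mat w) ^ n = rate \<beta> A (chart_mat w) ^ (n - k) * rate \<beta> A (chart_mat w) ^ k"
          using n by (simp add: power_add[symmetric])
        also have "\<dots> \<le> (G * exp (- c * d\<^sup>2)) ^ (n - k) * rate \<beta> A (chart_mat w) ^ k"
          using upper[OF d that] rate_nonneg[of w] by (intro mult_right_mono power_mono) auto
        finally show ?thesis .
      qed
      then show "indicator {T. d \<le> norm (T - R)} (chart_mat w) * ennreal (rate \<beta> A (chart_mat w) ^ n) \<le>
        ennreal ((G * exp (- c * d\<^sup>2)) ^ (n - k)) * (indicator UNIV (chart_mat w) * ennreal (rate \<beta> A (chart_mat w) ^ k))"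
        using G rate_nonneg[of w] by (auto simp: indicator_def ennreal_mult[symmetric] intro: ennreal_leI)
    qed
    also have "\<dots> = ennreal ((G * exp (- c * d\<^sup>2)) ^ (n - k)) * chart_integral \<beta> A k UNIV"
      unfolding chart_integral_def
    proof (rule nn_integral_cmult)
      have "rate \<beta> A \<in> borel_measurable borel"
        unfolding rate_def trace_gram by (intro borel_measurable_continuous_onI continuous_intros)
      then have [measurable]: "(\<lambda>w. rate \<beta> A (chart_mat w)) \<in> borel_measurable (chart_space UNIV)"
        by (rule measurable_compose[OF measurable_chart_mat])
      have "(\<lambda>w. indicator UNIV (chart_mat w) * ennreal (rate \<beta> A (chart_mat w) ^ k)) \<in> borel_measurable (chart_space UNIV)"
        by (simp only: indicator_UNIV mult_1) measurable
      then show "(\<lambda>w. indicator UNIV (chart_mat w) * ennreal (rate \<beta> A (chart_mat w) ^ k)) \<in> borel_measurable (chart_leb UNIV)"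
        by (simp only: measurable_cong_sets[OF sets_chart_leb refl])
    qed
    also have "\<dots> = ennreal ((G * exp (- c * d\<^sup>2)) ^ (n - k) * I)"
      using G I0 by (simp add: I ennreal_mult)
    finally show ?thesis .
  qed
  \<comment> \<open>What remains of the quotient apart from the power of \<open>n\<close> and the
    exponential: \<open>exp (3 * L\<^sup>2)\<close> covers the variation over the cell,
    \<open>2 ^ p\<close> its volume, \<open>G ^ k\<close> the factors kept in
    \<open>I\<close>.\<close>
  define K where "K = I * exp (3 * L\<^sup>2) / (G ^ k * 2 ^ p)"
  show ?thesis
  proof (rule exI[of _ K], rule exI[of _ c], rule exI[of _ p], rule exI[of _ N], intro conjI c allI impI)
    fix n d assume n: "N \<le> n" and d: "(0::real) \<le> d"
    have kn: "k \<le> n" and n0: "0 < real n"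
      using n by (simp_all add: N_def k_def)
    interpret invariant_model "nvector_model \<beta> A n" n
      using kn by (intro invariant_model_nvector) (simp add: k_def)
    let ?F = "{T :: 'k sqmat. d \<le> norm (T - R)}"
    define x where "x = measure (nvector_model \<beta> A n) (rmat n -` ?F \<inter> space (colmat_space n UNIV))"
    have x0: "0 \<le> x" by (simp add: x_def)
    have F: "?F \<in> sets borel"
    proof -
      have "closed ?F"
        by (intro closed_Collect_le continuous_intros)
      then show ?thesis by (rule borel_closed)
    qed
    have "ennreal (x * lo n) = ennreal x * ennreal (lo n)"
      using x0 by (simp add: ennreal_mult')
    also have "\<dots> \<le> ennreal x * chart_integral \<beta> A n UNIV"
      by (intro mult_left_mono total_lower n) simp
    also have "\<dots> = chart_integral \<beta> A n ?F"
      using emeasure_nvector_model_rmat(1)[where n=n and \<beta>=\<beta> and A=A and B="?F"] kn F by (simp add: x_def emeasure_eq_measure k_def)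
    also have "\<dots> \<le> ennreal ((G * exp (- c * d\<^sup>2)) ^ (n - k) * I)"
      by (rule far_upper[OF kn d])
    finally have "x * lo n \<le> (G * exp (- c * d\<^sup>2)) ^ (n - k) * I"
      using G I0 by (subst (asm) ennreal_le_iff) auto
    moreover have "G ^ n * exp (- 3 * L\<^sup>2) * (2 / real n) ^ p \<le> lo n"
    proof -
      have "exp (- 3 * (L / real n)\<^sup>2) ^ n = exp (- 3 * L\<^sup>2 / real n)"
        using n0 by (simp add: exp_of_nat_mult[symmetric] power_divide power2_eq_square)
      moreover have "3 * L\<^sup>2 / real n \<le> 3 * L\<^sup>2 / 1"
        using n0 by (intro divide_left_mono) auto
      ultimately have "exp (- 3 * L\<^sup>2) \<le> exp (- 3 * (L / real n)\<^sup>2) ^ n"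
        by simp
      then show ?thesis
        using G n0 by (simp add: lo_def power_mult_distrib mult_left_mono mult_right_mono)
    qed
    ultimately have "x * (G ^ n * exp (- 3 * L\<^sup>2) * (2 / real n) ^ p) \<le> (G * exp (- c * d\<^sup>2)) ^ (n - k) * I"
      using x0 by (meson mult_left_mono order_trans)
    moreover have "(G * exp (- c * d\<^sup>2)) ^ (n - k) * I =
       (K * real n ^ p * exp (- c * real (n - k) * d\<^sup>2)) * (G ^ n * exp (- 3 * L\<^sup>2) * (2 / real n) ^ p)"
    proof -
      have "(G * exp (- c * d\<^sup>2)) ^ (n - k) = G ^ (n - k) * exp (- c * real (n - k) * d\<^sup>2)"
        by (simp add: power_mult_distrib exp_of_nat_mult[symmetric] mult_ac)
      moreover have "G ^ n = G ^ (n - k) * G ^ k"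
        using kn by (simp add: power_add[symmetric])
      moreover have "exp (3 * L\<^sup>2) * exp (- 3 * L\<^sup>2) = 1"
        by (simp add: exp_add[symmetric])
      ultimately show ?thesis
        using G n0 by (simp add: K_def power_divide field_simps exp_minus)
    qed
    ultimately have "x \<le> K * real n ^ p * exp (- c * real (n - k) * d\<^sup>2)"
      using G n0 by (simp add: mult_le_cancel_right) 
    then show "measure (nvector_model \<beta> A n) (rmat n -` ?F \<inter> space (colmat_space n UNIV))
        \<le> K * real n ^ p * exp (- c * real (n - CARD('k)) * d\<^sup>2)"
      by (simp add: x_def k_def)
  qed
qed

subsection \<open>Realizations of the model\<close>

text \<open>The situation of the theorem for a single fixed \<open>n\<close>.\<close>

locale model_realization =
  prob_space N for N :: "'a measure" +
  fixes n :: nat and A :: "'k::{finite,linorder} sqmat" and \<beta> :: real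
    and X Q :: "'a \<Rightarrow> 'k \<Rightarrow> nat \<Rightarrow> real" and R :: "'a \<Rightarrow> 'k sqmat"
  assumes dim: "CARD('k) \<le> n"
    and X_meas: "X \<in> measurable N (colmat_space n UNIV)"
    and X_law: "distr N (colmat_space n UNIV) X = nvector_model \<beta> A n"
    and QR: "\<And>\<omega>. \<omega> \<in> space N \<Longrightarrow> (Q \<omega>, R \<omega>) = gram_schmidt n (X \<omega>)"
begin

sublocale model: invariant_model "nvector_model \<beta> A n" n
  by (rule invariant_model_nvector[OF dim])

lemma AE_nondeg: "AE \<omega> in N. gs_nondeg n UNIV (X \<omega>)"
proof -
  have "AE x in distr N (colmat_space n UNIV) X. gs_nondeg n UNIV x"
    unfolding X_law by (rule model.nondeg)
  then show ?thesis
    by (rule AE_distrD[OF X_meas])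
qed

lemma QR_eq:
  assumes "\<omega> \<in> space N"
  shows "Q \<omega> = (if gs_nondeg n UNIV (X \<omega>) then gs n UNIV (X \<omega>) else (\<lambda>j. \<lambda>i\<in>{..<n}. 0))"
    and "R \<omega> = (if gs_nondeg n UNIV (X \<omega>) then rmat n (X \<omega>) else 0)"
  using QR[OF assms] by (auto simp: gram_schmidt_eq split: if_splits)

lemma AE_QR_eq: "AE \<omega> in N. Q \<omega> = gs n UNIV (X \<omega>) \<and> R \<omega> = rmat n (X \<omega>)"
  using AE_nondeg AE_space by eventually_elim (simp add: QR_eq)

lemma AE_qr: "AE \<omega> in N. full_column_rank n (X \<omega>) \<and> is_qr n (X \<omega>) (Q \<omega>, R \<omega>)"
  using AE_nondeg AE_QR_eq by eventually_elim (simp add: full_column_rank_iff is_qr_gs)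

lemma measurable_Q: "Q \<in> measurable N (colmat_space n UNIV)"
proof -
  have "gs n UNIV \<in> measurable (colmat_space n (UNIV :: 'k set)) (colmat_space n UNIV)"
    using model.measurable_gs_P by (simp only: measurable_cong_sets[OF model.sets_P refl])
  from measurable_compose[OF X_meas this]
  have "(\<lambda>\<omega>. if gs_nondeg n UNIV (X \<omega>) then gs n UNIV (X \<omega>) else (\<lambda>j. \<lambda>i\<in>{..<n}. 0)) \<in> measurable N (colmat_space n UNIV)"
    using pred_gs_nondeg[OF X_meas finite]
    by (intro measurable_If measurable_const) (auto simp: space_colmat pred_def)
  then show ?thesis
    using QR_eq(1) by (subst measurable_cong) auto
qed

lemma measurable_R: "R \<in> borel_measurable N"
proof -
  have "(\<lambda>\<omega>. if gs_nondeg n UNIV (X \<omega>) then rmat n (X \<omega>) else 0) \<in> borel_measurable N"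
    using pred_gs_nondeg[OF X_meas finite] measurable_compose[OF X_meas measurable_rmat]
    by (intro measurable_If measurable_const) (auto simp: pred_def)
  then show ?thesis
    using QR_eq(2) by (subst measurable_cong) auto
qed

text \<open>Almost everywhere \<open>Q\<close> and \<open>R\<close> are the functions
  \<open>gs\<close> and \<open>rmat\<close> of \<open>X\<close>; the default value of
  \<open>gram_schmidt\<close> is taken only on a null set.\<close>

lemma emeasure_QR:
  assumes B: "B \<in> sets (colmat_space n UNIV)" and D: "D \<in> sets borel"
  shows "emeasure N (Q -` B \<inter> R -` D \<inter> space N) =
    emeasure (nvector_model \<beta> A n) (gs n UNIV -` B \<inter> rmat n -` D \<inter> space (colmat_space n UNIV))"
proof -
  let ?S = "gs n UNIV -` B \<inter> rmat n -` D \<inter> space (colmat_space n (UNIV :: 'k set))"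
  have "gs n UNIV -` B \<inter> space (colmat_space n (UNIV :: 'k set)) \<in> sets (colmat_space n UNIV)"
    using measurable_sets[OF model.measurable_gs_P B] by (simp add: model.sets_P model.space_P)
  moreover have "rmat n -` D \<inter> space (colmat_space n (UNIV :: 'k set)) \<in> sets (colmat_space n UNIV)"
    by (rule measurable_sets[OF measurable_rmat D])
  ultimately have "(gs n UNIV -` B \<inter> space (colmat_space n (UNIV :: 'k set))) \<inter>
      (rmat n -` D \<inter> space (colmat_space n (UNIV :: 'k set))) \<in> sets (colmat_space n UNIV)"
    by (rule sets.Int)
  also have "(gs n UNIV -` B \<inter> space (colmat_space n (UNIV :: 'k set))) \<inter>
      (rmat n -` D \<inter> space (colmat_space n (UNIV :: 'k set))) = ?S"
    by auto
  finally have S: "?S \<in> sets (colmat_space n UNIV)" .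
  have "Q -` B \<inter> space N \<inter> (R -` D \<inter> space N) \<in> sets N"
    by (intro sets.Int measurable_sets[OF measurable_Q B] measurable_sets[OF measurable_R D])
  also have "Q -` B \<inter> space N \<inter> (R -` D \<inter> space N) = Q -` B \<inter> R -` D \<inter> space N"
    by auto
  finally have E: "Q -` B \<inter> R -` D \<inter> space N \<in> sets N" .
  have "emeasure N (Q -` B \<inter> R -` D \<inter> space N) = emeasure N (X -` ?S \<inter> space N)"
  proof (rule emeasure_eq_AE)
    show "AE \<omega> in N. \<omega> \<in> Q -` B \<inter> R -` D \<inter> space N \<longleftrightarrow> \<omega> \<in> X -` ?S \<inter> space N"
      using AE_QR_eq AE_space
    proof eventually_elim
      case (elim \<omega>)
      then show ?case
        using measurable_space[OF X_meas] by auto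
    qed
    show "Q -` B \<inter> R -` D \<inter> space N \<in> sets N"
      by (rule E)
    show "X -` ?S \<inter> space N \<in> sets N"
      by (rule measurable_sets[OF X_meas S])
  qed
  also have "\<dots> = emeasure (distr N (colmat_space n UNIV) X) ?S"
    by (rule emeasure_distr[OF X_meas S, symmetric])
  finally show ?thesis
    by (simp add: X_law)
qed

text \<open>The pair version of \<open>joint_law\<close> on the underlying space. Taking the whole
  space for \<open>D\<close> gives the law of \<open>Q\<close>, and substituting that law gives
  independence.\<close>

lemma prob_QR:
  assumes haar: "is_haar_orthogonal n \<mu>" and B: "B \<in> sets (colmat_space n UNIV)" and D: "D \<in> sets borel"
  shows "emeasure N (Q -` B \<inter> R -` D \<inter> space N) =
      emeasure N (R -` D \<inter> space N) * emeasure (distr \<mu> (colmat_space n UNIV) first_cols) B"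
proof -
  have R: "Q -` space (colmat_space n UNIV) \<inter> R -` D \<inter> space N = R -` D \<inter> space N"
    using measurable_space[OF measurable_Q] by auto
  have rm: "gs n UNIV -` space (colmat_space n UNIV) \<inter> rmat n -` D \<inter> space (colmat_space n (UNIV :: 'k set)) =
      rmat n -` D \<inter> space (colmat_space n UNIV)"
    using measurable_space[OF model.measurable_gs_P] by (auto simp: model.space_P)
  show ?thesis
    using model.joint_law[OF haar B D] emeasure_QR[OF sets.top D]
    by (simp add: emeasure_QR[OF B D] R rm model.space_P)
qed

lemma emeasure_Q:
  assumes haar: "is_haar_orthogonal n \<mu>" and B: "B \<in> sets (colmat_space n UNIV)"
  shows "emeasure N (Q -` B \<inter> space N) = emeasure (distr \<mu> (colmat_space n UNIV) first_cols) B"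
  using prob_QR[OF haar B, of UNIV] by (simp add: emeasure_space_1)

lemma distr_Q:
  assumes haar: "is_haar_orthogonal n \<mu>"
  shows "distr N (colmat_space n UNIV) Q = distr \<mu> (colmat_space n UNIV) first_cols"
  by (rule measure_eqI) (simp_all add: emeasure_distr[OF measurable_Q] emeasure_Q[OF haar])

text \<open>Preimages of a sigma-algebra form a sigma-algebra, so independence can be checked on
  preimages directly.\<close>

lemma sigma_sets_preimages:
  assumes "f \<in> measurable N S"
  shows "sigma_sets (space N) {f -` B \<inter> space N | B. B \<in> sets S} = {f -` B \<inter> space N | B. B \<in> sets S}"
  using sets_vimage_algebra[of "space N" f S] sets_vimage_algebra2[of f "space N" S] measurable_space[OF assms]
  by auto

lemma indep_QR: "indep_rvs N (colmat_space n UNIV) Q borel R"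
proof -
  obtain \<mu> where haar: "is_haar_orthogonal n \<mu>"
    using haar_exists by blast
  have "indep_set {Q -` B \<inter> space N | B. B \<in> sets (colmat_space n UNIV)} {R -` B \<inter> space N | B. B \<in> sets borel}"
  proof (rule indep_setI)
    show "{Q -` B \<inter> space N | B. B \<in> sets (colmat_space n UNIV)} \<subseteq> events"
      using measurable_sets[OF measurable_Q] by auto
    show "{R -` B \<inter> space N | B. B \<in> sets borel} \<subseteq> events"
      using measurable_sets[OF measurable_R] by auto
    fix a b assume "a \<in> {Q -` B \<inter> space N | B. B \<in> sets (colmat_space n UNIV)}"
      "b \<in> {R -` B \<inter> space N | B. B \<in> sets borel}"
    then obtain B D where B: "a = Q -` B \<inter> space N" "B \<in> sets (colmat_space n UNIV)"
      and D: "b = R -` D \<inter> space N" "D \<in> sets borel"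
      by blast
    have "a \<inter> b = Q -` B \<inter> R -` D \<inter> space N"
      by (auto simp: B D)
    then have "emeasure N (a \<inter> b) = emeasure N b * emeasure N a"
      using prob_QR[OF haar B(2) D(2)] emeasure_Q[OF haar B(2)] by (simp add: B(1) D(1))
    then show "prob (a \<inter> b) = prob a * prob b"
      by (simp add: measure_def enn2real_mult mult.commute)
  qed
  then show ?thesis
    unfolding indep_rvs_def sigma_sets_preimages[OF measurable_Q] sigma_sets_preimages[OF measurable_R]
    using measurable_Q measurable_R by simp
qed

lemma prob_R_far:
  assumes D: "D \<in> sets borel"
  shows "prob {\<omega> \<in> space N. R \<omega> \<in> D} = measure (nvector_model \<beta> A n) (rmat n -` D \<inter> space (colmat_space n UNIV))"
proof -
  have "Q -` space (colmat_space n UNIV) \<inter> R -` D \<inter> space N = {\<omega> \<in> space N. R \<omega> \<in> D}"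
    using measurable_space[OF measurable_Q] by auto
  moreover have "gs n UNIV -` space (colmat_space n UNIV) \<inter> rmat n -` D \<inter> space (colmat_space n (UNIV :: 'k set)) =
      rmat n -` D \<inter> space (colmat_space n UNIV)"
    using measurable_space[OF model.measurable_gs_P] by (auto simp: model.space_P)
  ultimately show ?thesis
    using emeasure_QR[OF sets.top D] by (simp add: measure_def)
qed

end

section \<open>From the tail bound to limits\<close>

text \<open>The squared radius times \<open>n\<close> is \<open>n powr (2 * b)\<close>, and the
  exponential of a negative multiple of a positive power of \<open>n\<close> absorbs every
  polynomial.\<close>

lemma exponential_beats_polynomial:
  fixes K c b :: real
  assumes "0 < c" "0 < b"
  shows "(\<lambda>n. K * real n ^ p * exp (- c * real (n - k) * (real n powr (- 1 / 2 + b))\<^sup>2)) \<longlonglongrightarrow> 0"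
proof -
  have "(\<lambda>n. \<bar>K\<bar> * real n powr real p * exp (- (c / 2) * real n powr (2 * b))) \<longlonglongrightarrow> 0"
    using assms by (intro filterlim_compose[OF _ filterlim_real_sequentially, of "\<lambda>x. \<bar>K\<bar> * x powr real p * exp (- (c / 2) * x powr (2 * b))"]) real_asymp
  then show ?thesis
  proof (rule Lim_null_comparison[rotated])
    show "\<forall>\<^sub>F n in sequentially. norm (K * real n ^ p * exp (- c * real (n - k) * (real n powr (- 1 / 2 + b))\<^sup>2))
        \<le> \<bar>K\<bar> * real n powr real p * exp (- (c / 2) * real n powr (2 * b))"
      \<comment> \<open>From here on \<open>n - k\<close> is at least \<open>n / 2\<close>, which is
        where \<open>c / 2\<close> in the comparison comes from.\<close>
      using eventually_ge_at_top[of "2 * k + 1"]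
    proof eventually_elim
      case (elim n)
      then have n: "0 < real n" "real n / 2 \<le> real (n - k)"
        by auto
      have sq: "(real n powr (- 1 / 2 + b))\<^sup>2 = real n powr (- 1 + 2 * b)"
        by (simp add: power2_eq_square powr_add[symmetric])
      have "real n powr (1 + (- 1 + 2 * b)) = real n * real n powr (- 1 + 2 * b)"
        unfolding powr_add[of "real n" 1] using n(1) by simp
      then have "real n powr (2 * b) / 2 = real n / 2 * real n powr (- 1 + 2 * b)"
        by simp
      also have "\<dots> \<le> real (n - k) * real n powr (- 1 + 2 * b)"
        using n(2) by (intro mult_right_mono) auto
      finally have "c * (real n powr (2 * b) / 2) \<le> c * (real (n - k) * real n powr (- 1 + 2 * b))"
        using assms(1) by (intro mult_left_mono) auto
      then have "exp (- c * real (n - k) * (real n powr (- 1 / 2 + b))\<^sup>2) \<le> exp (- (c / 2) * real n powr (2 * b))"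
        unfolding sq by (simp add: mult.assoc)
      then show ?case
        using n(1) by (simp add: abs_mult powr_realpow mult_left_mono)
    qed
  qed
qed

text \<open>Splits the expectation by the distance of \<open>Y\<close> to \<open>y\<close>: nearby
  the error is at most \<open>e\<close>, elsewhere at most \<open>2 * B\<close>.\<close>

lemma (in prob_space) expectation_near_constant:
  fixes f :: "'b::{metric_space, second_countable_topology} \<Rightarrow> real"
  assumes Y: "Y \<in> borel_measurable M" and f: "continuous_on UNIV f" "\<And>x. \<bar>f x\<bar> \<le> B"
    and near: "\<And>x. dist x y < d \<Longrightarrow> \<bar>f x - f y\<bar> \<le> e" and e: "0 \<le> e"
  shows "\<bar>(\<integral>\<omega>. f (Y \<omega>) \<partial>M) - f y\<bar> \<le> e + 2 * B * prob {\<omega> \<in> space M. d \<le> dist (Y \<omega>) y}"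
proof -
  have B: "0 \<le> B"
    using f(2)[of y] by linarith
  have [measurable]: "(\<lambda>\<omega>. f (Y \<omega>)) \<in> borel_measurable M"
    using Y borel_measurable_continuous_onI[OF f(1)] by (rule measurable_compose)
  have [measurable]: "(\<lambda>\<omega>. dist (Y \<omega>) y) \<in> borel_measurable M"
    using Y by measurable
  let ?S = "{\<omega> \<in> space M. d \<le> dist (Y \<omega>) y}"
  have S: "?S \<in> events"
    by measurable
  have int: "integrable M (\<lambda>\<omega>. f (Y \<omega>))"
    using f(2) by (intro integrable_const_bound[of _ B]) auto
  have "(\<integral>\<omega>. f (Y \<omega>) \<partial>M) - f y = (\<integral>\<omega>. f (Y \<omega>) - f y \<partial>M)"
    using int by (simp add: prob_space)
  also have "\<bar>\<dots>\<bar> \<le> (\<integral>\<omega>. \<bar>f (Y \<omega>) - f y\<bar> \<partial>M)"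
    by (rule integral_abs_bound)
  also have "\<dots> \<le> (\<integral>\<omega>. e + 2 * B * indicator ?S \<omega> \<partial>M)"
  proof (rule integral_mono)
    show "integrable M (\<lambda>\<omega>. \<bar>f (Y \<omega>) - f y\<bar>)"
      using int by simp
    show "integrable M (\<lambda>\<omega>. e + 2 * B * indicator ?S \<omega>)"
      using S by (intro Bochner_Integration.integrable_add integrable_mult_right) (auto simp: emeasure_eq_measure)
    fix \<omega> assume \<omega>: "\<omega> \<in> space M"
    show "\<bar>f (Y \<omega>) - f y\<bar> \<le> e + 2 * B * indicator ?S \<omega>"
    proof (cases "\<omega> \<in> ?S")
      case True
      then show ?thesis
        using f(2)[of "Y \<omega>"] f(2)[of y] e by (simp add: abs_le_iff)
    next
      case False
      then show ?thesis
        using near[of "Y \<omega>"] \<omega> by simp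
    qed
  qed
  also have "\<dots> = e + 2 * B * prob ?S"
    using S by (simp add: prob_space emeasure_eq_measure)
  finally show ?thesis .
qed

theorem theorem1:
  fixes A :: "'k::{finite,linorder} sqmat" and \<beta> :: real
    and M :: "nat \<Rightarrow> 'a measure"
    and X :: "nat \<Rightarrow> 'a \<Rightarrow> 'k \<Rightarrow> nat \<Rightarrow> real"
    and Q :: "nat \<Rightarrow> 'a \<Rightarrow> 'k \<Rightarrow> nat \<Rightarrow> real"
    and R :: "nat \<Rightarrow> 'a \<Rightarrow> 'k sqmat"
  assumes A_sym: "transpose A = A"
    and beta_pos: "0 < \<beta>"
    and prob: "\<And>n. CARD('k) < n \<Longrightarrow> prob_space (M n)"
    and X_meas: "\<And>n. CARD('k) < n \<Longrightarrow> X n \<in> measurable (M n) (colmat_space n UNIV)"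
    and X_law: "\<And>n. CARD('k) < n \<Longrightarrow>
                  distr (M n) (colmat_space n UNIV) (X n) = nvector_model \<beta> A n"
    and QR: "\<And>n \<omega>. CARD('k) < n \<Longrightarrow> \<omega> \<in> space (M n) \<Longrightarrow>
               (Q n \<omega>, R n \<omega>) = gram_schmidt n (X n \<omega>)"
  shows
    "(\<forall>n > CARD('k). AE \<omega> in M n.
        full_column_rank n (X n \<omega>) \<and> is_qr n (X n \<omega>) (Q n \<omega>, R n \<omega>)) \<and>
     (\<forall>n > CARD('k). indep_rvs (M n) (colmat_space n UNIV) (Q n) borel (R n)) \<and>
     (\<forall>n > CARD('k). (\<exists>\<mu>. is_haar_orthogonal n \<mu>) \<and>
        (\<forall>\<mu>. is_haar_orthogonal n \<mu> \<longrightarrow>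
           distr (M n) (colmat_space n UNIV) (Q n) =
           distr \<mu> (colmat_space n UNIV) first_cols)) \<and>
     (\<exists>Rstar :: 'k sqmat.
        upper_triangular Rstar \<and>
        converges_weakly (\<lambda>n. distr (M n) borel (R n)) (return borel Rstar) \<and>
        (\<forall>b::real. 0 < b \<and> b < 1 / 2 \<longrightarrow>
           (\<lambda>n. measure (M n) {\<omega> \<in> space (M n). norm (R n \<omega> - Rstar) < real n powr (- 1 / 2 + b)})
             \<longlonglongrightarrow> 1) \<and>
        (\<exists>Sstar :: 'k sqmat.
           (\<forall>S. is_optimal \<beta> A S \<longleftrightarrow> S = Sstar) \<and>
           (\<forall>R'. is_right_cholesky Sstar R' \<longleftrightarrow> R' = Rstar)))"
proof -
  have model: "model_realization (M n) n A \<beta> (X n) (Q n) (R n)" if n: "CARD('k) < n" for n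
    using prob[OF n] X_meas[OF n] X_law[OF n] QR[OF n] n
    by (intro model_realization.intro model_realization_axioms.intro) auto
  obtain T C where T: "upper_triangular T" "\<And>i. 0 < T $ i $ i" "unit_columns T"
    and C: "upper_triangular C" "\<And>i. 0 < C $ i $ i" "T ** C = mat 1" "C ** T = mat 1"
    and rate: "\<And>U. upper_triangular U \<Longrightarrow> unit_columns U \<Longrightarrow> rate \<beta> A U = rate \<beta> A T * tri_weight (U ** C)"
    using optimal_triangular[OF A_sym, of \<beta>] by blast
  have "\<exists>(K::real) (c::real) (p::nat) (N::nat). 0 < c \<and> (\<forall>n\<ge>N. \<forall>d\<ge>0.
      measure (nvector_model \<beta> A n) (rmat n -` {U. d \<le> norm (U - T)} \<inter> space (colmat_space n UNIV))
        \<le> K * real n ^ p * exp (- c * real (n - CARD('k)) * d\<^sup>2))"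
    using rate by (intro rmat_deviation[OF T C])
  then obtain K c :: real and p N :: nat where c: "0 < c" and
    dev0: "\<forall>n\<ge>N. \<forall>d\<ge>0.
      measure (nvector_model \<beta> A n) (rmat n -` {U. d \<le> norm (U - T)} \<inter> space (colmat_space n UNIV))
        \<le> K * real n ^ p * exp (- c * real (n - CARD('k)) * d\<^sup>2)"
    by blast
  note dev = dev0[rule_format]
  \<comment> \<open>The complement of the event in the statement, which is what the tail bound
    controls.\<close>
  define far where "far n d = measure (M n) {\<omega> \<in> space (M n). d \<le> norm (R n \<omega> - T)}" for n d
  have far_tendsto: "(\<lambda>n. far n (real n powr (- 1 / 2 + b))) \<longlonglongrightarrow> 0" if b: "0 < b" for b
  proof (rule Lim_null_comparison[OF _ exponential_beats_polynomial[OF c b, of K p "CARD('k)"]])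
    show "\<forall>\<^sub>F n in sequentially. norm (far n (real n powr (- 1 / 2 + b)))
        \<le> K * real n ^ p * exp (- c * real (n - CARD('k)) * (real n powr (- 1 / 2 + b))\<^sup>2)"
      \<comment> \<open>\<open>M n\<close> is a probability space carrying the model only for
        \<open>n > CARD('k)\<close>, so each limit is taken along such \<open>n\<close>.\<close>
      using eventually_ge_at_top[of "max N (CARD('k) + 1)"]
    proof eventually_elim
      case (elim n)
      then interpret model_realization "M n" n A \<beta> "X n" "Q n" "R n"
        by (intro model) simp
      let ?d = "real n powr (- 1 / 2 + b)"
      have "closed {U. ?d \<le> norm (U - T)}"
        by (intro closed_Collect_le continuous_intros)
      from prob_R_far[OF borel_closed[OF this]] show ?case
        using dev[of n ?d] elim by (simp add: far_def)
    qed
  qed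
  have conc: "(\<lambda>n. measure (M n) {\<omega> \<in> space (M n). norm (R n \<omega> - T) < real n powr (- 1 / 2 + b)}) \<longlonglongrightarrow> 1"
    if b: "0 < b" for b
  proof (rule Lim_transform_eventually)
    show "(\<lambda>n. 1 - far n (real n powr (- 1 / 2 + b))) \<longlonglongrightarrow> 1"
      using tendsto_diff[OF tendsto_const far_tendsto[OF b], of 1] by simp
    show "\<forall>\<^sub>F n in sequentially. 1 - far n (real n powr (- 1 / 2 + b)) =
        measure (M n) {\<omega> \<in> space (M n). norm (R n \<omega> - T) < real n powr (- 1 / 2 + b)}"
      using eventually_ge_at_top[of "CARD('k) + 1"]
    proof eventually_elim
      case (elim n)
      then interpret model_realization "M n" n A \<beta> "X n" "Q n" "R n"
        by (intro model) simp
      let ?d = "real n powr (- 1 / 2 + b)"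
      note [measurable] = measurable_R
      have "{\<omega> \<in> space (M n). ?d \<le> norm (R n \<omega> - T)} \<in> events"
        by measurable
      from prob_compl[OF this] have "1 - far n ?d = prob (space (M n) - {\<omega> \<in> space (M n). ?d \<le> norm (R n \<omega> - T)})"
        by (simp add: far_def)
      also have "space (M n) - {\<omega> \<in> space (M n). ?d \<le> norm (R n \<omega> - T)} = {\<omega> \<in> space (M n). norm (R n \<omega> - T) < ?d}"
        by auto
      finally show ?case .
    qed
  qed
  have far_const: "(\<lambda>n. far n d) \<longlonglongrightarrow> 0" if d: "0 < d" for d
  \<comment> \<open>Any \<open>b\<close> between 0 and 1/2 serves: a radius tending to 0 is
    eventually smaller than \<open>d\<close>, and its tail event contains that of
    \<open>d\<close>.\<close>
  proof (rule Lim_null_comparison[OF _ far_tendsto[of "1 / 4"]])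
    have "(\<lambda>n. real n powr (- 1 / 2 + 1 / 4)) \<longlonglongrightarrow> 0"
      by real_asymp
    then have "\<forall>\<^sub>F n in sequentially. real n powr (- 1 / 2 + 1 / 4) < d"
      using d by (rule order_tendstoD)
    then show "\<forall>\<^sub>F n in sequentially. norm (far n d) \<le> far n (real n powr (- 1 / 2 + 1 / 4))"
      using eventually_ge_at_top[of "CARD('k) + 1"]
    proof eventually_elim
      case (elim n)
      then interpret model_realization "M n" n A \<beta> "X n" "Q n" "R n"
        by (intro model) simp
      note [measurable] = measurable_R
      show ?case
        using elim unfolding far_def by (simp, intro finite_measure_mono) auto
    qed
  qed simp
  have weak: "converges_weakly (\<lambda>n. distr (M n) borel (R n)) (return borel T)"
    unfolding converges_weakly_def
  proof (intro allI impI)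
    fix f :: "'k sqmat \<Rightarrow> real" assume f: "continuous_on UNIV f \<and> bounded (range f)"
    then obtain B where B: "\<And>x. \<bar>f x\<bar> \<le> B"
      by (auto simp: bounded_iff)
    have fm: "f \<in> borel_measurable borel"
      using f by (intro borel_measurable_continuous_onI) simp
    have "(\<lambda>n. \<integral>x. f x \<partial>distr (M n) borel (R n)) \<longlonglongrightarrow> f T"
    proof (rule tendstoI)
      fix e :: real assume e: "0 < e"
      \<comment> \<open>Continuity at the limit point handles values of \<open>R n\<close> near
        \<open>T\<close>; boundedness of \<open>f\<close> handles the rest, whose probability tends
        to 0.\<close>
      have "isCont f T"
        using f by (simp add: continuous_on_eq_continuous_at)
      then obtain d where d: "0 < d" "\<And>x. dist x T < d \<Longrightarrow> dist (f x) (f T) < e / 2"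
        using e by (metis continuous_at_eps_delta half_gt_zero)
      have "(\<lambda>n. e / 2 + 2 * B * far n d) \<longlonglongrightarrow> e / 2 + 2 * B * 0"
        by (intro tendsto_intros far_const d(1))
      moreover have "e / 2 + 2 * B * 0 < e"
        using e by simp
      ultimately have "\<forall>\<^sub>F n in sequentially. e / 2 + 2 * B * far n d < e"
        by (rule order_tendstoD)
      then show "\<forall>\<^sub>F n in sequentially. dist (\<integral>x. f x \<partial>distr (M n) borel (R n)) (f T) < e"
        using eventually_ge_at_top[of "CARD('k) + 1"]
      proof eventually_elim
        case (elim n)
        then interpret model_realization "M n" n A \<beta> "X n" "Q n" "R n"
          by (intro model) simp
        have "\<bar>(\<integral>\<omega>. f (R n \<omega>) \<partial>M n) - f T\<bar> \<le> e / 2 + 2 * B * prob {\<omega> \<in> space (M n). d \<le> dist (R n \<omega>) T}"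
          using f B d(2) e by (intro expectation_near_constant measurable_R) (auto simp: dist_real_def intro: less_imp_le)
        then show ?case
          using elim(1) by (simp add: integral_distr[OF measurable_R fm] dist_real_def far_def dist_norm)
      qed
    qed
    then show "(\<lambda>n. \<integral>x. f x \<partial>distr (M n) borel (R n)) \<longlonglongrightarrow> (\<integral>x. f x \<partial>return borel T)"
      using fm by (simp add: integral_return)
  qed
  have chol: "is_right_cholesky (transpose T ** T) R' \<longleftrightarrow> R' = T" for R'
  proof -
    have "is_right_cholesky (transpose T ** T) T"
      using T by (simp add: is_right_cholesky_def)
    then show ?thesis
      using cholesky_unique by blast
  qed
  have opt: "is_optimal \<beta> A S \<longleftrightarrow> S = transpose T ** T" for S
    by (rule optimal_iff[OF T C rate])
  have factors: "(AE \<omega> in M n. full_column_rank n (X n \<omega>) \<and> is_qr n (X n \<omega>) (Q n \<omega>, R n \<omega>)) \<and>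
      indep_rvs (M n) (colmat_space n UNIV) (Q n) borel (R n) \<and>
      (\<forall>\<mu>. is_haar_orthogonal n \<mu> \<longrightarrow>
        distr (M n) (colmat_space n UNIV) (Q n) = distr \<mu> (colmat_space n UNIV) first_cols)"
    if n: "CARD('k) < n" for n
  proof -
    interpret model_realization "M n" n A \<beta> "X n" "Q n" "R n"
      by (rule model[OF n])
    show ?thesis
      using AE_qr indep_QR distr_Q by simp
  qed
  show ?thesis
  proof (intro conjI)
    show "\<exists>Rstar :: 'k sqmat.
        upper_triangular Rstar \<and>
        converges_weakly (\<lambda>n. distr (M n) borel (R n)) (return borel Rstar) \<and>
        (\<forall>b::real. 0 < b \<and> b < 1 / 2 \<longrightarrow>
           (\<lambda>n. measure (M n) {\<omega> \<in> space (M n). norm (R n \<omega> - Rstar) < real n powr (- 1 / 2 + b)})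
             \<longlonglongrightarrow> 1) \<and>
        (\<exists>Sstar :: 'k sqmat.
           (\<forall>S. is_optimal \<beta> A S \<longleftrightarrow> S = Sstar) \<and>
           (\<forall>R'. is_right_cholesky Sstar R' \<longleftrightarrow> R' = Rstar))"
    proof (rule exI[of _ T], intro conjI allI impI exI[of _ "transpose T ** T"])
      show "upper_triangular T" by (rule T(1))
      show "converges_weakly (\<lambda>n. distr (M n) borel (R n)) (return borel T)" by (rule weak)
      show "is_optimal \<beta> A S \<longleftrightarrow> S = transpose T ** T" for S by (rule opt)
      show "is_right_cholesky (transpose T ** T) R' \<longleftrightarrow> R' = T" for R' by (rule chol)
    qed (rule conc, simp)
  qed (use factors haar_exists in auto)
qed

end
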